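(* Let $K$ be a field, $S=K[x_1,\ldots,x_n]$, and let $I$ and $J$ be monomial ideals of $S$. For $k\ge 0$ let $I_k(J)=I^k:J^\infty=\bigcup_{m\ge 1}(I^k:J^m)$, and let $d$ be the limit dimension of the family $(I_k(J)/I^k)_{k\ge 0}$. Then the limit $$\lim_{k\to\infty}\frac{1}{k^{n-d}}\,e_0\!\left(\frac{I_k(J)}{I^k}\right)$$ exists and is a rational number. In particular, the limit $$\lim_{k\to\infty}\frac{1}{k^{n}}\,\ell\!\left(\frac{(I^k)^{\mathrm{sat}}}{I^k}\right)$$ exists and is a rational number, where $(I^k)^{\mathrm{sat}}=I^k:(x_1,\ldots,x_n)^\infty$ and $\ell$ denotes length.
   Context: For a finitely generated graded $S$-module $N$ of dimension $d$, put $H(N,i)=\sum_{j\le i}\dim_K N_j$; for $i\gg 0$ this agrees with a polynomial of degree $d$, written $P_N(x)=\sum_{i=0}^{d}(-1)^i e_i(N)\binom{x+d-i}{d-i}$, and $e_0(N)$ is the multiplicity of $N$ (with $e_0(0)=0$). A family $(M_k)_{k\ge 0}$ of finitely generated $S$-modules has limit dimension $d$ if there is $k_0$ such that $\dim M_k=d$ for all $k\ge k_0$; the family $(I_k(J)/I^k)_{k\ge0}$ is known to have a limit dimension. *)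

theory Defs
  imports
    "HOL-Analysis.Analysis"
    "HOL-Library.Poly_Mapping"
    "HOL-Library.Extended_Real"
    "HOL-Algebra.Ideal_Product"
    "HOL-Algebra.QuotRing"
    "HOL-Computational_Algebra.Polynomial"
    "Jordan_Normal_Form.VS_Connect"
begin

section \<open>Modules over a commutative ring\<close>

text \<open>The zero ring has Krull dimension \<open>-1\<close>. The supremum is taken in \<open>int\<close>, so the value is
  meaningful only for rings of finite Krull dimension.\<close>

definition krull_dim :: "('a, 'b) ring_scheme \<Rightarrow> int" where
  "krull_dim R = Sup (insert (-1) {int r | r.
     \<exists>P. (\<forall>i\<le>r. primeideal (P i) R) \<and> (\<forall>i<r. P i \<subset> P (Suc i))})"

definition annihilator :: "('a, 'c) ring_scheme \<Rightarrow> ('a, 'b, 'd) module_scheme \<Rightarrow> 'a set" where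
  "annihilator R M = {r \<in> carrier R. \<forall>x\<in>carrier M. r \<odot>\<^bsub>M\<^esub> x = \<zero>\<^bsub>M\<^esub>}"

definition module_dim :: "('a, 'c) ring_scheme \<Rightarrow> ('a, 'b, 'd) module_scheme \<Rightarrow> int" where
  "module_dim R M = krull_dim (R Quot (annihilator R M))"

definition module_length :: "('a, 'c) ring_scheme \<Rightarrow> ('a, 'b, 'd) module_scheme \<Rightarrow> enat" where
  "module_length R M = Sup {enat r | r.
     \<exists>N. (\<forall>i\<le>r. Module.submodule (N i) R M) \<and> (\<forall>i<r. N i \<subset> N (Suc i))}"

definition has_limit_dim ::
    "('a, 'c) ring_scheme \<Rightarrow> (nat \<Rightarrow> ('a, 'b, 'd) module_scheme) \<Rightarrow> int \<Rightarrow> bool" where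
  "has_limit_dim R M d \<longleftrightarrow> (\<exists>k\<^sub>0. \<forall>k\<ge>k\<^sub>0. module_dim R (M k) = d)"

text \<open>Module records inherit the fields \<open>mult\<close> and \<open>one\<close> from ring records; no notion of module
  theory refers to them, and they are left unspecified in quotient modules.\<close>

definition quot_module :: "('a, 'b, 'd) module_scheme \<Rightarrow> 'b set \<Rightarrow> ('a, 'b set) module" where
  "quot_module M N =
     \<lparr>carrier = a_rcosets\<^bsub>M\<^esub> N, mult = undefined, one = undefined, zero = N, add = set_add M,
      smult = (\<lambda>r X. \<Union>x\<in>X. N +>\<^bsub>M\<^esub> (r \<odot>\<^bsub>M\<^esub> x))\<rparr>"

definition ideal_module :: "('a, 'c) ring_scheme \<Rightarrow> 'a set \<Rightarrow> ('a, 'a) module" where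
  "ideal_module R A =
     \<lparr>carrier = A, mult = mult R, one = one R, zero = zero R, add = add R, smult = mult R\<rparr>"


section \<open>Ideal operations\<close>

definition ideal_power :: "('a, 'c) ring_scheme \<Rightarrow> 'a set \<Rightarrow> nat \<Rightarrow> 'a set" where
  "ideal_power R I k = I [^]\<^bsub>ideals_set R\<^esub> k"

definition ideal_colon :: "('a, 'c) ring_scheme \<Rightarrow> 'a set \<Rightarrow> 'a set \<Rightarrow> 'a set" where
  "ideal_colon R I J = {r \<in> carrier R. \<forall>x\<in>J. r \<otimes>\<^bsub>R\<^esub> x \<in> I}"

definition ideal_saturation :: "('a, 'c) ring_scheme \<Rightarrow> 'a set \<Rightarrow> 'a set \<Rightarrow> 'a set" where
  "ideal_saturation R I J = (\<Union>m\<in>{1..}. ideal_colon R I (ideal_power R J m))"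


section \<open>The polynomial ring and its graded modules\<close>

text \<open>The variables are indexed by the finite type \<open>'n\<close>, so their number is \<open>CARD('n)\<close>.
  A monomial is represented by its exponent vector.\<close>

type_synonym ('n, 'k) mpoly = "('n \<Rightarrow>\<^sub>0 nat) \<Rightarrow>\<^sub>0 'k"

abbreviation mpoly_ring :: "('n, 'k::field) mpoly ring" where
  "mpoly_ring \<equiv> class_ring"

definition mconst :: "'k \<Rightarrow> ('n, 'k::field) mpoly" where
  "mconst c = Poly_Mapping.single 0 c"

definition mvar :: "'n \<Rightarrow> ('n, 'k::field) mpoly" where
  "mvar i = Poly_Mapping.single (Poly_Mapping.single i 1) 1"

definition monomial :: "('n \<Rightarrow>\<^sub>0 nat) \<Rightarrow> ('n, 'k::field) mpoly" where
  "monomial m = Poly_Mapping.single m 1"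

definition monomial_ideal :: "('n, 'k::field) mpoly set \<Rightarrow> bool" where
  "monomial_ideal I \<longleftrightarrow> (\<exists>E. I = genideal mpoly_ring (monomial ` E))"

definition irrelevant_ideal :: "('n, 'k::field) mpoly set" where
  "irrelevant_ideal = genideal mpoly_ring (range mvar)"

definition homogeneous_part :: "nat \<Rightarrow> ('n::finite, 'k::field) mpoly set" where
  "homogeneous_part j =
     {p. \<forall>m\<in>Poly_Mapping.keys p. (\<Sum>i\<in>UNIV. Poly_Mapping.lookup m i) = j}"

text \<open>A module together with its homogeneous components. All modules considered here are
  subquotients of the polynomial ring, so only degrees \<open>j \<ge> 0\<close> occur.\<close>

record ('a, 'b) graded_module = "('a, 'b) module" +
  component :: "nat \<Rightarrow> 'b set"

definition graded_quot :: "('n::finite, 'k::field) mpoly set \<Rightarrow> ('n, 'k) mpoly set \<Rightarrow>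
    (('n, 'k) mpoly, ('n, 'k) mpoly set) graded_module" where
  "graded_quot A B =
     module.extend (quot_module (ideal_module mpoly_ring A) B)
       (graded_module.fields (\<lambda>j. (\<lambda>a. B +>\<^bsub>mpoly_ring\<^esub> a) ` (A \<inter> homogeneous_part j)))"

definition component_space ::
    "(('n, 'k::field) mpoly, 'b, 'd) graded_module_scheme \<Rightarrow> nat \<Rightarrow> ('k, 'b) module" where
  "component_space N j =
     \<lparr>carrier = component N j, mult = mult N, one = one N, zero = zero N, add = add N,
      smult = (\<lambda>c x. mconst c \<odot>\<^bsub>N\<^esub> x)\<rparr>"

definition hilbert_fun ::
    "(('n, 'k::field) mpoly, 'b, 'd) graded_module_scheme \<Rightarrow> nat \<Rightarrow> nat" where
  "hilbert_fun N i = (\<Sum>j\<le>i. vectorspace.dim (class_ring :: 'k ring) (component_space N j))"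

definition hilbert_poly ::
    "(('n, 'k::field) mpoly, 'b, 'd) graded_module_scheme \<Rightarrow> rat poly" where
  "hilbert_poly N =
     (THE P. \<forall>\<^sub>F i in sequentially. of_nat (hilbert_fun N i) = poly P (of_nat i))"

definition hilbert_coeff ::
    "(('n, 'k::field) mpoly, 'b, 'd) graded_module_scheme \<Rightarrow> nat \<Rightarrow> rat" where
  "hilbert_coeff N = (let d = nat (module_dim mpoly_ring N) in
     THE e. (\<forall>x. poly (hilbert_poly N) x =
               (\<Sum>i\<le>d. (-1) ^ i * e i * ((x + of_nat (d - i)) gchoose (d - i)))) \<and>
            (\<forall>i>d. e i = 0))"

definition multiplicity_e0 ::
    "(('n, 'k::field) mpoly, 'b, 'd) graded_module_scheme \<Rightarrow> rat" where
  "multiplicity_e0 N = (if carrier N = {\<zero>\<^bsub>N\<^esub>} then 0 else hilbert_coeff N 0)"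

end

theory Submission
  imports Defs
begin

text \<open>
  Let \<open>E\<close> and \<open>J\<close> be the exponents of finitely many monomial generators of the two ideals. A monomial
  with exponent \<open>a\<close> lies in \<open>I\<^sup>k\<close> iff \<open>a\<close> dominates a sum of \<open>k\<close> elements of \<open>E\<close>, and in its
  saturation iff for every \<open>f \<in> J\<close> this becomes true after the coordinates in the support of \<open>f\<close> are
  ignored. If \<open>B\<close> bounds the entries of \<open>E\<close>, both conditions depend only on the truncation of \<open>a\<close> at
  \<open>B k\<close>. Hence the Hilbert function of the quotient is a finite sum of binomial coefficients, and its
  multiplicity counts the exponents \<open>b \<le> B k\<close> in the difference having exactly \<open>d\<close> coordinates equal
  to \<open>B k\<close>.

  Such a count, divided by the appropriate power of \<open>k\<close>, is the Lebesgue measure of a union of cubes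
  of side \<open>1/k\<close>, and by dominated convergence it tends to the volume of a bounded difference of rational
  polyhedra. This volume is rational because iterated integration preserves piecewise polynomial
  functions with rational data.

  The definition of \<open>e\<^sub>0\<close> refers to the Krull dimension as a supremum of integers. The only facts needed
  about it are that chains of primes in the polynomial ring are bounded in length and that the
  quotient has at least the dimension seen by its monomials: if \<open>d\<close> exceeds the latter, then both
  \<open>e\<^sub>0\<close> and the limit vanish.
\<close>

section \<open>Rational polyhedra\<close>

text \<open>The exponents of \<open>I^k\<close> need not be all lattice points of \<open>k\<close>
  times the Newton polyhedron, because \<open>I^k\<close> need not be integrally closed. No exact
  count in a dilated polytope is available, only agreement away from the boundary. Hence convergence
  is almost everywhere and a volume takes the place of an Ehrhart type formula: a point outside the
  polyhedron is never counted, and a point that stays inside after a small diagonal shift is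
  eventually always counted. The level \<open>B k\<close> comes from the fact that a sum of
  \<open>k\<close> generators has entries at most \<open>B k\<close>: a coordinate that reaches this
  level imposes no condition, so an entry of the truncated exponent equal to \<open>B k\<close> is a
  free direction. A truncated exponent with \<open>m\<close> free directions contributes a
  polynomial of degree \<open>m\<close> with leading coefficient \<open>1/m!\<close>, which is why
  only \<open>m = d\<close> matters for the multiplicity. The number of free directions is compared
  with \<open>d\<close> by an inequality only. This suffices because the Hilbert polynomial can be
  expanded in degree \<open>d\<close> even if its own degree is smaller; the leading coefficient is
  then 0.\<close>

inductive affine_rat :: "(('v \<Rightarrow> real) \<Rightarrow> real) \<Rightarrow> bool" where
  affine_rat_const: "c \<in> \<rat> \<Longrightarrow> affine_rat (\<lambda>_. c)"
| affine_rat_var: "affine_rat (\<lambda>x. x v)"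
| affine_rat_add: "affine_rat f \<Longrightarrow> affine_rat g \<Longrightarrow> affine_rat (\<lambda>x. f x + g x)"
| affine_rat_scale: "c \<in> \<rat> \<Longrightarrow> affine_rat f \<Longrightarrow> affine_rat (\<lambda>x. c * f x)"

lemma affine_rat_uminus: "affine_rat f \<Longrightarrow> affine_rat (\<lambda>x. - f x)"
  using affine_rat_scale[of "-1" f] by simp

lemma affine_rat_diff: "affine_rat f \<Longrightarrow> affine_rat g \<Longrightarrow> affine_rat (\<lambda>x. f x - g x)"
  using affine_rat_add[OF _ affine_rat_uminus, of f g] by simp

lemma affine_rat_sum:
  "(\<And>i. i \<in> A \<Longrightarrow> affine_rat (f i)) \<Longrightarrow> affine_rat (\<lambda>x. \<Sum>i\<in>A. f i x)"
proof (induction A rule: infinite_finite_induct)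
  case (insert a A)
  have "affine_rat (\<lambda>x. f a x + (\<Sum>i\<in>A. f i x))"
    using insert by (intro affine_rat_add) auto
  then show ?case using insert by simp
qed (auto intro: affine_rat_const)

lemma affine_rat_subst:
  assumes "affine_rat f" and "\<And>v. affine_rat (\<lambda>x. s x v)"
  shows "affine_rat (\<lambda>x. f (s x))"
  using assms by (induction rule: affine_rat.induct) (auto intro: affine_rat.intros)

text \<open>Singles out one variable; elimination and integration in \<open>v\<close> both start
  from this form. Independence of \<open>v\<close> is expressed as invariance under updates at
  \<open>v\<close>.\<close>

lemma affine_rat_split:
  assumes "affine_rat f"
  obtains \<alpha> g where "\<alpha> \<in> \<rat>" "affine_rat g" "\<And>x y. g (x(v := y)) = g x"
    "\<And>x. f x = \<alpha> * x v + g x"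
proof -
  have "\<exists>\<alpha> g. \<alpha> \<in> \<rat> \<and> affine_rat g \<and> (\<forall>x y. g (x(v := y)) = g x) \<and> (\<forall>x. f x = \<alpha> * x v + g x)"
    using assms
  proof (induction rule: affine_rat.induct)
    case (affine_rat_const c)
    then show ?case by (intro exI[of _ 0] exI[of _ "\<lambda>_. c"]) (auto intro: affine_rat.intros)
  next
    case (affine_rat_var w)
    show ?case
    proof (cases "w = v")
      case True
      then show ?thesis by (intro exI[of _ 1] exI[of _ "\<lambda>_. 0"]) (auto intro: affine_rat.intros)
    next
      case False
      then show ?thesis by (intro exI[of _ 0] exI[of _ "\<lambda>x. x w"]) (auto intro: affine_rat.intros)
    qed
  next
    case (affine_rat_add f1 f2)
    then obtain \<alpha>1 g1 \<alpha>2 g2 where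
      "\<alpha>1 \<in> \<rat>" "affine_rat g1" "\<forall>x y. g1 (x(v := y)) = g1 x" "\<forall>x. f1 x = \<alpha>1 * x v + g1 x"
      "\<alpha>2 \<in> \<rat>" "affine_rat g2" "\<forall>x y. g2 (x(v := y)) = g2 x" "\<forall>x. f2 x = \<alpha>2 * x v + g2 x"
      by blast
    then show ?case
      by (intro exI[of _ "\<alpha>1 + \<alpha>2"] exI[of _ "\<lambda>x. g1 x + g2 x"])
         (auto intro: affine_rat.intros simp: algebra_simps simp del: fun_upd_apply)
  next
    case (affine_rat_scale c f1)
    then obtain \<alpha>1 g1 where
      "\<alpha>1 \<in> \<rat>" "affine_rat g1" "\<forall>x y. g1 (x(v := y)) = g1 x" "\<forall>x. f1 x = \<alpha>1 * x v + g1 x"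
      by blast
    then show ?case using affine_rat_scale(1)
      by (intro exI[of _ "c * \<alpha>1"] exI[of _ "\<lambda>x. c * g1 x"])
         (auto intro: affine_rat.intros simp: algebra_simps simp del: fun_upd_apply)
  qed
  then show ?thesis using that by blast
qed

text \<open>The index type is left arbitrary so that elimination can run over a type that also
  contains one variable per exponent vector.\<close>

definition polyhedron_rat :: "('v \<Rightarrow> real) set \<Rightarrow> bool" where
  "polyhedron_rat S \<longleftrightarrow>
     (\<exists>L. finite L \<and> (\<forall>f\<in>L. affine_rat f) \<and> S = {x. \<forall>f\<in>L. 0 \<le> f x})"

lemma polyhedron_rat_halfspace: "affine_rat f \<Longrightarrow> polyhedron_rat {x. 0 \<le> f x}"
  unfolding polyhedron_rat_def by (intro exI[of _ "{f}"]) auto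

lemma polyhedron_rat_Int:
  assumes "polyhedron_rat S" "polyhedron_rat T"
  shows "polyhedron_rat (S \<inter> T)"
proof -
  obtain L1 L2 where "finite L1" "\<forall>f\<in>L1. affine_rat f" "S = {x. \<forall>f\<in>L1. 0 \<le> f x}"
    "finite L2" "\<forall>f\<in>L2. affine_rat f" "T = {x. \<forall>f\<in>L2. 0 \<le> f x}"
    using assms unfolding polyhedron_rat_def by blast
  then show ?thesis unfolding polyhedron_rat_def by (intro exI[of _ "L1 \<union> L2"]) auto
qed

lemma polyhedron_rat_UNIV: "polyhedron_rat UNIV"
  unfolding polyhedron_rat_def by (intro exI[of _ "{}"]) auto

lemma polyhedron_rat_INT:
  "finite A \<Longrightarrow> (\<And>i. i \<in> A \<Longrightarrow> polyhedron_rat (S i)) \<Longrightarrow> polyhedron_rat (\<Inter>i\<in>A. S i)"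
  by (induction A rule: finite_induct) (auto intro: polyhedron_rat_UNIV polyhedron_rat_Int)

lemma polyhedron_rat_subst:
  assumes "polyhedron_rat S" and "\<And>v. affine_rat (\<lambda>x. s x v)"
  shows "polyhedron_rat {x. s x \<in> S}"
proof -
  obtain L where "finite L" "\<forall>f\<in>L. affine_rat f" "S = {x. \<forall>f\<in>L. 0 \<le> f x}"
    using assms(1) unfolding polyhedron_rat_def by blast
  then show ?thesis unfolding polyhedron_rat_def
    by (intro exI[of _ "(\<lambda>f x. f (s x)) ` L"]) (auto intro: affine_rat_subst assms(2))
qed

lemma ex_between_finite:
  fixes A B :: "real set"
  assumes "finite A" "finite B" "\<And>a b. a \<in> A \<Longrightarrow> b \<in> B \<Longrightarrow> a \<le> b"
  shows "\<exists>y. (\<forall>a\<in>A. a \<le> y) \<and> (\<forall>b\<in>B. y \<le> b)"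
proof (cases "A = {}")
  case True
  then show ?thesis using assms(2) by (cases "B = {}") (auto intro!: exI[of _ "Min B"])
next
  case False
  then show ?thesis using assms by (intro exI[of _ "Max A"]) auto
qed

text \<open>Fourier--Motzkin elimination.\<close>

lemma polyhedron_rat_project:
  assumes "polyhedron_rat S"
  shows "polyhedron_rat {x. \<exists>y. x(v := y) \<in> S}"
proof -
  obtain L where L: "finite L" "\<forall>f\<in>L. affine_rat f" "S = {x. \<forall>f\<in>L. 0 \<le> f x}"
    using assms unfolding polyhedron_rat_def by blast
  have "\<forall>f\<in>L. \<exists>\<alpha> g. \<alpha> \<in> \<rat> \<and> affine_rat g \<and> (\<forall>x y. g (x(v := y)) = g x) \<and> (\<forall>x. f x = \<alpha> * x v + g x)"
    using L(2) affine_rat_split by metis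
  then obtain \<alpha> g where ag: "\<And>f. f \<in> L \<Longrightarrow> \<alpha> f \<in> \<rat>" "\<And>f. f \<in> L \<Longrightarrow> affine_rat (g f)"
    "\<And>f x y. f \<in> L \<Longrightarrow> g f (x(v := y)) = g f x" "\<And>f x. f \<in> L \<Longrightarrow> f x = \<alpha> f * x v + g f x"
    by metis
  define Z where "Z = {f\<in>L. \<alpha> f = 0}"
  define P where "P = {f\<in>L. \<alpha> f > 0}"
  define N where "N = {f\<in>L. \<alpha> f < 0}"
  \<comment> \<open>\<open>p\<close> bounds the eliminated variable from below and \<open>q\<close>
    from above; this positive combination cancels it and says that the two bounds are
    compatible.\<close>
  define h where "h = (\<lambda>(p, q) x. \<alpha> p * g q x - \<alpha> q * g p x)"
  have fin: "finite Z" "finite P" "finite N" using L(1) by (auto simp: Z_def P_def N_def)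
  have val: "f (x(v := y)) = \<alpha> f * y + g f x" if "f \<in> L" for f x y
    using ag(3,4)[OF that] by simp
  have iff: "(\<exists>y. x(v := y) \<in> S) \<longleftrightarrow> (\<forall>f \<in> g ` Z \<union> h ` (P \<times> N). 0 \<le> f x)" for x
  proof
    assume "\<exists>y. x(v := y) \<in> S"
    then obtain y where "\<forall>f\<in>L. 0 \<le> f (x(v := y))" using L(3) by auto
    then have y: "0 \<le> \<alpha> f * y + g f x" if "f \<in> L" for f
      using that val[OF that, of x y] by fastforce
    have "0 \<le> \<alpha> p * g q x - \<alpha> q * g p x" if "p \<in> P" "q \<in> N" for p q
    proof -
      have "0 \<le> \<alpha> p * (\<alpha> q * y + g q x)" "0 \<le> - \<alpha> q * (\<alpha> p * y + g p x)"
        using that y[of p] y[of q] by (auto simp: P_def N_def mult_nonpos_nonneg)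
      then show ?thesis by (simp add: algebra_simps)
    qed
    moreover have "0 \<le> g f x" if "f \<in> Z" for f using y[of f] that by (auto simp: Z_def)
    ultimately show "\<forall>f \<in> g ` Z \<union> h ` (P \<times> N). 0 \<le> f x" by (auto simp: h_def)
  next
    assume a: "\<forall>f \<in> g ` Z \<union> h ` (P \<times> N). 0 \<le> f x"
    have "- g p x / \<alpha> p \<le> - g q x / \<alpha> q" if "p \<in> P" "q \<in> N" for p q
    proof -
      have "0 \<le> \<alpha> p * g q x - \<alpha> q * g p x" 
      proof -
        have "h (p, q) \<in> g ` Z \<union> h ` (P \<times> N)" using that by blast
        then have "0 \<le> h (p, q) x" using a by blast
        then show ?thesis by (simp add: h_def)
      qed
      then show ?thesis using that by (auto simp: P_def N_def field_simps)
    qed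
    then have "\<exists>y. (\<forall>a\<in>(\<lambda>p. - g p x / \<alpha> p) ` P. a \<le> y) \<and> (\<forall>b\<in>(\<lambda>q. - g q x / \<alpha> q) ` N. y \<le> b)"
      using fin by (intro ex_between_finite) auto
    then obtain y where y: "\<And>p. p \<in> P \<Longrightarrow> - g p x / \<alpha> p \<le> y" "\<And>q. q \<in> N \<Longrightarrow> y \<le> - g q x / \<alpha> q"
      by auto
    have "0 \<le> \<alpha> f * y + g f x" if fL: "f \<in> L" for f
    proof -
      consider "f \<in> Z" | "f \<in> P" | "f \<in> N"
        using fL by (force simp: Z_def P_def N_def)
      then show ?thesis
      proof cases
        case 1 then show ?thesis using a by (auto simp: Z_def)
      next
        case 2 then show ?thesis using y(1)[of f] by (auto simp: P_def field_simps)
      next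
        case 3 then show ?thesis using y(2)[of f] by (auto simp: N_def field_simps)
      qed
    qed
    then have "0 \<le> f (x(v := y))" if "f \<in> L" for f
      using that val[OF that, of x y] by fastforce
    then show "\<exists>y. x(v := y) \<in> S" using L(3) by auto
  qed
  have "affine_rat f" if "f \<in> g ` Z \<union> h ` (P \<times> N)" for f
    using that ag(1,2)
    by (auto simp: h_def Z_def P_def N_def intro!: affine_rat_diff affine_rat_scale)
  moreover have "finite (g ` Z \<union> h ` (P \<times> N))" using fin by simp
  ultimately show ?thesis unfolding polyhedron_rat_def iff by (intro exI conjI refl) auto
qed

text \<open>Only the values of \<open>z\<close> on \<open>V\<close> are read, so the quantifier over
  functions stands for one real quantifier per element of \<open>V\<close>, and these are eliminated
  one at a time.\<close>

lemma polyhedron_rat_project_finite: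
  assumes "finite V" "polyhedron_rat S"
  shows "polyhedron_rat {x. \<exists>z. (\<lambda>v. if v \<in> V then z v else x v) \<in> S}"
  using assms(1)
proof (induction V rule: finite_induct)
  case empty
  then show ?case using assms(2) by simp
next
  case (insert v V)
  have "(\<exists>z. (\<lambda>w. if w \<in> insert v V then z w else x w) \<in> S) \<longleftrightarrow>
        (\<exists>y z. (\<lambda>w. if w \<in> V then z w else (x(v := y)) w) \<in> S)" (is "?l \<longleftrightarrow> ?r") for x
  proof
    assume ?l
    then obtain z where z: "(\<lambda>w. if w \<in> insert v V then z w else x w) \<in> S" by blast
    have "(\<lambda>w. if w \<in> V then z w else (x(v := z v)) w) = (\<lambda>w. if w \<in> insert v V then z w else x w)"
      by auto
    then show ?r using z by metis
  next
    assume ?r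
    then obtain y z where z: "(\<lambda>w. if w \<in> V then z w else (x(v := y)) w) \<in> S" by blast
    have "(\<lambda>w. if w \<in> V then z w else (x(v := y)) w) =
      (\<lambda>w. if w \<in> insert v V then (z(v := y)) w else x w)"
      using insert by auto
    then show ?l using z by metis
  qed
  then show ?case using polyhedron_rat_project[OF insert.IH, of v] by simp
qed

section \<open>Newton polyhedra\<close>

text \<open>For finite \<open>E\<close> this is the Newton polyhedron, the convex hull of
  \<open>E\<close> plus the nonnegative orthant. It is empty if \<open>E\<close> is, since the
  weights must add up to 1.\<close>

definition newton_set :: "('n \<Rightarrow> nat) set \<Rightarrow> ('n \<Rightarrow> real) set" where
  "newton_set E = {x. \<exists>l::('n \<Rightarrow> nat) \<Rightarrow> real. (\<forall>e\<in>E. 0 \<le> l e) \<and> (\<Sum>e\<in>E. l e) = 1 \<and>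
     (\<forall>i. (\<Sum>e\<in>E. l e * real (e i)) \<le> x i)}"

text \<open>Fresh variables \<open>Inr e\<close> carry the convex weights, which makes all
  conditions linear in position and weights jointly; eliminating the weights leaves a polyhedron in
  the variables \<open>Inl i\<close>.\<close>

lemma polyhedron_rat_newton_set:
  fixes E :: "('n::finite \<Rightarrow> nat) set"
  assumes "finite E"
  shows "polyhedron_rat (newton_set E)"
proof -
  define S :: "('n + ('n \<Rightarrow> nat) \<Rightarrow> real) set" where
    "S = (\<Inter>e\<in>E. {x. 0 \<le> x (Inr e)}) \<inter> {x. 0 \<le> (\<Sum>e\<in>E. x (Inr e)) - 1} \<inter>
         {x. 0 \<le> 1 - (\<Sum>e\<in>E. x (Inr e))} \<inter>
         (\<Inter>i. {x. 0 \<le> x (Inl i) - (\<Sum>e\<in>E. real (e i) * x (Inr e))})"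
  have "polyhedron_rat S"
    unfolding S_def using assms
    by (intro polyhedron_rat_Int polyhedron_rat_INT polyhedron_rat_halfspace affine_rat_diff
        affine_rat_sum affine_rat_scale affine_rat_var affine_rat_const) auto
  then have "polyhedron_rat {x. \<exists>z. (\<lambda>v. if v \<in> Inr ` E then z v else x v) \<in> S}"
    using assms by (intro polyhedron_rat_project_finite) auto
  \<comment> \<open>Returns to the original variables. The weights have been eliminated, so the
    value 0 put in their place is immaterial.\<close>
  then have "polyhedron_rat {x. case_sum x (\<lambda>_. 0) \<in> {x. \<exists>z. (\<lambda>v. if v \<in> Inr ` E then z v else x v) \<in> S}}"
  proof (rule polyhedron_rat_subst)
    show "affine_rat (\<lambda>x::'n \<Rightarrow> real. case_sum x (\<lambda>_. 0) v)" for v :: "'n + ('n \<Rightarrow> nat)"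
      by (cases v) (auto intro: affine_rat.intros)
  qed
  also have "{x. case_sum x (\<lambda>_. 0) \<in> {x. \<exists>z. (\<lambda>v. if v \<in> Inr ` E then z v else x v) \<in> S}} = newton_set E"
    (is "?A = _")
  proof (rule Set.set_eqI)
    fix x
    have "x \<in> ?A \<longleftrightarrow> (\<exists>z :: 'n + ('n \<Rightarrow> nat) \<Rightarrow> real. (\<forall>e\<in>E. 0 \<le> z (Inr e)) \<and> (\<Sum>e\<in>E. z (Inr e)) = 1 \<and>
       (\<forall>i. (\<Sum>e\<in>E. real (e i) * z (Inr e)) \<le> x i))"
      by (simp add: S_def image_iff, rule iff_exI, auto)
    also have "\<dots> \<longleftrightarrow> x \<in> newton_set E" (is "?l \<longleftrightarrow> _")
    proof
      assume ?l
      then obtain z :: "'n + ('n \<Rightarrow> nat) \<Rightarrow> real" where "(\<forall>e\<in>E. 0 \<le> z (Inr e)) \<and> (\<Sum>e\<in>E. z (Inr e)) = 1 \<and>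
       (\<forall>i. (\<Sum>e\<in>E. real (e i) * z (Inr e)) \<le> x i)" by blast
      then show "x \<in> newton_set E" unfolding newton_set_def
        by (intro CollectI exI[of _ "\<lambda>e. z (Inr e)"]) (simp add: mult.commute)
    next
      assume "x \<in> newton_set E"
      then obtain l where "(\<forall>e\<in>E. 0 \<le> l e) \<and> (\<Sum>e\<in>E. l e) = 1 \<and>
       (\<forall>i. (\<Sum>e\<in>E. l e * real (e i)) \<le> x i)" unfolding newton_set_def by blast
      then show ?l
        by (intro exI[of _ "case_sum (\<lambda>_. 0) l"]) (simp add: mult.commute)
    qed
    finally show "x \<in> ?A \<longleftrightarrow> x \<in> newton_set E" .
  qed
  finally show ?thesis .
qed

section \<open>Piecewise polynomial functions and rational volumes\<close>

text \<open>Polynomials are built by multiplying with one affine factor at a time, which is the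
  shape consumed by the induction for antiderivatives.\<close>

inductive poly_rat :: "(('v \<Rightarrow> real) \<Rightarrow> real) \<Rightarrow> bool" where
  poly_rat_const: "c \<in> \<rat> \<Longrightarrow> poly_rat (\<lambda>_. c)"
| poly_rat_add: "poly_rat f \<Longrightarrow> poly_rat g \<Longrightarrow> poly_rat (\<lambda>x. f x + g x)"
| poly_rat_mult: "affine_rat a \<Longrightarrow> poly_rat f \<Longrightarrow> poly_rat (\<lambda>x. a x * f x)"

lemma poly_rat_scale: "c \<in> \<rat> \<Longrightarrow> poly_rat f \<Longrightarrow> poly_rat (\<lambda>x. c * f x)"
  using poly_rat_mult[OF affine_rat_const] .

lemma poly_rat_diff: "poly_rat f \<Longrightarrow> poly_rat g \<Longrightarrow> poly_rat (\<lambda>x. f x - g x)"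
  using poly_rat_add[of f "\<lambda>x. - 1 * g x"] poly_rat_scale[of "-1" g] by simp

lemma poly_rat_var_power: "c \<in> \<rat> \<Longrightarrow> poly_rat (\<lambda>x. c * x v ^ m)"
proof (induction m)
  case (Suc m)
  then show ?case using poly_rat_mult[OF affine_rat_var[of v] Suc.IH] by (simp add: mult_ac)
qed (simp add: poly_rat_const)

lemma poly_rat_subst:
  assumes "poly_rat f" and "\<And>v. affine_rat (\<lambda>x. s x v)"
  shows "poly_rat (\<lambda>x. f (s x))"
  using assms(1)
proof (induction rule: poly_rat.induct)
  case (poly_rat_mult a f)
  show ?case by (rule poly_rat.poly_rat_mult[OF affine_rat_subst[OF poly_rat_mult(1) assms(2)] poly_rat_mult.IH])
qed (rule poly_rat.intros; assumption)+

text \<open>The weight \<open>y ^ m\<close> carries the induction: for a factor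
  \<open>\<alpha> * x v + g x\<close> the first summand raises \<open>m\<close> by one and the
  second is constant in \<open>v\<close>, so integration by parts is avoided.\<close>

lemma poly_rat_antiderivative:
  assumes "poly_rat p"
  shows "\<exists>P. poly_rat P \<and>
    (\<forall>x y. ((\<lambda>y. P (x(v := y))) has_real_derivative p (x(v := y)) * y ^ m) (at y))"
  using assms
proof (induction arbitrary: m rule: poly_rat.induct)
  case (poly_rat_const c)
  have "((\<lambda>y. c / real (Suc m) * y ^ Suc m) has_real_derivative c * y ^ m) (at y)" for y
    by (rule derivative_eq_intros refl | simp)+
  moreover have "poly_rat (\<lambda>x. c / real (Suc m) * x v ^ Suc m)"
    using poly_rat_const by (intro poly_rat_var_power Rats_divide) auto
  ultimately show ?case by (intro exI[of _ "\<lambda>x. c / real (Suc m) * x v ^ Suc m"]) simp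
next
  case (poly_rat_add f g)
  obtain F where F: "poly_rat F"
    "\<forall>x y. ((\<lambda>y. F (x(v := y))) has_real_derivative f (x(v := y)) * y ^ m) (at y)"
    using poly_rat_add.IH(1)[of m] by blast
  obtain G where G: "poly_rat G"
    "\<forall>x y. ((\<lambda>y. G (x(v := y))) has_real_derivative g (x(v := y)) * y ^ m) (at y)"
    using poly_rat_add.IH(2)[of m] by blast
  have "((\<lambda>y. F (x(v := y)) + G (x(v := y))) has_real_derivative
      (f (x(v := y)) + g (x(v := y))) * y ^ m) (at y)" for x y
    unfolding distrib_right by (rule DERIV_add[OF F(2)[rule_format] G(2)[rule_format]])
  then show ?case
    by (intro exI[of _ "\<lambda>x. F x + G x"] conjI poly_rat.poly_rat_add F(1) G(1) allI)
next
  case (poly_rat_mult a f)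
  obtain \<alpha> g where ag: "\<alpha> \<in> \<rat>" "affine_rat g" "\<And>x y. g (x(v := y)) = g x" "\<And>x. a x = \<alpha> * x v + g x"
    using affine_rat_split[OF poly_rat_mult(1)] by metis
  obtain F where F: "poly_rat F"
    "\<forall>x y. ((\<lambda>y. F (x(v := y))) has_real_derivative f (x(v := y)) * y ^ m) (at y)"
    using poly_rat_mult.IH[of m] by blast
  obtain G where G: "poly_rat G"
    "\<forall>x y. ((\<lambda>y. G (x(v := y))) has_real_derivative f (x(v := y)) * y ^ Suc m) (at y)"
    using poly_rat_mult.IH[of "Suc m"] by blast
  have "((\<lambda>y. \<alpha> * G (x(v := y)) + g (x(v := y)) * F (x(v := y))) has_real_derivative
      a (x(v := y)) * f (x(v := y)) * y ^ m) (at y)" for x y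
  proof -
    have "((\<lambda>y. \<alpha> * G (x(v := y)) + g x * F (x(v := y))) has_real_derivative
      \<alpha> * (f (x(v := y)) * y ^ Suc m) + g x * (f (x(v := y)) * y ^ m)) (at y)"
      by (intro DERIV_add DERIV_cmult F(2)[rule_format] G(2)[rule_format])
    moreover have "a (x(v := y)) = \<alpha> * y + g x" using ag(3,4) by simp
    ultimately show ?thesis by (simp add: ag(3) algebra_simps del: fun_upd_apply)
  qed
  then show ?case
    by (intro exI[of _ "\<lambda>x. \<alpha> * G x + g x * F x"] conjI allI poly_rat.poly_rat_add
        poly_rat_scale poly_rat.poly_rat_mult F(1) G(1) ag(1,2))
qed

section \<open>Integration of piecewise polynomial functions\<close>

text \<open>A decision tree with affine sign tests at the nodes and polynomials at the leaves. No
  common subdivision of the space has to be formed, and integration follows the recursion of the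
  tree.\<close>

inductive piecewise_poly :: "(('v \<Rightarrow> real) \<Rightarrow> real) \<Rightarrow> bool" where
  piecewise_poly_leaf: "poly_rat f \<Longrightarrow> piecewise_poly f"
| piecewise_poly_node: "affine_rat a \<Longrightarrow> piecewise_poly f \<Longrightarrow> piecewise_poly g \<Longrightarrow>
    piecewise_poly (\<lambda>x. if 0 \<le> a x then f x else g x)"

text \<open>A copy of the tree of \<open>g\<close> is hung below every leaf of the tree of
  \<open>f\<close>.\<close>

lemma piecewise_poly_add:
  assumes "piecewise_poly f" "piecewise_poly g"
  shows "piecewise_poly (\<lambda>x. f x + g x)"
  using assms
proof (induction arbitrary: g rule: piecewise_poly.induct)
  case (piecewise_poly_leaf f)
  show ?case using piecewise_poly_leaf(2,1)
  proof (induction rule: piecewise_poly.induct)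
    case (piecewise_poly_leaf g)
    then show ?case by (intro piecewise_poly.piecewise_poly_leaf poly_rat_add)
  next
    case (piecewise_poly_node a g1 g2)
    then have "piecewise_poly (\<lambda>x. if 0 \<le> a x then f x + g1 x else f x + g2 x)"
      by (intro piecewise_poly.piecewise_poly_node) auto
    moreover have "(\<lambda>x. if 0 \<le> a x then f x + g1 x else f x + g2 x) =
      (\<lambda>x. f x + (if 0 \<le> a x then g1 x else g2 x))" by auto
    ultimately show ?case by simp
  qed
next
  case (piecewise_poly_node a f1 f2)
  then have "piecewise_poly (\<lambda>x. if 0 \<le> a x then f1 x + g x else f2 x + g x)"
    by (intro piecewise_poly.piecewise_poly_node) auto
  moreover have "(\<lambda>x. if 0 \<le> a x then f1 x + g x else f2 x + g x) =
    (\<lambda>x. (if 0 \<le> a x then f1 x else f2 x) + g x)" by auto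
  ultimately show ?case by simp
qed

text \<open>The conjunction of tests becomes a chain of nodes whose failing branches all lead to
  \<open>g\<close>.\<close>

lemma piecewise_poly_indicator:
  assumes "polyhedron_rat S" "piecewise_poly f" "piecewise_poly g"
  shows "piecewise_poly (\<lambda>x. if x \<in> S then f x else g x)"
proof -
  obtain L where L: "finite L" "\<forall>f\<in>L. affine_rat f" "S = {x. \<forall>f\<in>L. 0 \<le> f x}"
    using assms(1) unfolding polyhedron_rat_def by blast
  have "piecewise_poly (\<lambda>x. if (\<forall>f\<in>L. 0 \<le> f x) then f x else g x)"
    using L(1,2)
  proof (induction L rule: finite_induct)
    case (insert a L)
    have "piecewise_poly (\<lambda>x. if 0 \<le> a x then (if (\<forall>f\<in>L. 0 \<le> f x) then f x else g x) else g x)"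
      using insert assms by (intro piecewise_poly_node) auto
    moreover have "(\<lambda>x. if 0 \<le> a x then (if (\<forall>f\<in>L. 0 \<le> f x) then f x else g x) else g x) =
      (\<lambda>x. if (\<forall>f\<in>insert a L. 0 \<le> f x) then f x else g x)" by auto
    ultimately show ?case by simp
  qed (use assms in simp)
  then show ?thesis using L(3) by simp
qed

lemma affine_rat_at_zero: "affine_rat f \<Longrightarrow> f (\<lambda>_. 0) \<in> \<rat>"
  by (induction rule: affine_rat.induct) auto

lemma poly_rat_at_zero: "poly_rat f \<Longrightarrow> f (\<lambda>_. 0) \<in> \<rat>"
  by (induction rule: poly_rat.induct) (auto simp: affine_rat_at_zero)

text \<open>This is how a rational number is finally read off: once all variables have been
  integrated out, the value at the origin is the integral.\<close>

lemma piecewise_poly_at_zero: "piecewise_poly f \<Longrightarrow> f (\<lambda>_. 0) \<in> \<rat>"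
  by (induction rule: piecewise_poly.induct) (auto simp: poly_rat_at_zero)

lemma affine_rat_measurable:
  assumes "affine_rat f" "\<And>v. (\<lambda>z. s z v) \<in> borel_measurable M"
  shows "(\<lambda>z. f (s z)) \<in> borel_measurable M"
  using assms(1)
proof (induction rule: affine_rat.induct)
  case (affine_rat_var v)
  show ?case by (rule assms(2))
qed (simp_all add: borel_measurable_add borel_measurable_times)

lemma poly_rat_measurable:
  assumes "poly_rat f" "\<And>v. (\<lambda>z. s z v) \<in> borel_measurable M"
  shows "(\<lambda>z. f (s z)) \<in> borel_measurable M"
  using assms(1)
proof (induction rule: poly_rat.induct)
  case (poly_rat_mult a f)
  show ?case
    by (rule borel_measurable_times[OF affine_rat_measurable[OF poly_rat_mult(1) assms(2)] poly_rat_mult.IH])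
qed (simp_all add: borel_measurable_add)

lemma piecewise_poly_measurable:
  assumes "piecewise_poly f" "\<And>v. (\<lambda>z. s z v) \<in> borel_measurable M"
  shows "(\<lambda>z. f (s z)) \<in> borel_measurable M"
  using assms(1)
proof (induction rule: piecewise_poly.induct)
  case (piecewise_poly_leaf f)
  show ?case by (rule poly_rat_measurable[OF piecewise_poly_leaf assms(2)])
next
  case (piecewise_poly_node a f g)
  note [measurable] = affine_rat_measurable[OF piecewise_poly_node(1) assms(2)] piecewise_poly_node.IH
  show ?case by measurable
qed

lemma has_integral_join:
  fixes h f1 f2 :: "real \<Rightarrow> real"
  assumes "(f1 has_integral A) {u..r}" "(f2 has_integral B) {r..w}" "u \<le> r" "r \<le> w"
    and "\<And>y. y < r \<Longrightarrow> h y = f1 y" "\<And>y. r < y \<Longrightarrow> h y = f2 y"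
  shows "(h has_integral A + B) {u..w}"
proof (rule has_integral_combine[OF assms(3,4)])
  show "(h has_integral A) {u..r}"
    by (rule has_integral_spike_finite[OF _ _ assms(1), of "{r}"]) (use assms in auto)
  show "(h has_integral B) {r..w}"
    by (rule has_integral_spike_finite[OF _ _ assms(2), of "{r}"]) (use assms in auto)
qed

text \<open>The splitting point \<open>r\<close> of the interval is clamped to \<open>[u, w]\<close> by further tests.\<close>

lemma piecewise_poly_integral_split:
  fixes r u w :: "('v \<Rightarrow> real) \<Rightarrow> real"
  assumes int: "\<And>u w. affine_rat u \<Longrightarrow> affine_rat w \<Longrightarrow> (\<And>x y. u (x(v := y)) = u x) \<Longrightarrow>
      (\<And>x y. w (x(v := y)) = w x) \<Longrightarrow> \<exists>G. piecewise_poly G \<and>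
      (\<forall>x. u x \<le> w x \<longrightarrow> ((\<lambda>y. fl (x(v := y))) has_integral G x) {u x..w x})"
    "\<And>u w. affine_rat u \<Longrightarrow> affine_rat w \<Longrightarrow> (\<And>x y. u (x(v := y)) = u x) \<Longrightarrow>
      (\<And>x y. w (x(v := y)) = w x) \<Longrightarrow> \<exists>G. piecewise_poly G \<and>
      (\<forall>x. u x \<le> w x \<longrightarrow> ((\<lambda>y. fr (x(v := y))) has_integral G x) {u x..w x})"
  and aff: "affine_rat r" "affine_rat u" "affine_rat w"
  and indep: "\<And>x y. r (x(v := y)) = r x" "\<And>x y. u (x(v := y)) = u x" "\<And>x y. w (x(v := y)) = w x"
  and h: "\<And>x y. y < r x \<Longrightarrow> h (x(v := y)) = fl (x(v := y))"
    "\<And>x y. r x < y \<Longrightarrow> h (x(v := y)) = fr (x(v := y))"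
  shows "\<exists>G. piecewise_poly G \<and>
    (\<forall>x. u x \<le> w x \<longrightarrow> ((\<lambda>y. h (x(v := y))) has_integral G x) {u x..w x})"
proof -
  obtain G1 where G1: "piecewise_poly G1"
    "\<forall>x. u x \<le> w x \<longrightarrow> ((\<lambda>y. fl (x(v := y))) has_integral G1 x) {u x..w x}"
    using int(1)[of u w] aff indep by blast
  obtain G2 where G2: "piecewise_poly G2"
    "\<forall>x. u x \<le> w x \<longrightarrow> ((\<lambda>y. fr (x(v := y))) has_integral G2 x) {u x..w x}"
    using int(2)[of u w] aff indep by blast
  obtain H1 where H1: "piecewise_poly H1"
    "\<forall>x. u x \<le> r x \<longrightarrow> ((\<lambda>y. fl (x(v := y))) has_integral H1 x) {u x..r x}"
    using int(1)[of u r] aff indep by blast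
  obtain H2 where H2: "piecewise_poly H2"
    "\<forall>x. r x \<le> w x \<longrightarrow> ((\<lambda>y. fr (x(v := y))) has_integral H2 x) {r x..w x}"
    using int(2)[of r w] aff indep by blast
  define G where "G = (\<lambda>x. if 0 \<le> u x - r x then G2 x else
    if 0 \<le> r x - w x then G1 x else H1 x + H2 x)"
  have "piecewise_poly G"
    unfolding G_def by (intro piecewise_poly_node affine_rat_diff aff G1 G2 piecewise_poly_add H1 H2)
  moreover have "((\<lambda>y. h (x(v := y))) has_integral G x) {u x..w x}" if uw: "u x \<le> w x" for x
  proof -
    consider "r x \<le> u x" | "u x < r x" "w x \<le> r x" | "u x < r x" "r x < w x" by linarith
    then show ?thesis
    proof cases
      case 1
      have "((\<lambda>y. h (x(v := y))) has_integral G2 x) {u x..w x}"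
        by (rule has_integral_spike_finite[OF _ _ G2(2)[rule_format, OF uw], of "{r x}"])
           (use 1 h in \<open>auto simp del: fun_upd_apply\<close>)
      then show ?thesis using 1 by (simp add: G_def)
    next
      case 2
      have "((\<lambda>y. h (x(v := y))) has_integral G1 x) {u x..w x}"
        by (rule has_integral_spike_finite[OF _ _ G1(2)[rule_format, OF uw], of "{r x}"])
           (use 2 h in \<open>auto simp del: fun_upd_apply\<close>)
      then show ?thesis using 2 by (simp add: G_def)
    next
      case 3
      have "((\<lambda>y. h (x(v := y))) has_integral H1 x + H2 x) {u x..w x}"
        by (rule has_integral_join[OF H1(2)[rule_format] H2(2)[rule_format]]) (use 3 h in \<open>auto simp del: fun_upd_apply\<close>)
      then show ?thesis using 3 by (simp add: G_def)
    qed
  qed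
  ultimately show ?thesis by blast
qed

text \<open>Bounds that vary affinely with the other variables arise even from a constant interval:
  a test with slope \<open>\<alpha>\<close> in \<open>v\<close> switches at
  \<open>- b x / \<alpha>\<close>, which becomes an endpoint for both branches.\<close>

lemma piecewise_poly_integral:
  assumes "piecewise_poly f" "affine_rat u" "affine_rat w"
    "\<And>x y. u (x(v := y)) = u x" "\<And>x y. w (x(v := y)) = w x"
  shows "\<exists>G. piecewise_poly G \<and>
    (\<forall>x. u x \<le> w x \<longrightarrow> ((\<lambda>y. f (x(v := y))) has_integral G x) {u x..w x})"
  using assms
proof (induction arbitrary: u w rule: piecewise_poly.induct)
  case (piecewise_poly_leaf p)
  obtain P where P: "poly_rat P"
    "\<forall>x y. ((\<lambda>y. P (x(v := y))) has_real_derivative p (x(v := y))) (at y)"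
    using poly_rat_antiderivative[OF piecewise_poly_leaf(1), of v 0]
    unfolding power_0 mult_1_right by blast
  define G where "G = (\<lambda>x. P (x(v := w x)) - P (x(v := u x)))"
  have "affine_rat (\<lambda>x. (x(v := g x)) z)" if "affine_rat g" for g z
    using that by (cases "z = v") (auto intro: affine_rat_var)
  then have "poly_rat G"
    unfolding G_def using piecewise_poly_leaf
    by (intro poly_rat_diff poly_rat_subst[OF P(1)]) auto
  moreover have "((\<lambda>y. p (x(v := y))) has_integral G x) {u x..w x}" if "u x \<le> w x" for x
    unfolding G_def
    by (rule fundamental_theorem_of_calculus[OF that])
       (rule has_field_derivative_at_within[OF P(2)[rule_format],
          unfolded has_real_derivative_iff_has_vector_derivative])
  ultimately show ?case using piecewise_poly.piecewise_poly_leaf by blast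
next
  case (piecewise_poly_node a f g)
  obtain \<alpha> b where ab: "\<alpha> \<in> \<rat>" "affine_rat b" "\<And>x y. b (x(v := y)) = b x" "\<And>x. a x = \<alpha> * x v + b x"
    using affine_rat_split[OF piecewise_poly_node(1)] by metis
  have av: "a (x(v := y)) = \<alpha> * y + b x" for x y using ab(3,4) by simp
  note IH1 = piecewise_poly_node.IH(1) and IH2 = piecewise_poly_node.IH(2)
  let ?h = "\<lambda>x. if 0 \<le> a x then f x else g x"
  \<comment> \<open>For \<open>\<alpha> \<noteq> 0\<close> this is the point where the test changes
    sign; the sign of \<open>\<alpha>\<close> decides which branch lies to its left.\<close>
  have r: "affine_rat (\<lambda>x. (- 1 / \<alpha>) * b x)" by (intro affine_rat_scale ab Rats_divide) auto
  consider "\<alpha> = 0" | "\<alpha> > 0" | "\<alpha> < 0" by linarith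
  then show ?case
  proof cases
    case 1
    obtain G1 where G1: "piecewise_poly G1"
      "\<forall>x. u x \<le> w x \<longrightarrow> ((\<lambda>y. f (x(v := y))) has_integral G1 x) {u x..w x}"
      using IH1[of u w] piecewise_poly_node.prems by blast
    obtain G2 where G2: "piecewise_poly G2"
      "\<forall>x. u x \<le> w x \<longrightarrow> ((\<lambda>y. g (x(v := y))) has_integral G2 x) {u x..w x}"
      using IH2[of u w] piecewise_poly_node.prems by blast
    have "piecewise_poly (\<lambda>x. if 0 \<le> b x then G1 x else G2 x)"
      by (intro piecewise_poly.piecewise_poly_node ab G1(1) G2(1))
    moreover have "((\<lambda>y. ?h (x(v := y))) has_integral (if 0 \<le> b x then G1 x else G2 x)) {u x..w x}"
      if "u x \<le> w x" for x
      using G1(2)[rule_format, OF that] G2(2)[rule_format, OF that] 1 av by (simp del: fun_upd_apply)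
    ultimately show ?thesis by blast
  next
    case 2
    show ?thesis
      by (rule piecewise_poly_integral_split[where fl = g and fr = f and r = "\<lambda>x. (- 1 / \<alpha>) * b x", OF IH2 IH1])
         (use 2 r av piecewise_poly_node.prems ab(3) in \<open>auto simp: field_simps simp del: fun_upd_apply\<close>)
  next
    case 3
    show ?thesis
      by (rule piecewise_poly_integral_split[where fl = f and fr = g and r = "\<lambda>x. (- 1 / \<alpha>) * b x", OF IH1 IH2])
         (use 3 r av piecewise_poly_node.prems ab(3) in \<open>auto simp: field_simps simp del: fun_upd_apply\<close>)
  qed
qed

lemma piecewise_poly_nn_integral_one:
  fixes f :: "('v \<Rightarrow> real) \<Rightarrow> real" and \<beta> :: nat
  assumes f: "piecewise_poly f" "\<And>x. 0 \<le> f x" "\<And>x. x v \<notin> {0..real \<beta>} \<Longrightarrow> f x = 0"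
  shows "\<exists>g. piecewise_poly g \<and> (\<forall>x. 0 \<le> g x) \<and>
    (\<forall>x. (\<integral>\<^sup>+ y. ennreal (f (x(v := y))) \<partial>lborel) = ennreal (g x))"
proof -
  obtain G where G: "piecewise_poly G"
    "\<forall>x. 0 \<le> real \<beta> \<longrightarrow> ((\<lambda>y. f (x(v := y))) has_integral G x) {0..real \<beta>}"
    using piecewise_poly_integral[OF f(1) affine_rat_const affine_rat_const, of 0 "real \<beta>" v]
    by (metis Rats_0 Rats_of_nat)
  have int: "((\<lambda>y. f (x(v := y))) has_integral G x) UNIV" for x
    by (rule has_integral_on_superset[OF G(2)[rule_format]]) (use f(3)[of "x(v := _)"] in auto)
  have nonneg: "0 \<le> G x" for x
    using has_integral_nonneg[OF int] f(2) by blast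
  have "(\<integral>\<^sup>+ y. ennreal (f (x(v := y))) \<partial>lborel) = ennreal (G x)" for x
  proof (rule nn_integral_has_integral_lborel[OF _ _ int])
    have "(\<lambda>y. (x(v := y)) z) \<in> borel_measurable borel" for z
      by (cases "z = v") auto
    then show "(\<lambda>y. f (x(v := y))) \<in> borel_measurable borel"
      by (rule piecewise_poly_measurable[OF f(1)])
  qed (use f(2) in auto)
  then show ?thesis using G(1) nonneg by blast
qed

text \<open>Coordinates outside \<open>I\<close> stay as parameters, so the result of one
  integration is again a function to which the induction applies. It still vanishes outside the box
  because updating \<open>i\<close> leaves the other coordinates alone.\<close>

lemma piecewise_poly_nn_integral:
  fixes f :: "('v \<Rightarrow> real) \<Rightarrow> real" and \<beta> :: "'v \<Rightarrow> nat"
  assumes "finite I" "piecewise_poly f" "\<And>x. 0 \<le> f x"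
    "\<And>x i. i \<in> I \<Longrightarrow> x i \<notin> {0..real (\<beta> i)} \<Longrightarrow> f x = 0"
  shows "\<exists>g. piecewise_poly g \<and> (\<forall>x. 0 \<le> g x) \<and>
    (\<forall>x. (\<integral>\<^sup>+ z. ennreal (f (\<lambda>i. if i \<in> I then z i else x i)) \<partial>PiM I (\<lambda>_. lborel)) = ennreal (g x))"
  using assms
proof (induction I arbitrary: f rule: finite_induct)
  case empty
  then show ?case
    by (intro exI[of _ f]) (simp add: space_PiM emeasure_PiM_empty)
next
  case (insert i I)
  interpret product_sigma_finite "\<lambda>_::'v. lborel :: real measure"
    by (simp add: product_sigma_finite_def lborel.sigma_finite_measure_axioms)
  obtain g where g: "piecewise_poly g" "\<And>x. 0 \<le> g x"
    "\<And>x. (\<integral>\<^sup>+ y. ennreal (f (x(i := y))) \<partial>lborel) = ennreal (g x)"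
    using piecewise_poly_nn_integral_one[OF insert.prems(1,2), of i "\<beta> i"] insert.prems(3)[of i]
    by (metis insertI1)
  have "g x = 0" if "j \<in> I" "x j \<notin> {0..real (\<beta> j)}" for x j
  proof -
    have "f (x(i := y)) = 0" for y
    proof (rule insert.prems(3))
      show "j \<in> insert i I" using that by simp
      show "(x(i := y)) j \<notin> {0..real (\<beta> j)}" using that insert.hyps by auto
    qed
    then have "ennreal (g x) = 0" using g(3)[of x] by simp
    then show ?thesis using g(2)[of x] by (simp add: ennreal_eq_0_iff)
  qed
  then obtain G where G: "piecewise_poly G" "\<And>x. 0 \<le> G x"
    "\<And>x. (\<integral>\<^sup>+ z. ennreal (g (\<lambda>i. if i \<in> I then z i else x i)) \<partial>PiM I (\<lambda>_. lborel)) = ennreal (G x)"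
    using insert.IH[OF g(1,2)] by auto
  have "(\<integral>\<^sup>+ z. ennreal (f (\<lambda>j. if j \<in> insert i I then z j else x j)) \<partial>PiM (insert i I) (\<lambda>_. lborel)) = ennreal (G x)" for x
  proof -
    have m: "(\<lambda>z. f (\<lambda>j. if j \<in> insert i I then z j else x j)) \<in> borel_measurable (PiM (insert i I) (\<lambda>_. lborel))"
    proof (rule piecewise_poly_measurable[OF insert.prems(1)])
      show "(\<lambda>z. if v \<in> insert i I then z v else x v) \<in> borel_measurable (PiM (insert i I) (\<lambda>_. lborel))" for v
        by (cases "v \<in> insert i I") auto
    qed
    have eq: "(\<lambda>j. if j \<in> insert i I then (z(i := y)) j else x j) =
      (\<lambda>j. if j \<in> I then z j else x j)(i := y)" for z y
      using insert.hyps by auto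
    have "(\<integral>\<^sup>+ z. ennreal (f (\<lambda>j. if j \<in> insert i I then z j else x j)) \<partial>PiM (insert i I) (\<lambda>_. lborel)) =
      (\<integral>\<^sup>+ z. (\<integral>\<^sup>+ y. ennreal (f (\<lambda>j. if j \<in> insert i I then (z(i := y)) j else x j)) \<partial>lborel) \<partial>PiM I (\<lambda>_. lborel))"
      using m by (intro product_nn_integral_insert insert.hyps) auto
    also have "\<dots> = ennreal (G x)" unfolding eq g(3) G(3) ..
    finally show ?thesis .
  qed
  then show ?case using G by blast
qed

text \<open>The indicator of \<open>S - T\<close> is a decision tree, in which testing
  \<open>T\<close> below \<open>S\<close> takes care of the strict inequalities of the complement.
  After integration over all coordinates the parameter has no influence and is set to the
  origin.\<close>

lemma rational_volume:
  fixes S T :: "('n::finite \<Rightarrow> real) set" and \<beta> :: "'n \<Rightarrow> nat"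
  assumes S: "polyhedron_rat S" and T: "polyhedron_rat T"
    and box: "\<And>x i. x \<in> S \<Longrightarrow> x i \<in> {0..real (\<beta> i)}"
  shows "\<exists>q\<in>\<rat>. 0 \<le> q \<and> emeasure (PiM UNIV (\<lambda>_. lborel)) (S - T) = ennreal q"
    and "S - T \<in> sets (PiM UNIV (\<lambda>_. lborel))"
proof -
  let ?M = "PiM UNIV (\<lambda>_. lborel) :: ('n \<Rightarrow> real) measure"
  define f where "f = (\<lambda>x. if x \<in> S then (if x \<in> T then 0 else 1) else (0::real))"
  have f: "piecewise_poly f"
    unfolding f_def
    by (intro piecewise_poly_indicator S T piecewise_poly_leaf poly_rat_const) auto
  have "f \<in> borel_measurable ?M"
    by (rule piecewise_poly_measurable[OF f]) auto
  then have "f -` {1} \<inter> space ?M \<in> sets ?M" by (rule measurable_sets) auto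
  moreover have "f -` {1} \<inter> space ?M = S - T" by (auto simp: f_def space_PiM split: if_splits)
  ultimately show sets: "S - T \<in> sets ?M" by simp
  obtain g where g: "piecewise_poly g" "\<And>x. 0 \<le> g x"
    "\<And>x. (\<integral>\<^sup>+ z. ennreal (f (\<lambda>i. if i \<in> UNIV then z i else x i)) \<partial>?M) = ennreal (g x)"
  proof -
    have "0 \<le> f x" for x by (simp add: f_def)
    moreover have "f x = 0" if "x i \<notin> {0..real (\<beta> i)}" for x i
      using box[of x i] that by (auto simp: f_def)
    ultimately have "\<exists>g. piecewise_poly g \<and> (\<forall>x. 0 \<le> g x) \<and>
      (\<forall>x. (\<integral>\<^sup>+ z. ennreal (f (\<lambda>i. if i \<in> UNIV then z i else x i)) \<partial>?M) = ennreal (g x))"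
      by (intro piecewise_poly_nn_integral f) auto
    then show thesis using that by blast
  qed
  have "(\<integral>\<^sup>+ z. ennreal (f z) \<partial>?M) = (\<integral>\<^sup>+ z. indicator (S - T) z \<partial>?M)"
    by (rule nn_integral_cong) (simp add: f_def indicator_def)
  then have "emeasure ?M (S - T) = (\<integral>\<^sup>+ z. ennreal (f z) \<partial>?M)"
    using sets by simp
  also have "\<dots> = ennreal (g (\<lambda>_. 0))" using g(3)[of "\<lambda>_. 0"] by simp
  finally show "\<exists>q\<in>\<rat>. 0 \<le> q \<and> emeasure ?M (S - T) = ennreal q"
    using g(2) piecewise_poly_at_zero[OF g(1)] by blast
qed

section \<open>Asymptotic lattice point counts\<close>

lemma affine_rat_coeffs:
  fixes f :: "('v::finite \<Rightarrow> real) \<Rightarrow> real"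
  assumes "affine_rat f"
  shows "\<exists>c \<alpha>. \<forall>x. f x = c + (\<Sum>v\<in>UNIV. \<alpha> v * x v)"
  using assms
proof (induction rule: affine_rat.induct)
  case (affine_rat_const c)
  show ?case by (intro exI[of _ c] exI[of _ "\<lambda>_. 0"]) simp
next
  case (affine_rat_var w)
  have "(\<Sum>v\<in>UNIV. (if v = w then 1 else 0) * x v) = x w" for x :: "'v \<Rightarrow> real"
    by (subst sum.remove[of _ w]) auto
  then show ?case by (intro exI[of _ 0] exI[of _ "\<lambda>v. if v = w then 1 else 0"]) simp
next
  case (affine_rat_add f g)
  then obtain c \<alpha> d \<gamma> where "\<And>x. f x = c + (\<Sum>v\<in>UNIV. \<alpha> v * x v)" "\<And>x. g x = d + (\<Sum>v\<in>UNIV. \<gamma> v * x v)"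
    by blast
  then show ?case
    by (intro exI[of _ "c + d"] exI[of _ "\<lambda>v. \<alpha> v + \<gamma> v"]) (simp add: distrib_right sum.distrib)
next
  case (affine_rat_scale r f)
  then obtain c \<alpha> where "\<And>x. f x = c + (\<Sum>v\<in>UNIV. \<alpha> v * x v)" by blast
  then show ?case
    by (intro exI[of _ "r * c"] exI[of _ "\<lambda>v. r * \<alpha> v"])
       (simp add: distrib_left sum_distrib_left mult.assoc)
qed

abbreviation lborel_fun :: "('n::finite \<Rightarrow> real) measure" where
  "lborel_fun \<equiv> PiM UNIV (\<lambda>_. lborel)"

text \<open>By Fubini in the coordinate \<open>w\<close>: every line in this direction meets the
  hyperplane in a single point.\<close>

lemma AE_hyperplane:
  fixes \<alpha> :: "'n::finite \<Rightarrow> real"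
  assumes "\<alpha> w \<noteq> 0"
  shows "AE x in lborel_fun. c + (\<Sum>v\<in>UNIV. \<alpha> v * x v) \<noteq> 0"
proof -
  interpret product_sigma_finite "\<lambda>_::'n. lborel :: real measure"
    by (simp add: product_sigma_finite_def lborel.sigma_finite_measure_axioms)
  let ?f = "\<lambda>x::'n \<Rightarrow> real. c + (\<Sum>v\<in>UNIV. \<alpha> v * x v)"
  define N where "N = {x \<in> space (lborel_fun :: ('n \<Rightarrow> real) measure). ?f x = 0}"
  have N: "N \<in> sets lborel_fun" unfolding N_def by measurable
  have ins: "insert w (UNIV - {w}) = UNIV" by auto
  have mem: "x(w := y) \<in> N \<longleftrightarrow> y = - (c + (\<Sum>v\<in>UNIV-{w}. \<alpha> v * x v)) / \<alpha> w" for x y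
  proof -
    have "?f (x(w := y)) = c + (\<alpha> w * y + (\<Sum>v\<in>UNIV-{w}. \<alpha> v * x v))"
      by (subst sum.remove[of _ w]) auto
    then show ?thesis using assms by (auto simp: N_def space_PiM field_simps)
  qed
  have "emeasure lborel_fun N = (\<integral>\<^sup>+ x. indicator N x \<partial>PiM (insert w (UNIV - {w})) (\<lambda>_. lborel))"
    using N by (simp add: ins)
  also have "\<dots> = (\<integral>\<^sup>+ x. (\<integral>\<^sup>+ y. indicator N (x(w := y)) \<partial>lborel) \<partial>PiM (UNIV - {w}) (\<lambda>_. lborel))"
    using N by (intro product_nn_integral_insert) (auto simp: ins)
  also have "\<dots> = (\<integral>\<^sup>+ x. 0 \<partial>PiM (UNIV - {w}) (\<lambda>_. lborel :: real measure))"
  proof (rule nn_integral_cong)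
    fix x
    have "(\<integral>\<^sup>+ y. indicator N (x(w := y)) \<partial>lborel) =
      (\<integral>\<^sup>+ y. indicator {- (c + (\<Sum>v\<in>UNIV-{w}. \<alpha> v * x v)) / \<alpha> w} y \<partial>lborel)"
      by (intro nn_integral_cong) (auto simp: indicator_def mem)
    also have "\<dots> = 0" by simp
    finally show "(\<integral>\<^sup>+ y. indicator N (x(w := y)) \<partial>lborel) = 0" .
  qed
  finally have "emeasure lborel_fun N = 0" by simp
  then have "N \<in> null_sets lborel_fun" using N by (auto simp: null_sets_def)
  then show ?thesis by (rule AE_I') (auto simp: N_def)
qed

text \<open>A nonconstant inequality is strict at almost every point where it holds, hence survives
  a small shift; a constant one is unaffected. The shift provides the room that absorbs rounding in
  \<open>eventually_power_exps\<close>.\<close>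

lemma AE_polyhedron_shift:
  fixes S :: "('n::finite \<Rightarrow> real) set"
  assumes "polyhedron_rat S"
  shows "AE x in lborel_fun. x \<in> S \<longrightarrow> (\<exists>\<epsilon>>0. (\<lambda>i. x i - \<epsilon>) \<in> S)"
proof -
  obtain L where L: "finite L" "\<forall>f\<in>L. affine_rat f" "S = {x. \<forall>f\<in>L. 0 \<le> f x}"
    using assms unfolding polyhedron_rat_def by blast
  have "AE x in lborel_fun. 0 \<le> f x \<longrightarrow> (\<forall>\<^sub>F \<epsilon> in at_right 0. 0 \<le> f (\<lambda>i. x i - \<epsilon>))" if f: "f \<in> L" for f
  proof -
    obtain c \<alpha> where ca: "\<And>x. f x = c + (\<Sum>v\<in>UNIV. \<alpha> v * x v)"
      using affine_rat_coeffs L(2) f by blast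
    show ?thesis
    proof (cases "\<exists>w. \<alpha> w \<noteq> 0")
      case True
      then obtain w where "\<alpha> w \<noteq> 0" by blast
      from AE_hyperplane[of \<alpha>, OF this, of c] show ?thesis
      proof eventually_elim
        case (elim x)
        show ?case
        proof
          assume "0 \<le> f x"
          then have pos: "0 < f x" using elim ca by (simp add: less_le)
          have "((\<lambda>\<epsilon>. c + (\<Sum>v\<in>UNIV. \<alpha> v * (x v - \<epsilon>))) \<longlongrightarrow> c + (\<Sum>v\<in>UNIV. \<alpha> v * (x v - 0))) (at_right 0)"
            by (intro tendsto_intros)
          then have "((\<lambda>\<epsilon>. f (\<lambda>i. x i - \<epsilon>)) \<longlongrightarrow> f x) (at_right 0)" by (simp add: ca)
          from order_tendstoD(1)[OF this pos]
          show "\<forall>\<^sub>F \<epsilon> in at_right 0. 0 \<le> f (\<lambda>i. x i - \<epsilon>)" by eventually_elim simp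
        qed
      qed
    next
      case False
      then show ?thesis by (simp add: ca)
    qed
  qed
  then have "AE x in lborel_fun. \<forall>f\<in>L. 0 \<le> f x \<longrightarrow> (\<forall>\<^sub>F \<epsilon> in at_right 0. 0 \<le> f (\<lambda>i. x i - \<epsilon>))"
    using L(1) by (intro AE_finite_allI) auto
  then show ?thesis
  proof eventually_elim
    case (elim x)
    show ?case
    proof
      assume "x \<in> S"
      then have "\<forall>\<^sub>F \<epsilon> in at_right 0. \<forall>f\<in>L. 0 \<le> f (\<lambda>i. x i - \<epsilon>)"
        using elim L by (intro eventually_ball_finite) auto
      moreover have "\<forall>\<^sub>F \<epsilon> in at_right (0::real). 0 < \<epsilon>" by (rule eventually_at_right_less)
      ultimately have "\<forall>\<^sub>F \<epsilon> in at_right 0. 0 < \<epsilon> \<and> (\<lambda>i. x i - \<epsilon>) \<in> S"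
        by eventually_elim (use L(3) in auto)
      then show "\<exists>\<epsilon>>0. (\<lambda>i. x i - \<epsilon>) \<in> S"
        using eventually_happens[of _ "at_right (0::real)"] by (auto simp: trivial_limit_at_right_real)
    qed
  qed
qed

section \<open>Lattice points and dilated Newton polyhedra\<close>

text \<open>The choice of \<open>k\<close> generators is a multiplicity function rather than a list,
  so that dividing it by \<open>k\<close> gives the weights of \<open>newton_set\<close>
  directly.\<close>

definition power_exps :: "('n \<Rightarrow> nat) set \<Rightarrow> nat \<Rightarrow> ('n \<Rightarrow> nat) set" where
  "power_exps E k = {a. \<exists>c::('n \<Rightarrow> nat) \<Rightarrow> nat. (\<Sum>e\<in>E. c e) = k \<and> (\<forall>i. (\<Sum>e\<in>E. c e * e i) \<le> a i)}"

text \<open>Multiplicities divided by \<open>k\<close> are convex weights, and the floor only lowers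
  the point. In contrast to the converse, this direction requires no shift.\<close>

lemma newton_set_if_power_exps:
  assumes "0 < k" "\<And>i. 0 \<le> x i" "(\<lambda>i. nat \<lfloor>real k * x i\<rfloor>) \<in> power_exps E k"
  shows "x \<in> newton_set E"
proof -
  obtain c where c: "(\<Sum>e\<in>E. c e) = k" "\<And>i. (\<Sum>e\<in>E. c e * e i) \<le> nat \<lfloor>real k * x i\<rfloor>"
    using assms(3) unfolding power_exps_def by blast
  have "(\<Sum>e\<in>E. real (c e) / real k * real (e i)) \<le> x i" for i
  proof -
    have "real (\<Sum>e\<in>E. c e * e i) \<le> real (nat \<lfloor>real k * x i\<rfloor>)" using c(2) by (simp only: of_nat_le_iff)
    also have "\<dots> \<le> real k * x i" using assms(2)[of i] by simp
    finally have "(\<Sum>e\<in>E. real (c e) * real (e i)) / real k \<le> x i"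
      using assms(1) by (simp add: field_simps)
    then show ?thesis by (simp add: sum_divide_distrib)
  qed
  moreover have "(\<Sum>e\<in>E. real (c e) / real k) = 1"
    using assms(1) c(1) by (simp add: sum_divide_distrib[symmetric] flip: of_nat_sum)
  ultimately show ?thesis unfolding newton_set_def
    by (intro CollectI exI[of _ "\<lambda>e. real (c e) / real k"]) simp
qed

lemma sum_fun_upd_mult:
  fixes w :: "'a \<Rightarrow> nat"
  assumes "finite E" "e \<in> E"
  shows "(\<Sum>x\<in>E. (c(e := t)) x * w x) + c e * w e = (\<Sum>x\<in>E. c x * w x) + t * w e"
proof -
  have "(\<Sum>x\<in>E-{e}. (c(e := t)) x * w x) = (\<Sum>x\<in>E-{e}. c x * w x)" by (intro sum.cong) auto
  then show ?thesis
    using sum.remove[OF assms, of "\<lambda>x. (c(e := t)) x * w x"] sum.remove[OF assms, of "\<lambda>x. c x * w x"] by simp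
qed

text \<open>Round the convex coefficients of \<open>x - \<epsilon>\<close> down after scaling by \<open>k\<close>; the at most \<open>card E\<close>
  missing generators cost a bounded amount, which \<open>k \<epsilon>\<close> eventually exceeds.\<close>

lemma eventually_power_exps:
  fixes x :: "'n::finite \<Rightarrow> real"
  assumes E: "finite E" and x: "\<And>i. 0 \<le> x i" and \<epsilon>: "0 < \<epsilon>" "(\<lambda>i. x i - \<epsilon>) \<in> newton_set E"
  shows "\<forall>\<^sub>F k in sequentially. (\<lambda>i. nat \<lfloor>real k * x i\<rfloor>) \<in> power_exps E k"
proof -
  obtain l where l: "\<And>e. e \<in> E \<Longrightarrow> 0 \<le> l e" "(\<Sum>e\<in>E. l e) = 1" "\<And>i. (\<Sum>e\<in>E. l e * real (e i)) \<le> x i - \<epsilon>"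
    using \<epsilon>(2) unfolding newton_set_def by auto
  have "E \<noteq> {}" using l(2) by auto
  then obtain e0 where e0: "e0 \<in> E" by blast
  define B where "B = Max (range e0)"
  have B: "e0 i \<le> B" for i unfolding B_def by (rule Max_ge) auto
  \<comment> \<open>\<open>card E * B\<close> pays for the generators added to reach the total
    \<open>k\<close>, and the extra 1 pays for the floor.\<close>
  have main: "(\<lambda>i. nat \<lfloor>real k * x i\<rfloor>) \<in> power_exps E k" if k: "real (card E) * real B + 1 \<le> real k * \<epsilon>" for k
  proof -
    define c where "c = (\<lambda>e. nat \<lfloor>real k * l e\<rfloor>)"
    have c_le: "real (c e) \<le> real k * l e" if "e \<in> E" for e
      using l(1)[OF that] by (simp add: c_def)
    have c_ge: "real k * l e - 1 \<le> real (c e)" if "e \<in> E" for e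
      using l(1)[OF that] by (simp add: c_def)
    have "real (\<Sum>e\<in>E. c e) \<le> (\<Sum>e\<in>E. real k * l e)"
      unfolding of_nat_sum by (intro sum_mono c_le)
    also have "\<dots> = real k" using l(2) by (simp flip: sum_distrib_left)
    finally have sum_le: "(\<Sum>e\<in>E. c e) \<le> k" by (simp only: of_nat_le_iff)
    have "real k - real (card E) = (\<Sum>e\<in>E. real k * l e - 1)"
      using l(2) by (simp add: sum_subtractf flip: sum_distrib_left)
    also have "\<dots> \<le> real (\<Sum>e\<in>E. c e)" unfolding of_nat_sum by (intro sum_mono c_ge)
    finally have defect: "k - (\<Sum>e\<in>E. c e) \<le> card E" using sum_le by linarith
    \<comment> \<open>All missing copies go to the single generator \<open>e0\<close>, which makes
      the total exactly \<open>k\<close>.\<close>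
    define c' where "c' = c(e0 := c e0 + (k - (\<Sum>e\<in>E. c e)))"
    have sum_c': "(\<Sum>e\<in>E. c' e * w e) = (\<Sum>e\<in>E. c e * w e) + (k - (\<Sum>e\<in>E. c e)) * w e0" for w
      using sum_fun_upd_mult[OF E e0, of c "c e0 + (k - (\<Sum>e\<in>E. c e))" w]
      by (simp add: c'_def distrib_right)
    have "(\<Sum>e\<in>E. c' e) = k" using sum_c'[of "\<lambda>_. 1"] sum_le by simp
    moreover have "(\<Sum>e\<in>E. c' e * e i) \<le> nat \<lfloor>real k * x i\<rfloor>" for i
    proof -
      have "real (\<Sum>e\<in>E. c' e * e i) = (\<Sum>e\<in>E. real (c e) * real (e i)) + real ((k - (\<Sum>e\<in>E. c e)) * e0 i)"
        unfolding sum_c' by simp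
      also have "\<dots> \<le> (\<Sum>e\<in>E. real k * l e * real (e i)) + real (card E * B)"
        by (intro add_mono sum_mono mult_right_mono c_le, simp_all only: of_nat_le_iff)
           (auto intro: mult_le_mono defect B)
      also have "(\<Sum>e\<in>E. real k * l e * real (e i)) \<le> real k * (x i - \<epsilon>)"
        using mult_left_mono[OF l(3)[of i], of "real k"] by (simp add: sum_distrib_left mult.assoc)
      finally have "real (\<Sum>e\<in>E. c' e * e i) \<le> real k * x i - 1"
        using k by (simp add: algebra_simps)
      then show ?thesis by linarith
    qed
    ultimately show ?thesis unfolding power_exps_def by blast
  qed
  have "filterlim (\<lambda>k. real k * \<epsilon>) at_top sequentially"
    using \<epsilon>(1) by (intro filterlim_at_top_mult_tendsto_pos[OF tendsto_const _ filterlim_real_sequentially])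
  then have "\<forall>\<^sub>F k in sequentially. real (card E) * real B + 1 \<le> real k * \<epsilon>"
    by (simp add: filterlim_at_top)
  then show ?thesis by eventually_elim (rule main)
qed

lemma nat_floor_mult_less_iff:
  assumes "0 < k" "0 \<le> y"
  shows "nat \<lfloor>real k * y\<rfloor> < b * k \<longleftrightarrow> y < real b"
proof -
  have "nat \<lfloor>real k * y\<rfloor> < b * k \<longleftrightarrow> \<lfloor>real k * y\<rfloor> < int (b * k)"
    using assms by (simp add: nat_less_iff)
  also have "\<dots> \<longleftrightarrow> real k * y < real k * real b" by (simp add: floor_less_iff mult.commute)
  also have "\<dots> \<longleftrightarrow> y < real b" using assms by simp
  finally show ?thesis .
qed

text \<open>On the nonnegative orthant the fibres of the floor map are half-open cubes of side
  \<open>1/k\<close>; they are disjoint and of equal volume.\<close>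

lemma emeasure_cubes:
  fixes W :: "('n::finite \<Rightarrow> nat) set"
  assumes "finite W" "0 < k"
  defines "A \<equiv> {x. (\<forall>i. 0 \<le> x i) \<and> (\<lambda>i. nat \<lfloor>real k * x i\<rfloor>) \<in> W}"
  shows "A \<in> sets lborel_fun" "measure lborel_fun A = real (card W) / real k ^ CARD('n)"
proof -
  interpret product_sigma_finite "\<lambda>_::'n. lborel :: real measure"
    by (simp add: product_sigma_finite_def lborel.sigma_finite_measure_axioms)
  define Q where "Q a = (PiE UNIV (\<lambda>i. {real (a i) / real k ..< real (a i + 1) / real k}))" for a :: "'n \<Rightarrow> nat"
  have Q: "x \<in> Q a \<longleftrightarrow> (\<forall>i. 0 \<le> x i) \<and> (\<lambda>i. nat \<lfloor>real k * x i\<rfloor>) = a" for x a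
  proof -
    have "real (a i) / real k \<le> y \<and> y < real (a i + 1) / real k \<longleftrightarrow> 0 \<le> y \<and> nat \<lfloor>real k * y\<rfloor> = a i" for i y
    proof -
      have "real (a i) / real k \<le> y \<and> y < real (a i + 1) / real k \<longleftrightarrow> real (a i) \<le> real k * y \<and> real k * y < real (a i) + 1"
        using assms(2) by (auto simp: field_simps)
      also have "\<dots> \<longleftrightarrow> \<lfloor>real k * y\<rfloor> = int (a i)" by (simp add: floor_eq_iff)
      also have "\<dots> \<longleftrightarrow> 0 \<le> y \<and> nat \<lfloor>real k * y\<rfloor> = a i"
      proof -
        have "0 \<le> y \<longleftrightarrow> 0 \<le> \<lfloor>real k * y\<rfloor>" using assms(2) by (simp add: zero_le_mult_iff)
        then show ?thesis by linarith
      qed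
      finally show ?thesis .
    qed
    then show ?thesis by (auto simp: Q_def PiE_def fun_eq_iff)
  qed
  have A: "A = (\<Union>a\<in>W. Q a)" by (auto simp: A_def Q)
  have disj: "disjoint_family_on Q W" by (auto simp: disjoint_family_on_def Q)
  have setsQ: "Q a \<in> sets lborel_fun" for a unfolding Q_def by (intro sets_PiM_I_finite) auto
  then show "A \<in> sets lborel_fun" unfolding A using assms(1) by auto
  have emQ: "emeasure lborel_fun (Q a) = ennreal (1 / real k ^ CARD('n))" for a
  proof -
    have "emeasure lborel_fun (Q a) = (\<Prod>i\<in>(UNIV::'n set). emeasure lborel {real (a i) / real k ..< real (a i + 1) / real k})"
      unfolding Q_def by (intro emeasure_PiM) auto
    also have "\<dots> = (\<Prod>i\<in>(UNIV::'n set). ennreal (1 / real k))"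
      using assms(2) by (intro prod.cong refl) (auto simp: field_simps)
    also have "\<dots> = ennreal (1 / real k ^ CARD('n))"
      by (simp add: prod_ennreal ennreal_power power_one_over)
    finally show ?thesis .
  qed
  have "measure lborel_fun A = (\<Sum>a\<in>W. measure lborel_fun (Q a))"
    unfolding A using assms(1) setsQ disj emQ by (intro measure_finite_Union) auto
  also have "\<dots> = real (card W) / real k ^ CARD('n)"
    by (simp add: measure_def emQ)
  finally show "measure lborel_fun A = real (card W) / real k ^ CARD('n)" .
qed

text \<open>For almost every \<open>x\<close>, membership of its lattice point in each
  \<open>power_exps E k\<close> eventually agrees with membership of \<open>x\<close> in
  \<open>newton_set E\<close>. So the indicators of the unions of cubes converge almost everywhere
  to that of \<open>S - newton_set E0\<close>, dominated by the indicator of the box.\<close>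

theorem lattice_count_limit:
  fixes E0 :: "('n::finite \<Rightarrow> nat) set" and \<E> :: "('n \<Rightarrow> nat) set set" and \<beta> :: "'n \<Rightarrow> nat"
  assumes "finite E0" "finite \<E>" "\<And>E. E \<in> \<E> \<Longrightarrow> finite E"
  shows "\<exists>q\<in>\<rat>. (\<lambda>k. real (card {a. (\<forall>i. a i < \<beta> i * k) \<and> a \<notin> power_exps E0 k \<and> (\<forall>E\<in>\<E>. a \<in> power_exps E k)})
      / real k ^ CARD('n)) \<longlonglongrightarrow> q"
proof -
  define W where "W k = {a. (\<forall>i. a i < \<beta> i * k) \<and> a \<notin> power_exps E0 k \<and> (\<forall>E\<in>\<E>. a \<in> power_exps E k)}" for k
  define box where "box = (\<Inter>i. {x::'n \<Rightarrow> real. 0 \<le> x i} \<inter> {x. 0 \<le> real (\<beta> i) - x i})"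
  define S where "S = box \<inter> (\<Inter>E\<in>\<E>. newton_set E)"
  define A where "A k = {x. (\<forall>i. 0 \<le> x i) \<and> (\<lambda>i. nat \<lfloor>real k * x i\<rfloor>) \<in> W k}" for k
  have finW: "finite (W k)" for k
  proof (rule finite_subset)
    show "W k \<subseteq> PiE UNIV (\<lambda>i. {..<\<beta> i * k})" by (auto simp: W_def)
  qed (intro finite_PiE, auto)
  have poly_box: "polyhedron_rat box"
    unfolding box_def
    by (intro polyhedron_rat_INT polyhedron_rat_Int polyhedron_rat_halfspace affine_rat_diff
        affine_rat_var affine_rat_const) auto
  have poly_S: "polyhedron_rat S"
    unfolding S_def using assms by (intro polyhedron_rat_Int poly_box polyhedron_rat_INT polyhedron_rat_newton_set) auto
  have box: "x i \<in> {0..real (\<beta> i)}" if "x \<in> box" for x i using that by (auto simp: box_def)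
  obtain q where q: "q \<in> \<rat>" "0 \<le> q" "emeasure lborel_fun (S - newton_set E0) = ennreal q"
    and S_sets: "S - newton_set E0 \<in> sets lborel_fun"
    using rational_volume[OF poly_S polyhedron_rat_newton_set[OF assms(1)], of \<beta>] box by (auto simp: S_def)
  \<comment> \<open>The halfspace given by the constant \<open>- 1\<close> is empty, so the
    difference is the box itself.\<close>
  have box_vol: "box \<in> sets lborel_fun" "emeasure lborel_fun box < \<infinity>"
    using rational_volume[OF poly_box polyhedron_rat_halfspace[OF affine_rat_const[of "-1"]], of \<beta>] box
    by auto
  have A_sets: "A k \<in> sets lborel_fun" and A_meas: "measure lborel_fun (A k) = real (card (W k)) / real k ^ CARD('n)"
    if "0 < k" for k
    using emeasure_cubes[OF finW[of k] that] by (auto simp: A_def)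
  have A_box: "x \<in> box" if "x \<in> A (Suc k)" for x k
  proof -
    have "0 \<le> x i \<and> x i \<le> real (\<beta> i)" for i
    proof -
      have "0 \<le> x i" "nat \<lfloor>real (Suc k) * x i\<rfloor> < \<beta> i * Suc k"
        using that unfolding A_def W_def by blast+
      then show ?thesis using nat_floor_mult_less_iff[of "Suc k" "x i" "\<beta> i"] by auto
    qed
    then show ?thesis by (simp add: box_def)
  qed
  have AE: "AE x in lborel_fun. \<forall>\<^sub>F k in sequentially. x \<in> A (Suc k) \<longleftrightarrow> x \<in> S - newton_set E0"
  proof -
    \<comment> \<open>The face \<open>x i = \<beta> i\<close> belongs to the closed box but violates
      the strict bound on the lattice point; it is a null set.\<close>
    have "AE x in lborel_fun. \<forall>i::'n. real (\<beta> i) - x i \<noteq> 0"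
    proof (rule AE_all_countable[THEN iffD2], rule allI)
      fix i :: 'n
      have "(\<Sum>v\<in>UNIV. (if v = i then - 1 else 0) * x v) = - x i" for x :: "'n \<Rightarrow> real"
        by (subst sum.remove[of _ i]) auto
      then show "AE x in lborel_fun. real (\<beta> i) - x i \<noteq> 0"
        using AE_hyperplane[of "\<lambda>v. if v = i then - 1 else 0" i "real (\<beta> i)"] by simp
    qed
    moreover have "AE x in lborel_fun. \<forall>E\<in>insert E0 \<E>. x \<in> newton_set E \<longrightarrow> (\<exists>\<epsilon>>0. (\<lambda>i. x i - \<epsilon>) \<in> newton_set E)"
      using assms by (intro AE_finite_allI AE_polyhedron_shift polyhedron_rat_newton_set) auto
    ultimately show ?thesis
    proof eventually_elim
      case (elim x)
      show ?case
      proof (cases "x \<in> box")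
        case False
        then have "x \<notin> A (Suc k)" for k using A_box by blast
        then show ?thesis using False by (simp add: S_def)
      next
        case True
        then have x: "0 \<le> x i" "x i < real (\<beta> i)" for i
          using elim(1)[rule_format, of i] box[OF True, of i] by auto
        have ev: "\<forall>\<^sub>F k in sequentially. (\<lambda>i. nat \<lfloor>real k * x i\<rfloor>) \<in> power_exps E k \<longleftrightarrow> x \<in> newton_set E"
          if E: "E \<in> insert E0 \<E>" for E
        proof (cases "x \<in> newton_set E")
          case True
          then obtain \<epsilon> where "0 < \<epsilon>" "(\<lambda>i. x i - \<epsilon>) \<in> newton_set E" using elim(2) E by blast
          moreover have "finite E" using E assms by auto
          ultimately have "\<forall>\<^sub>F k in sequentially. (\<lambda>i. nat \<lfloor>real k * x i\<rfloor>) \<in> power_exps E k"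
            using x(1) by (intro eventually_power_exps)
          then show ?thesis by eventually_elim (use True in simp)
        next
          case False
          have "\<forall>\<^sub>F k::nat in sequentially. 0 < k" by (rule eventually_gt_at_top)
          then show ?thesis
            by eventually_elim (use False newton_set_if_power_exps[of _ x E] x(1) in auto)
        qed
        have "\<forall>\<^sub>F k in sequentially. \<forall>E\<in>insert E0 \<E>.
            (\<lambda>i. nat \<lfloor>real k * x i\<rfloor>) \<in> power_exps E k \<longleftrightarrow> x \<in> newton_set E"
          using assms(2) ev by (intro eventually_ball_finite) auto
        moreover have "\<forall>\<^sub>F k::nat in sequentially. 0 < k" by (rule eventually_gt_at_top)
        ultimately have "\<forall>\<^sub>F k in sequentially. x \<in> A k \<longleftrightarrow> x \<in> S - newton_set E0"
        proof eventually_elim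
          case (elim k)
          have "nat \<lfloor>real k * x i\<rfloor> < \<beta> i * k" for i
            using nat_floor_mult_less_iff[of k "x i" "\<beta> i"] x elim(2) by blast
          then show ?case using elim(1) True x(1) by (auto simp: A_def W_def S_def)
        qed
        then show ?thesis by (rule eventually_sequentially_Suc[THEN iffD2])
      qed
    qed
  qed
  \<comment> \<open>The index is shifted because cubes of side \<open>1/k\<close> require positive
    \<open>k\<close>.\<close>
  have "(\<lambda>k. \<integral>x. indicat_real (A (Suc k)) x \<partial>lborel_fun) \<longlonglongrightarrow> (\<integral>x. indicat_real (S - newton_set E0) x \<partial>lborel_fun)"
  proof (rule integral_dominated_convergence[where w = "indicat_real box"])
    show "indicat_real (S - newton_set E0) \<in> borel_measurable lborel_fun" using S_sets by simp
    show "indicat_real (A (Suc k)) \<in> borel_measurable lborel_fun" for k using A_sets[of "Suc k"] by simp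
    show "integrable lborel_fun (indicat_real box)" using box_vol by simp
    show "AE x in lborel_fun. (\<lambda>k. indicat_real (A (Suc k)) x) \<longlonglongrightarrow> indicat_real (S - newton_set E0) x"
      using AE
    proof eventually_elim
      case (elim x)
      then have "\<forall>\<^sub>F k in sequentially. indicat_real (S - newton_set E0) x = indicat_real (A (Suc k)) x"
        by eventually_elim (auto simp: indicator_def)
      then show ?case by (rule tendsto_eventually[OF eventually_mono]) simp
    qed
    show "AE x in lborel_fun. norm (indicat_real (A (Suc k)) x) \<le> indicat_real box x" for k
    proof (rule AE_I2)
      fix x :: "'n \<Rightarrow> real"
      show "norm (indicat_real (A (Suc k)) x) \<le> indicat_real box x"
        using A_box[of x k] by (auto simp: indicator_def)
    qed
  qed
  moreover have "(\<integral>x. indicat_real (S - newton_set E0) x \<partial>lborel_fun) = q"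
    using q S_sets by (simp add: measure_def)
  moreover have "(\<integral>x. indicat_real (A (Suc k)) x \<partial>lborel_fun) = real (card (W (Suc k))) / real (Suc k) ^ CARD('n)" for k
    using A_meas[of "Suc k"] A_sets[of "Suc k"] by simp
  ultimately have "(\<lambda>k. real (card (W (Suc k))) / real (Suc k) ^ CARD('n)) \<longlonglongrightarrow> q" by simp
  then have "(\<lambda>k. real (card (W k)) / real k ^ CARD('n)) \<longlonglongrightarrow> q"
    by (rule LIMSEQ_imp_Suc)
  then show ?thesis using q(1) unfolding W_def by blast
qed

section \<open>Exponents of powers of monomial ideals\<close>

lemma power_exps_mono: "a \<in> power_exps E k \<Longrightarrow> (\<And>i. a i \<le> b i) \<Longrightarrow> b \<in> power_exps E k"
  unfolding power_exps_def by (blast intro: order_trans)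

lemma power_exps_0: "power_exps E 0 = UNIV"
  unfolding power_exps_def by (auto intro: exI[of _ "\<lambda>_. 0"])

text \<open>The recursion that matches multiplication of a power by the ideal: one generator with
  positive multiplicity is split off, or one is added.\<close>

lemma power_exps_Suc:
  assumes "finite E"
  shows "a \<in> power_exps E (Suc k) \<longleftrightarrow> (\<exists>b\<in>power_exps E k. \<exists>e\<in>E. \<forall>i. b i + e i \<le> a i)"
proof
  assume "a \<in> power_exps E (Suc k)"
  then obtain c where c: "(\<Sum>e\<in>E. c e) = Suc k" "\<And>i. (\<Sum>e\<in>E. c e * e i) \<le> a i"
    unfolding power_exps_def by blast
  then obtain e where e: "e \<in> E" "c e \<noteq> 0" by (metis nat.distinct(1) sum.neutral)
  define c' where "c' = c(e := c e - 1)"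
  have sum_c': "(\<Sum>x\<in>E. c' x * w x) + w e = (\<Sum>x\<in>E. c x * w x)" for w
    using sum_fun_upd_mult[OF assms e(1), of c "c e - 1" w] e(2) unfolding c'_def by (cases "c e") auto
  have "(\<Sum>x\<in>E. c' x) = k" using sum_c'[of "\<lambda>_. 1"] c(1) by simp
  then have "(\<lambda>i. \<Sum>x\<in>E. c' x * x i) \<in> power_exps E k" unfolding power_exps_def by blast
  moreover have "\<forall>i. (\<Sum>x\<in>E. c' x * x i) + e i \<le> a i" using sum_c'[of "\<lambda>x. x _"] c(2) by simp
  ultimately show "\<exists>b\<in>power_exps E k. \<exists>e\<in>E. \<forall>i. b i + e i \<le> a i"
    using e(1) by (intro bexI[of _ "\<lambda>i. \<Sum>x\<in>E. c' x * x i"] bexI[of _ e])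
next
  assume "\<exists>b\<in>power_exps E k. \<exists>e\<in>E. \<forall>i. b i + e i \<le> a i"
  then obtain b e c where bec: "e \<in> E" "\<And>i. b i + e i \<le> a i" "(\<Sum>e\<in>E. c e) = k" "\<And>i. (\<Sum>e\<in>E. c e * e i) \<le> b i"
    unfolding power_exps_def by blast
  define c' where "c' = c(e := Suc (c e))"
  have sum_c': "(\<Sum>x\<in>E. c' x * w x) = (\<Sum>x\<in>E. c x * w x) + w e" for w
    using sum_fun_upd_mult[OF assms bec(1), of c "Suc (c e)" w] by (simp add: c'_def)
  have "(\<Sum>x\<in>E. c' x) = Suc k" using sum_c'[of "\<lambda>_. 1"] bec(3) by simp
  moreover have "(\<Sum>x\<in>E. c' x * x i) \<le> a i" for i
    using sum_c'[of "\<lambda>x. x i"] bec(2)[of i] bec(4)[of i] by linarith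
  ultimately show "a \<in> power_exps E (Suc k)" unfolding power_exps_def by blast
qed

section \<open>Forgetting coordinates\<close>

text \<open>Applied to the generators, this corresponds to inverting the variables in
  \<open>S\<close>: the conditions on these coordinates disappear.\<close>

definition zero_on :: "'n set \<Rightarrow> ('n \<Rightarrow> nat) \<Rightarrow> 'n \<Rightarrow> nat" where
  "zero_on S e = (\<lambda>i. if i \<in> S then 0 else e i)"

lemma zero_on_image_image: "zero_on F ` zero_on S ` E = zero_on (F \<union> S) ` E"
  unfolding image_image by (intro image_cong refl) (auto simp: zero_on_def)

lemma power_exps_zero_on:
  assumes "finite E"
  shows "a \<in> power_exps (zero_on S ` E) k \<longleftrightarrow> (\<exists>b\<in>power_exps E k. \<forall>i. i \<notin> S \<longrightarrow> b i \<le> a i)"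
proof (induction k arbitrary: a)
  case 0
  show ?case by (auto simp: power_exps_0)
next
  case (Suc k)
  show ?case
  proof
    assume "a \<in> power_exps (zero_on S ` E) (Suc k)"
    then obtain b' e where b': "b' \<in> power_exps (zero_on S ` E) k" "e \<in> E" "\<And>i. b' i + zero_on S e i \<le> a i"
      unfolding power_exps_Suc[OF finite_imageI[OF assms]] by blast
    then obtain b where b: "b \<in> power_exps E k" "\<And>i. i \<notin> S \<Longrightarrow> b i \<le> b' i" using Suc.IH by blast
    have "(\<lambda>i. b i + e i) \<in> power_exps E (Suc k)"
      unfolding power_exps_Suc[OF assms] by (intro bexI[OF _ b(1)] bexI[OF _ b'(2)]) simp
    moreover have "b i + e i \<le> a i" if "i \<notin> S" for i
      using b(2)[OF that] b'(3)[of i] that by (simp add: zero_on_def)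
    ultimately show "\<exists>b\<in>power_exps E (Suc k). \<forall>i. i \<notin> S \<longrightarrow> b i \<le> a i"
      by (intro bexI[of _ "\<lambda>i. b i + e i"]) auto
  next
    assume "\<exists>b\<in>power_exps E (Suc k). \<forall>i. i \<notin> S \<longrightarrow> b i \<le> a i"
    then obtain b where b1: "b \<in> power_exps E (Suc k)" "\<forall>i. i \<notin> S \<longrightarrow> b i \<le> a i" by blast
    from b1(1) obtain b0 e where b: "b0 \<in> power_exps E k" "e \<in> E" "\<forall>i. b0 i + e i \<le> b i"
      unfolding power_exps_Suc[OF assms] by blast
    define b' where "b' i = (if i \<in> S then a i else b0 i)" for i
    have b': "b' \<in> power_exps (zero_on S ` E) k"
      unfolding Suc.IH by (intro bexI[OF _ b(1)]) (simp add: b'_def)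
    have "b' i + zero_on S e i \<le> a i" for i
      using b1(2)[rule_format, of i] b(3)[rule_format, of i]
      by (cases "i \<in> S") (simp_all add: b'_def zero_on_def)
    then show "a \<in> power_exps (zero_on S ` E) (Suc k)"
      unfolding power_exps_Suc[OF finite_imageI[OF assms]] using b(2) by (intro bexI[OF _ b']) blast
  qed
qed

lemma power_exps_subset_zero_on:
  assumes "finite E" "a \<in> power_exps E k"
  shows "a \<in> power_exps (zero_on S ` E) k"
  unfolding power_exps_zero_on[OF assms(1)] by (intro bexI[OF _ assms(2)]) simp

text \<open>The sum of the chosen generators is itself a witness, and having \<open>k\<close>
  summands it is bounded by \<open>B * k\<close>. This is the origin of the truncation
  level.\<close>

lemma power_exps_bounded_witness:
  assumes "a \<in> power_exps E k" "\<And>e i. e \<in> E \<Longrightarrow> e i \<le> B"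
  obtains b where "b \<in> power_exps E k" "\<And>i. b i \<le> a i" "\<And>i. b i \<le> B * k"
proof -
  obtain c where c: "(\<Sum>e\<in>E. c e) = k" "\<And>i. (\<Sum>e\<in>E. c e * e i) \<le> a i"
    using assms(1) unfolding power_exps_def by blast
  have "(\<Sum>e\<in>E. c e * e i) \<le> B * k" for i
  proof -
    have "(\<Sum>e\<in>E. c e * e i) \<le> (\<Sum>e\<in>E. c e * B)" using assms(2) by (intro sum_mono) auto
    also have "\<dots> = B * k" unfolding sum_distrib_right[symmetric] c(1) by (rule mult.commute)
    finally show ?thesis .
  qed
  moreover have "(\<lambda>i. \<Sum>e\<in>E. c e * e i) \<in> power_exps E k" using c(1) unfolding power_exps_def by blast
  ultimately show ?thesis using that c(2) by blast
qed

text \<open>A coordinate of size at least \<open>B * k\<close> dominates that of a bounded witness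
  automatically, so forgetting it changes nothing.\<close>

lemma power_exps_zero_on_iff:
  assumes "finite E" "\<And>e i. e \<in> E \<Longrightarrow> e i \<le> B" "\<And>i. i \<in> S \<Longrightarrow> B * k \<le> a i"
  shows "a \<in> power_exps (zero_on S ` E) k \<longleftrightarrow> a \<in> power_exps E k"
proof
  assume "a \<in> power_exps (zero_on S ` E) k"
  then obtain b where "b \<in> power_exps E k" "\<And>i. i \<notin> S \<Longrightarrow> b i \<le> a i"
    using assms(1) by (auto simp: power_exps_zero_on)
  moreover from this(1) obtain b' where "b' \<in> power_exps E k" "\<And>i. b' i \<le> b i" "\<And>i. b' i \<le> B * k"
    using power_exps_bounded_witness[of b E k B] assms(2) by blast
  ultimately show "a \<in> power_exps E k"
    using power_exps_mono[of b' E k a] assms(3) by (metis order_trans)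
qed (use assms power_exps_subset_zero_on in blast)

lemma power_exps_zero_on_cong:
  assumes "finite E" "\<And>i. i \<notin> S \<Longrightarrow> a i = b i"
  shows "a \<in> power_exps (zero_on S ` E) k \<longleftrightarrow> b \<in> power_exps (zero_on S ` E) k"
  using assms by (auto simp: power_exps_zero_on)

lemma power_exps_truncate:
  assumes "\<And>e i. e \<in> E \<Longrightarrow> e i \<le> B"
  shows "(\<lambda>i. min (a i) (B * k)) \<in> power_exps E k \<longleftrightarrow> a \<in> power_exps E k"
proof
  assume "a \<in> power_exps E k"
  then obtain b where "b \<in> power_exps E k" "\<And>i. b i \<le> a i" "\<And>i. b i \<le> B * k"
    using power_exps_bounded_witness[of a E k B] assms by blast
  then show "(\<lambda>i. min (a i) (B * k)) \<in> power_exps E k" by (auto intro: power_exps_mono)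
qed (erule power_exps_mono, simp)

text \<open>Adding a multiple of \<open>f\<close> moves only coordinates in its support, and these
  are the ones forgotten.\<close>

lemma power_exps_add_multiple:
  assumes "finite E" "(\<lambda>i. a i + m * f i) \<in> power_exps E k"
  shows "a \<in> power_exps (zero_on {i. f i \<noteq> 0} ` E) k"
  unfolding power_exps_zero_on[OF assms(1)] by (rule bexI[OF _ assms(2)]) simp

text \<open>At least \<open>B * k\<close> copies of \<open>f\<close> lift every coordinate of its
  support to the level where it imposes no condition. This is why the saturation sees only the
  supports of the generators of \<open>J\<close>.\<close>

lemma power_exps_add_multiple_large:
  assumes "finite E" "\<And>e i. e \<in> E \<Longrightarrow> e i \<le> B" "a \<in> power_exps (zero_on {i. f i \<noteq> 0} ` E) k" "B * k \<le> m"
  shows "(\<lambda>i. a i + m * f i) \<in> power_exps E k"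
proof -
  have "(\<lambda>i. a i + m * f i) \<in> power_exps (zero_on {i. f i \<noteq> 0} ` E) k"
    using assms(3) by (rule power_exps_mono) simp
  moreover have "B * k \<le> a i + m * f i" if "i \<in> {i. f i \<noteq> 0}" for i
  proof -
    have "B * k \<le> m * f i" using that assms(4) by (cases "f i") auto
    then show ?thesis by simp
  qed
  ultimately show ?thesis 
    using power_exps_zero_on_iff[of E B "{i. f i \<noteq> 0}" k "\<lambda>i. a i + m * f i"] assms(1,2) by blast
qed

lemma generator_bound:
  fixes E :: "('n::finite \<Rightarrow> nat) set"
  assumes "finite E"
  obtains B where "\<And>e i. e \<in> E \<Longrightarrow> e i \<le> B"
proof -
  have "e i \<le> Max (\<Union>e\<in>E. range e)" if "e \<in> E" for e i using that assms by (intro Max_ge) auto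
  then show thesis using that by blast
qed

section \<open>Dickson's lemma\<close>

text \<open>Coordinates are treated one after another. A monotone subsequence in the next coordinate
  is increasing or else, as a decreasing sequence of naturals, eventually constant; in the second
  case an initial segment is dropped.\<close>

lemma nat_fun_seq_mono_subseq:
  fixes s :: "nat \<Rightarrow> 'n \<Rightarrow> nat"
  assumes "finite I"
  shows "\<exists>r::nat \<Rightarrow> nat. strict_mono r \<and> (\<forall>i\<in>I. incseq (\<lambda>n. s (r n) i))"
  using assms
proof (induction I rule: finite_induct)
  case empty
  show ?case by (intro exI[of _ id]) (simp add: strict_mono_def)
next
  case (insert j I)
  then obtain r where r: "strict_mono r" "\<forall>i\<in>I. incseq (\<lambda>n. s (r n) i)" by blast
  obtain t :: "nat \<Rightarrow> nat" where t: "strict_mono t" "monoseq (\<lambda>n. s (r (t n)) j)"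
    using seq_monosub[of "\<lambda>n. s (r n) j"] by (auto simp: o_def)
  have rt: "\<forall>i\<in>I. incseq (\<lambda>n. s (r (t n)) i)"
    using r(2) strict_mono_mono[OF t(1)] unfolding incseq_def mono_def by blast
  have "\<exists>u::nat \<Rightarrow> nat. strict_mono u \<and> incseq (\<lambda>n. s (r (t (u n))) j)"
  proof (cases "incseq (\<lambda>n. s (r (t n)) j)")
    case True
    then show ?thesis by (intro exI[of _ id]) (simp add: strict_mono_def)
  next
    case False
    then have dec: "decseq (\<lambda>n. s (r (t n)) j)" using t(2) by (simp add: monoseq_iff)
    define m where "m = (LEAST m. m \<in> range (\<lambda>n. s (r (t n)) j))"
    have "m \<in> range (\<lambda>n. s (r (t n)) j)" unfolding m_def by (rule LeastI[of _ "s (r (t 0)) j"]) auto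
    then obtain N where N: "m = s (r (t N)) j" by blast
    have "s (r (t (n + N))) j = m" for n
    proof (rule antisym)
      show "s (r (t (n + N))) j \<le> m" using dec N by (auto simp: decseq_def)
      show "m \<le> s (r (t (n + N))) j" unfolding m_def by (rule Least_le) auto
    qed
    then show ?thesis by (intro exI[of _ "\<lambda>n. n + N"]) (simp add: strict_mono_def incseq_def)
  qed
  then obtain u where u: "strict_mono u" "incseq (\<lambda>n. s (r (t (u n))) j)" by blast
  have "strict_mono (\<lambda>n. r (t (u n)))"
    using r(1) t(1) u(1) by (auto simp: strict_mono_def)
  moreover have "\<forall>i\<in>insert j I. incseq (\<lambda>n. s (r (t (u n))) i)"
    using u rt strict_mono_mono[OF u(1)] unfolding incseq_def mono_def by blast
  ultimately show ?case by (intro exI[of _ "\<lambda>n. r (t (u n))"]) blast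
qed

text \<open>\<open>E'\<close> consists of the minimal elements. Infinitely many of them would
  contain a sequence increasing in every coordinate, hence two distinct comparable minimal elements.
  Every element lies above a minimal one by descent on the coordinate sum.\<close>

lemma dickson:
  fixes E :: "('n::finite \<Rightarrow> nat) set"
  shows "\<exists>E'\<subseteq>E. finite E' \<and> (\<forall>e\<in>E. \<exists>e'\<in>E'. \<forall>i. e' i \<le> e i)"
proof -
  define E' where "E' = {e\<in>E. \<forall>f\<in>E. (\<forall>i. f i \<le> e i) \<longrightarrow> f = e}"
  have "finite E'"
  proof (rule ccontr)
    assume "infinite E'"
    then obtain s :: "nat \<Rightarrow> 'n \<Rightarrow> nat" where s: "inj s" "range s \<subseteq> E'"
      using infinite_countable_subset by blast
    obtain r :: "nat \<Rightarrow> nat" where r: "strict_mono r" "\<And>i. incseq (\<lambda>n. s (r n) i)"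
      using nat_fun_seq_mono_subseq[of UNIV s] by auto
    have "\<forall>i. s (r 0) i \<le> s (r 1) i" using r(2) by (auto simp: incseq_def)
    moreover have "s (r 0) \<in> E" "s (r 1) \<in> E'" using s(2) by (auto simp: E'_def)
    ultimately have "s (r 0) = s (r 1)" by (auto simp: E'_def)
    then have "r 0 = r 1" using s(1) by (auto dest: injD)
    then show False using strict_monoD[OF r(1), of 0 1] by simp
  qed
  moreover have "\<exists>e'\<in>E'. \<forall>i. e' i \<le> e i" if "e \<in> E" for e
    using that
  proof (induction "\<Sum>i\<in>UNIV. e i" arbitrary: e rule: less_induct)
    case less
    show ?case
    proof (cases "e \<in> E'")
      case False
      then obtain f where f: "f \<in> E" "\<forall>i. f i \<le> e i" "f \<noteq> e" using less.prems by (auto simp: E'_def)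
      then obtain i where "f i \<noteq> e i" by blast
      then have "f i < e i" using f(2) by (simp add: le_neq_implies_less)
      then have "sum f UNIV < sum e UNIV" using f(2) by (intro sum_strict_mono_ex1) auto
      then obtain e' where "e' \<in> E'" "\<forall>i. e' i \<le> f i" using less.hyps f(1) by blast
      then show ?thesis using f(2) order_trans by blast
    qed auto
  qed
  ultimately show ?thesis by (intro exI[of _ E']) (auto simp: E'_def)
qed

section \<open>Counting exponents of bounded degree\<close>

text \<open>Splitting off the value \<open>t\<close> of one coordinate gives a sum of binomial
  coefficients, which the hockey-stick identity closes.\<close>

lemma card_bounded_sum:
  fixes F :: "'n::finite set"
  shows "finite {c::'n \<Rightarrow> nat. (\<forall>i. i \<notin> F \<longrightarrow> c i = 0) \<and> (\<Sum>i\<in>F. c i) \<le> N} \<and>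
    card {c::'n \<Rightarrow> nat. (\<forall>i. i \<notin> F \<longrightarrow> c i = 0) \<and> (\<Sum>i\<in>F. c i) \<le> N} = (N + card F) choose card F"
  using finite[of F]
proof (induction F arbitrary: N rule: finite_induct)
  case empty
  have "{c::'n \<Rightarrow> nat. \<forall>i. c i = 0} = {\<lambda>_. 0}" by auto
  then show ?case by simp
next
  case (insert j F)
  define A where "A N = {c::'n \<Rightarrow> nat. (\<forall>i. i \<notin> F \<longrightarrow> c i = 0) \<and> (\<Sum>i\<in>F. c i) \<le> N}" for N
  let ?A' = "{c::'n \<Rightarrow> nat. (\<forall>i. i \<notin> insert j F \<longrightarrow> c i = 0) \<and> (\<Sum>i\<in>insert j F. c i) \<le> N}"
  have IH: "finite (A N)" "card (A N) = (N + card F) choose card F" for N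
    using insert.IH[of N] by (auto simp: A_def)
  have upd: "(\<Sum>i\<in>F. (c(j := t)) i) = (\<Sum>i\<in>F. c i)" for c :: "'n \<Rightarrow> nat" and t
    using insert.hyps by (intro sum.cong) auto
  have "bij_betw (\<lambda>(t, c). c(j := t)) (SIGMA t:{..N}. A (N - t)) ?A'"
  proof (rule bij_betw_byWitness[where f' = "\<lambda>c. (c j, c(j := 0))"])
    show "\<forall>p\<in>SIGMA t:{..N}. A (N - t). (\<lambda>c. (c j, c(j := 0))) ((\<lambda>(t, c). c(j := t)) p) = p"
      using insert.hyps by (auto simp: A_def)
    show "(\<lambda>(t, c). c(j := t)) ` (SIGMA t:{..N}. A (N - t)) \<subseteq> ?A'"
      using insert.hyps by (auto simp: A_def upd simp del: fun_upd_apply) (auto)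
    show "(\<lambda>c. (c j, c(j := 0))) ` ?A' \<subseteq> (SIGMA t:{..N}. A (N - t))"
      using insert.hyps by (auto simp: A_def upd simp del: fun_upd_apply) (auto)
  qed auto
  then have "card ?A' = card (SIGMA t:{..N}. A (N - t))" "finite ?A' \<longleftrightarrow> finite (SIGMA t:{..N}. A (N - t))"
    by (auto dest: bij_betw_same_card bij_betw_finite)
  moreover have "card (SIGMA t:{..N}. A (N - t)) = (\<Sum>t\<le>N. (N - t + card F) choose card F)"
    using IH by simp
  moreover have "(\<Sum>t\<le>N. (N - t + card F) choose card F) = (\<Sum>t\<le>N. (card F + t) choose card F)"
    by (rule sum.reindex_bij_witness[where i = "\<lambda>t. N - t" and j = "\<lambda>t. N - t"])
       (auto simp: add.commute)
  moreover have "\<dots> = (N + card (insert j F)) choose card (insert j F)"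
    using choose_rising_sum(1)[of "card F" N] insert.hyps by (simp add: add_ac)
  ultimately show ?case using IH(1) by simp
qed

text \<open>A coordinate equal to the cap \<open>T\<close> stands for all values from
  \<open>T\<close> on, so \<open>m\<close> counts the free directions of the exponents that truncate
  to \<open>b\<close>.\<close>

abbreviation stratum :: "('n \<Rightarrow> nat) set \<Rightarrow> nat \<Rightarrow> nat \<Rightarrow> ('n \<Rightarrow> nat) set" where
  "stratum D T m \<equiv> {b \<in> D. (\<forall>i. b i \<le> T) \<and> card {i. b i = T} = m}"

text \<open>The exponents truncating to \<open>b\<close> are \<open>b\<close> plus an arbitrary
  vector supported on the capped coordinates. The bound on \<open>N\<close> keeps the degree of
  every such \<open>b\<close> at most \<open>N\<close>, so the subtraction of naturals is
  genuine.\<close>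

lemma card_truncation_invariant:
  fixes D :: "('n::finite \<Rightarrow> nat) set"
  assumes D: "\<And>a. (\<lambda>i. min (a i) T) \<in> D \<longleftrightarrow> a \<in> D" and N: "CARD('n) * T \<le> N"
  shows "card {a\<in>D. sum a UNIV \<le> N} = (\<Sum>b | b \<in> D \<and> (\<forall>i. b i \<le> T).
     (N - sum b UNIV + card {i. b i = T}) choose card {i. b i = T})"
proof -
  let ?B = "{b \<in> D. \<forall>i. b i \<le> T}"
  let ?trunc = "\<lambda>a i. min (a i) T"
  define X where "X b = {a. ?trunc a = b \<and> sum a UNIV \<le> N}" for b :: "'n \<Rightarrow> nat"
  have finB: "finite ?B"
    by (rule finite_subset[of _ "PiE UNIV (\<lambda>_. {..T})"]) (auto intro: finite_PiE)
  have X: "finite (X b) \<and> card (X b) = (N - sum b UNIV + card {i. b i = T}) choose card {i. b i = T}"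
    if b: "b \<in> ?B" for b
  proof -
    define F where "F = {i. b i = T}"
    let ?C = "{c::'n \<Rightarrow> nat. (\<forall>i. i \<notin> F \<longrightarrow> c i = 0) \<and> (\<Sum>i\<in>F. c i) \<le> N - sum b UNIV}"
    have "sum b UNIV \<le> (\<Sum>i\<in>(UNIV::'n set). T)" using b by (intro sum_mono) auto
    then have bN: "sum b UNIV \<le> N" using N by simp
    have sumF: "sum c UNIV = (\<Sum>i\<in>F. c i)" if "\<forall>i. i \<notin> F \<longrightarrow> c i = 0" for c :: "'n \<Rightarrow> nat"
      using that by (intro sum.mono_neutral_right) auto
    have "bij_betw (\<lambda>c i. b i + c i) ?C (X b)"
    proof (rule bij_betw_byWitness[where f' = "\<lambda>a i. a i - b i"])
      show "(\<lambda>c i. b i + c i) ` ?C \<subseteq> X b"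
      proof
        fix a assume "a \<in> (\<lambda>c i. b i + c i) ` ?C"
        then obtain c where c: "a = (\<lambda>i. b i + c i)" "\<forall>i. i \<notin> F \<longrightarrow> c i = 0" "(\<Sum>i\<in>F. c i) \<le> N - sum b UNIV"
          by blast
        have "?trunc a = b"
        proof
          fix i show "min (a i) T = b i"
            using c(1,2) b by (cases "i \<in> F") (auto simp: F_def)
        qed
        moreover have "sum a UNIV \<le> N"
          using c(3) sumF[OF c(2)] bN unfolding c(1) by (simp add: sum.distrib)
        ultimately show "a \<in> X b" by (simp add: X_def)
      qed
      show "(\<lambda>a i. a i - b i) ` X b \<subseteq> ?C"
      proof
        fix c assume "c \<in> (\<lambda>a i. a i - b i) ` X b"
        then obtain a where a: "c = (\<lambda>i. a i - b i)" "?trunc a = b" "sum a UNIV \<le> N" by (auto simp: X_def)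
        have le: "b i \<le> a i" for i unfolding a(2)[symmetric] by simp
        have z: "\<forall>i. i \<notin> F \<longrightarrow> c i = 0" unfolding a(1) a(2)[symmetric] F_def by (auto simp: min_def)
        have "sum c UNIV = sum a UNIV - sum b UNIV"
          unfolding a(1) using le by (intro sum_subtractf_nat) auto
        then show "c \<in> ?C" using z sumF[OF z] a(3) by simp
      qed
      show "\<forall>a\<in>X b. (\<lambda>i. b i + (a i - b i)) = a"
      proof
        fix a assume "a \<in> X b"
        then have "b i \<le> a i" for i by (auto simp: X_def)
        then show "(\<lambda>i. b i + (a i - b i)) = a" by simp
      qed
    qed auto
    then have "card (X b) = card ?C" "finite ?C \<longleftrightarrow> finite (X b)"
      by (auto dest: bij_betw_same_card bij_betw_finite)
    then show ?thesis using card_bounded_sum[of F "N - sum b UNIV"] by (simp add: F_def)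
  qed
  have eq: "{a\<in>D. sum a UNIV \<le> N} = (\<Union>b\<in>?B. X b)" using D by (auto simp: X_def)
  have "card {a\<in>D. sum a UNIV \<le> N} = (\<Sum>b\<in>?B. card (X b))"
    unfolding eq
  proof (rule card_UN_disjoint[OF finB])
    show "\<forall>b\<in>?B. finite (X b)" using X by blast
    show "\<forall>b\<in>?B. \<forall>b'\<in>?B. b \<noteq> b' \<longrightarrow> X b \<inter> X b' = {}" unfolding X_def by blast
  qed
  then show ?thesis using X by simp
qed

section \<open>Strata of the quotient\<close>

definition exps_diff :: "('n \<Rightarrow> nat) set \<Rightarrow> ('n \<Rightarrow> nat) set \<Rightarrow> nat \<Rightarrow> ('n \<Rightarrow> nat) set" where
  "exps_diff E J k = {a. a \<notin> power_exps E k \<and> (\<forall>f\<in>J. a \<in> power_exps (zero_on {i. f i \<noteq> 0} ` E) k)}"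

lemma zero_on_le_bound: "(\<And>e i. e \<in> E \<Longrightarrow> e i \<le> B) \<Longrightarrow> e \<in> zero_on S ` E \<Longrightarrow> e i \<le> (B::nat)"
  by (auto simp: zero_on_def)

lemma exps_diff_truncate:
  assumes "\<And>e i. e \<in> E \<Longrightarrow> e i \<le> B"
  shows "(\<lambda>i. min (a i) (B * k)) \<in> exps_diff E J k \<longleftrightarrow> a \<in> exps_diff E J k"
proof -
  have "(\<lambda>i. min (a i) (B * k)) \<in> power_exps E k \<longleftrightarrow> a \<in> power_exps E k"
    by (rule power_exps_truncate) (rule assms)
  moreover have "(\<lambda>i. min (a i) (B * k)) \<in> power_exps (zero_on S ` E) k \<longleftrightarrow> a \<in> power_exps (zero_on S ` E) k" for S
    by (rule power_exps_truncate, rule zero_on_le_bound[of E]) (use assms in auto)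
  ultimately show ?thesis by (simp add: exps_diff_def)
qed

text \<open>Has the form counted in \<open>lattice_count_limit\<close>, with all bounds proportional
  to \<open>k\<close>. Since the generators are zeroed on \<open>F\<close>, the coordinates in
  \<open>F\<close> are free below \<open>k\<close>.\<close>

abbreviation stratum_grid ::
    "('n \<Rightarrow> nat) set \<Rightarrow> ('n \<Rightarrow> nat) set \<Rightarrow> nat \<Rightarrow> 'n set \<Rightarrow> nat \<Rightarrow> ('n \<Rightarrow> nat) set" where
  "stratum_grid E J B F k \<equiv> {a. (\<forall>i. a i < (if i \<in> F then 1 else B) * k) \<and> a \<notin> power_exps (zero_on F ` E) k \<and>
       (\<forall>E'\<in>(\<lambda>f. zero_on (F \<union> {i. f i \<noteq> 0}) ` E) ` J. a \<in> power_exps E' k)}"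

text \<open>The coordinates in \<open>F\<close>, which are equal to \<open>B k\<close> in the elements counted on the left,
  range freely over \<open>{..<k}\<close> on the right, so that both sides live in the same dimension.\<close>

lemma card_stratum:
  fixes E J :: "('n::finite \<Rightarrow> nat) set"
  assumes E: "finite E" "\<And>e i. e \<in> E \<Longrightarrow> e i \<le> B" and k: "0 < k"
  shows "card (stratum (exps_diff E J k) (B * k) m) * k ^ m =
    (\<Sum>F | card F = m. card (stratum_grid E J B F k))"
proof -
  define T where "T = B * k"
  define X where "X F = {b \<in> exps_diff E J k. (\<forall>i. b i \<le> T) \<and> {i. b i = T} = F}" for F
  define W where "W F = (stratum_grid E J B F k)" for F
  have finX: "finite (X F)" for F
    by (rule finite_subset[of _ "PiE UNIV (\<lambda>_. {..T})"]) (auto simp: X_def intro: finite_PiE)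
  \<comment> \<open>Capped coordinates may be zeroed in the generators; after that the entries in
    \<open>F\<close> do not matter and can be exchanged for those of \<open>a\<close>.\<close>
  have iff: "b \<in> exps_diff E J k \<longleftrightarrow> a \<notin> power_exps (zero_on F ` E) k \<and>
       (\<forall>E'\<in>(\<lambda>f. zero_on (F \<union> {i. f i \<noteq> 0}) ` E) ` J. a \<in> power_exps E' k)"
    if ab: "\<And>i. i \<in> F \<Longrightarrow> b i = T" "\<And>i. i \<notin> F \<Longrightarrow> a i = b i" for a b F
  proof -
    have "b \<in> power_exps E k \<longleftrightarrow> a \<in> power_exps (zero_on F ` E) k"
    proof -
      have "b \<in> power_exps E k \<longleftrightarrow> b \<in> power_exps (zero_on F ` E) k"
        by (rule power_exps_zero_on_iff[symmetric, where B = B]) (use E ab in \<open>auto simp: T_def\<close>)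
      also have "\<dots> \<longleftrightarrow> a \<in> power_exps (zero_on F ` E) k"
        by (rule power_exps_zero_on_cong) (use E ab in auto)
      finally show ?thesis .
    qed
    moreover have "b \<in> power_exps (zero_on S ` E) k \<longleftrightarrow> a \<in> power_exps (zero_on (F \<union> S) ` E) k" for S
    proof -
      have "b \<in> power_exps (zero_on S ` E) k \<longleftrightarrow> b \<in> power_exps (zero_on F ` zero_on S ` E) k"
        by (rule power_exps_zero_on_iff[symmetric, where B = B])
           (use E ab zero_on_le_bound[of E B] in \<open>auto simp: T_def\<close>)
      also have "\<dots> \<longleftrightarrow> a \<in> power_exps (zero_on F ` zero_on S ` E) k"
        by (rule power_exps_zero_on_cong) (use E ab in auto)
      finally show ?thesis by (simp add: zero_on_image_image)
    qed
    ultimately show ?thesis by (auto simp: exps_diff_def)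
  qed
  have cardW: "card (W F) = card (X F) * k ^ card F" for F
  proof -
    let ?P = "PiE F (\<lambda>_. {..<k})"
    have "bij_betw (\<lambda>(b, c) i. if i \<in> F then c i else b i) (X F \<times> ?P) (W F)"
    proof (rule bij_betw_byWitness[where f' = "\<lambda>a. (\<lambda>i. if i \<in> F then T else a i, restrict a F)"])
      show "\<forall>p\<in>X F \<times> ?P. (\<lambda>a. (\<lambda>i. if i \<in> F then T else a i, restrict a F))
          ((\<lambda>(b, c) i. if i \<in> F then c i else b i) p) = p"
        by (auto simp: X_def fun_eq_iff PiE_def extensional_def)
      show "(\<lambda>(b, c) i. if i \<in> F then c i else b i) ` (X F \<times> ?P) \<subseteq> W F"
      proof clarify
        fix b c assume b: "b \<in> X F" and c: "c \<in> ?P"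
        have "b i < T" if "i \<notin> F" for i using b that by (auto simp: X_def less_le)
        then show "(\<lambda>i. if i \<in> F then c i else b i) \<in> W F"
          using iff[of F b "\<lambda>i. if i \<in> F then c i else b i"] b c
          by (auto simp: W_def T_def X_def)
      qed
      show "(\<lambda>a. (\<lambda>i. if i \<in> F then T else a i, restrict a F)) ` W F \<subseteq> X F \<times> ?P"
      proof
        fix p assume "p \<in> (\<lambda>a. (\<lambda>i. if i \<in> F then T else a i, restrict a F)) ` W F"
        then obtain a where a: "a \<in> W F" and p: "p = (\<lambda>i. if i \<in> F then T else a i, restrict a F)" by blast
        have lt: "a i < (if i \<in> F then 1 else B) * k" for i using a by (auto simp: W_def)
        have "(\<lambda>i. if i \<in> F then T else a i) \<in> exps_diff E J k"
          using iff[of F "\<lambda>i. if i \<in> F then T else a i" a] a by (simp add: W_def)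
        moreover have "(if i \<in> F then T else a i) \<le> T" for i using lt[of i] by (auto simp: T_def)
        moreover have "{i. (if i \<in> F then T else a i) = T} = F"
          using lt by (auto simp: T_def split: if_splits) (metis less_irrefl)
        moreover have "restrict a F \<in> ?P"
        proof (rule restrict_PiE_iff[THEN iffD2], rule ballI)
          fix i assume "i \<in> F"
          then show "a i \<in> {..<k}" using lt[of i] by simp
        qed
        ultimately show "p \<in> X F \<times> ?P" by (simp add: p X_def)
      qed
      show "\<forall>a\<in>W F. (\<lambda>(b, c) i. if i \<in> F then c i else b i) (\<lambda>i. if i \<in> F then T else a i, restrict a F) = a"
        by (auto simp: fun_eq_iff)
    qed
    then have "card (W F) = card (X F \<times> ?P)" by (simp add: bij_betw_same_card)
    then show ?thesis by (simp add: card_cartesian_product card_PiE)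
  qed
  have eq: "(stratum (exps_diff E J k) T m) = (\<Union>F\<in>{F. card F = m}. X F)"
    by (auto simp: X_def)
  have "card (stratum (exps_diff E J k) T m) = (\<Sum>F | card F = m. card (X F))"
    unfolding eq by (rule card_UN_disjoint) (use finX in \<open>auto simp: X_def\<close>)
  then have "card (stratum (exps_diff E J k) T m) * k ^ m = (\<Sum>F | card F = m. card (W F))"
    by (simp add: cardW sum_distrib_right)
  then show ?thesis by (simp only: T_def W_def)
qed

text \<open>The stratum is resolved by the set of capped coordinates, and each of the finitely many
  grids contributes a rational limit.\<close>

lemma stratum_limit:
  fixes E J :: "('n::finite \<Rightarrow> nat) set"
  assumes "finite E" "finite J" "\<And>e i. e \<in> E \<Longrightarrow> e i \<le> B"
  shows "\<exists>q\<in>\<rat>. (\<lambda>k. real (card (stratum (exps_diff E J k) (B * k) m) * k ^ m)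
     / real k ^ CARD('n)) \<longlonglongrightarrow> q"
proof -
  define W where "W F k = (stratum_grid E J B F k)" for F k
  have "\<exists>q\<in>\<rat>. (\<lambda>k. real (card (W F k)) / real k ^ CARD('n)) \<longlonglongrightarrow> q" for F
    unfolding W_def using assms by (intro lattice_count_limit) auto
  then obtain q where q: "\<And>F. q F \<in> \<rat>" "\<And>F. (\<lambda>k. real (card (W F k)) / real k ^ CARD('n)) \<longlonglongrightarrow> q F"
    by metis
  have "(\<lambda>k. \<Sum>F | card F = m. real (card (W F k)) / real k ^ CARD('n)) \<longlonglongrightarrow> (\<Sum>F | card F = m. q F)"
    by (intro tendsto_sum q)
  moreover have "\<forall>\<^sub>F k in sequentially. (\<Sum>F | card F = m. real (card (W F k)) / real k ^ CARD('n)) =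
    real (card (stratum (exps_diff E J k) (B * k) m) * k ^ m) / real k ^ CARD('n)"
    using eventually_gt_at_top[of 0]
  proof eventually_elim
    case (elim k)
    show ?case
      by (subst card_stratum) (use assms elim in \<open>auto simp: W_def sum_divide_distrib\<close>)
  qed
  ultimately have "(\<lambda>k. real (card (stratum (exps_diff E J k) (B * k) m) * k ^ m)
     / real k ^ CARD('n)) \<longlonglongrightarrow> (\<Sum>F | card F = m. q F)"
    by (rule Lim_transform_eventually)
  moreover have "(\<Sum>F | card F = m. q F) \<in> \<rat>" by (intro Rats_sum) (use q in auto)
  ultimately show ?thesis by blast
qed

section \<open>Binomial expansions of rational polynomials\<close>

definition binomial_poly :: "rat \<Rightarrow> nat \<Rightarrow> rat poly" where
  "binomial_poly c j = Polynomial.smult (1 / fact j) (\<Prod>i<j. [:c - of_nat i, 1:])"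

lemma poly_binomial_poly: "poly (binomial_poly c j) x = (x + c) gchoose j"
  by (simp add: binomial_poly_def poly_prod gbinomial_prod_rev atLeast0LessThan algebra_simps)

lemma degree_prod_linear: "degree (\<Prod>i<j. [:c - of_nat i, 1:] :: rat poly) = j"
  by (subst degree_prod_eq_sum_degree) auto

lemma degree_binomial_poly: "degree (binomial_poly c j) = j"
  by (simp add: binomial_poly_def degree_prod_linear)

lemma coeff_binomial_poly: "coeff (binomial_poly c j) j = 1 / fact j"
proof -
  have "lead_coeff (\<Prod>i<j. [:c - of_nat i, 1:]) = 1" by (simp add: lead_coeff_prod)
  then show ?thesis by (simp add: binomial_poly_def degree_prod_linear)
qed

definition binomial_expansion :: "nat \<Rightarrow> (nat \<Rightarrow> rat) \<Rightarrow> rat poly" where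
  "binomial_expansion d e =
     (\<Sum>i\<le>d. Polynomial.smult ((-1) ^ i * e i) (binomial_poly (of_nat (d - i)) (d - i)))"

lemma poly_binomial_expansion:
  "poly (binomial_expansion d e) x = (\<Sum>i\<le>d. (-1) ^ i * e i * ((x + of_nat (d - i)) gchoose (d - i)))"
  by (simp add: binomial_expansion_def poly_sum poly_binomial_poly)

text \<open>Removing the top term lowers the degree and shifts the coefficients, the alternating
  sign being absorbed into \<open>- e (Suc i)\<close>. Existence and uniqueness both descend along
  this identity.\<close>

lemma binomial_expansion_Suc:
  "binomial_expansion (Suc d) e = Polynomial.smult (e 0) (binomial_poly (of_nat (Suc d)) (Suc d)) +
     binomial_expansion d (\<lambda>i. - e (Suc i))"
  unfolding binomial_expansion_def by (subst sum.atMost_Suc_shift) (simp del: of_nat_Suc)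

lemma coeff_binomial_expansion: "coeff (binomial_expansion d e) d = e 0 / fact d"
proof -
  have "coeff (binomial_expansion d e) d =
    (\<Sum>i\<le>d. (-1) ^ i * e i * coeff (binomial_poly (of_nat (d - i)) (d - i)) d)"
    by (simp add: binomial_expansion_def coeff_sum)
  also have "\<dots> = (\<Sum>i\<le>d. if i = 0 then e 0 / fact d else 0)"
    by (intro sum.cong refl) (auto simp: coeff_binomial_poly coeff_eq_0 degree_binomial_poly)
  finally show ?thesis by simp
qed

lemma binomial_expansion_inj:
  "binomial_expansion d e = binomial_expansion d e' \<Longrightarrow> i \<le> d \<Longrightarrow> e i = e' i"
proof (induction d arbitrary: e e' i)
  case 0
  then show ?case using coeff_binomial_expansion[of 0 e] coeff_binomial_expansion[of 0 e'] by simp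
next
  case (Suc d)
  have e0: "e 0 = e' 0"
    using coeff_binomial_expansion[of "Suc d" e] coeff_binomial_expansion[of "Suc d" e'] Suc.prems by simp
  then have "binomial_expansion d (\<lambda>i. - e (Suc i)) = binomial_expansion d (\<lambda>i. - e' (Suc i))"
    using Suc.prems(1) by (simp add: binomial_expansion_Suc)
  from Suc.IH[OF this] show ?case using e0 Suc.prems(2) by (cases i) auto
qed

lemma binomial_expansion_exists:
  "degree P \<le> d \<Longrightarrow> \<exists>e. binomial_expansion d e = P \<and> (\<forall>i>d. e i = 0)"
proof (induction d arbitrary: P)
  case 0
  then obtain c where "P = [:c:]" using degree_eq_zeroE[of P] by auto
  then show ?case
    by (intro exI[of _ "\<lambda>i. if i = 0 then c else 0"]) (simp add: binomial_expansion_def binomial_poly_def)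
next
  case (Suc d)
  \<comment> \<open>The factorial compensates for the leading coefficient
    \<open>1 / fact (Suc d)\<close> of the binomial polynomial, so subtracting it cancels the top
    term of \<open>P\<close>.\<close>
  define c where "c = coeff P (Suc d) * fact (Suc d)"
  define Q where "Q = P - Polynomial.smult c (binomial_poly (of_nat (Suc d)) (Suc d))"
  have "coeff Q (Suc d) = 0" by (simp add: Q_def c_def coeff_binomial_poly del: of_nat_Suc fact_Suc)
  moreover have "degree Q \<le> Suc d"
    unfolding Q_def using Suc.prems degree_smult_le[of c "binomial_poly (of_nat (Suc d)) (Suc d)"]
    by (intro degree_diff_le) (auto simp: degree_binomial_poly simp del: of_nat_Suc)
  ultimately have "degree Q \<le> d"
    by (metis Suc_le_eq degree_0 eq_zero_or_degree_less le_SucE less_Suc_eq_le zero_le leading_coeff_0_iff)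
  then obtain e where e: "binomial_expansion d e = Q" "\<forall>i>d. e i = 0" using Suc.IH by blast
  define e' where "e' i = (case i of 0 \<Rightarrow> c | Suc i \<Rightarrow> - e i)" for i
  have "(\<lambda>i. - e' (Suc i)) = e" by (auto simp: e'_def)
  then have "binomial_expansion (Suc d) e' = P"
    by (simp add: binomial_expansion_Suc e(1) e'_def Q_def)
  moreover have "\<forall>i>Suc d. e' i = 0" using e(2) by (auto simp: e'_def split: nat.split)
  ultimately show ?case by blast
qed

text \<open>The definite description is justified by existence and uniqueness up to index
  \<open>d\<close>, the values beyond being fixed at 0. The degree of \<open>P\<close> may be
  smaller than \<open>d\<close>, and then \<open>e 0\<close> is 0.\<close>

lemma the_binomial_coeff_0:
  fixes P :: "rat poly"
  assumes "degree P \<le> d"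
  shows "(THE e. (\<forall>x. poly P x = (\<Sum>i\<le>d. (-1) ^ i * e i * ((x + of_nat (d - i)) gchoose (d - i)))) \<and>
    (\<forall>i>d. e i = 0)) 0 = coeff P d * fact d"
proof -
  obtain e where e: "binomial_expansion d e = P" "\<forall>i>d. e i = 0"
    using binomial_expansion_exists[OF assms] by blast
  have iff: "(\<forall>x. poly P x = (\<Sum>i\<le>d. (-1) ^ i * e' i * ((x + of_nat (d - i)) gchoose (d - i)))) \<longleftrightarrow>
    P = binomial_expansion d e'" for e'
    unfolding poly_binomial_expansion[symmetric] poly_eq_poly_eq_iff[symmetric] fun_eq_iff by (rule refl)
  have "(THE e. (\<forall>x. poly P x = (\<Sum>i\<le>d. (-1) ^ i * e i * ((x + of_nat (d - i)) gchoose (d - i)))) \<and>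
    (\<forall>i>d. e i = 0)) = e"
  proof (rule the_equality, unfold iff)
    show "P = binomial_expansion d e \<and> (\<forall>i>d. e i = 0)" using e by simp
    fix e' assume e': "P = binomial_expansion d e' \<and> (\<forall>i>d. e' i = 0)"
    show "e' = e"
    proof
      fix i
      show "e' i = e i"
        using binomial_expansion_inj[of d e' e i] e e' by (cases "i \<le> d") auto
    qed
  qed
  then show ?thesis using coeff_binomial_expansion[of d e] e(1) by simp
qed

text \<open>The difference has infinitely many roots. This makes the Hilbert polynomial
  unique.\<close>

lemma poly_eqI_eventually:
  fixes P Q :: "rat poly"
  assumes "\<forall>\<^sub>F i in sequentially. poly P (of_nat i) = poly Q (of_nat i)"
  shows "P = Q"
proof (rule ccontr)
  assume "P \<noteq> Q"
  then have "finite {x. poly (P - Q) x = 0}" by (intro poly_roots_finite) simp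
  moreover obtain N where "\<And>i. i \<ge> N \<Longrightarrow> poly P (of_nat i) = poly Q (of_nat i)"
    using assms by (auto simp: eventually_sequentially)
  then have "of_nat ` {N..} \<subseteq> {x. poly (P - Q) x = 0}" by auto
  ultimately have "finite (of_nat ` {N..} :: rat set)" by (rule finite_subset[rotated])
  then have "finite {N..}" by (rule finite_imageD) (simp add: inj_on_def)
  then show False by (simp add: infinite_Ici)
qed

section \<open>Hilbert polynomials of truncation-invariant sets\<close>

text \<open>Every truncated \<open>b\<close> contributes a binomial polynomial whose degree is its
  number of capped coordinates. In degree \<open>d\<close> only those with exactly \<open>d\<close>
  of them are visible, each with coefficient \<open>1 / fact d\<close>; there may be none.\<close>

lemma truncation_invariant_poly:
  fixes D :: "('n::finite \<Rightarrow> nat) set"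
  assumes D: "\<And>a. (\<lambda>i. min (a i) T) \<in> D \<longleftrightarrow> a \<in> D"
    and d: "\<And>b. b \<in> D \<Longrightarrow> (\<And>i. b i \<le> T) \<Longrightarrow> card {i. b i = T} \<le> d"
  shows "\<exists>P::rat poly. degree P \<le> d \<and>
    coeff P d * fact d = of_nat (card (stratum D T d)) \<and>
    (\<forall>\<^sub>F N in sequentially. of_nat (card {a\<in>D. sum a UNIV \<le> N}) = poly P (of_nat N))"
proof -
  let ?B = "{b \<in> D. \<forall>i. b i \<le> T}"
  let ?s = "\<lambda>b. sum b UNIV"
  let ?f = "\<lambda>b. card {i. b i = T}"
  have finB: "finite ?B"
    by (rule finite_subset[of _ "PiE UNIV (\<lambda>_. {..T})"]) (auto intro: finite_PiE)
  define P where "P = (\<Sum>b\<in>?B. binomial_poly (of_nat (?f b) - of_nat (?s b)) (?f b))"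
  have "degree P \<le> d" unfolding P_def
    by (intro degree_sum_le finB) (auto simp: degree_binomial_poly d)
  moreover have "coeff P d * fact d = of_nat (card (stratum D T d))"
  proof -
    have "coeff P d = (\<Sum>b\<in>?B. if ?f b = d then 1 / fact d else 0)"
      unfolding P_def coeff_sum
    proof (rule sum.cong[OF refl])
      fix b assume "b \<in> ?B"
      then have "?f b \<le> d" using d by blast
      then show "coeff (binomial_poly (of_nat (?f b) - of_nat (?s b)) (?f b)) d = (if ?f b = d then 1 / fact d else 0)"
        using coeff_binomial_poly[of _ d] by (auto intro!: coeff_eq_0 simp: degree_binomial_poly)
    qed
    also have "\<dots> = (\<Sum>b\<in>{b\<in>?B. ?f b = d}. 1 / fact d)"
      by (rule sum.inter_filter[OF finB, symmetric])
    also have "{b\<in>?B. ?f b = d} = (stratum D T d)" by auto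
    finally show ?thesis by simp
  qed
  moreover have "of_nat (card {a\<in>D. sum a UNIV \<le> N}) = poly P (of_nat N)" if N: "CARD('n) * T \<le> N" for N
  proof -
    have "of_nat ((N - ?s b + ?f b) choose ?f b) = poly (binomial_poly (of_nat (?f b) - of_nat (?s b)) (?f b)) (of_nat N :: rat)"
      if b: "b \<in> ?B" for b
    proof -
      have "?s b \<le> (\<Sum>i\<in>(UNIV::'n set). T)" using b by (intro sum_mono) auto
      then have "?s b \<le> N" using N by simp
      then show ?thesis
        unfolding poly_binomial_poly binomial_gbinomial by (simp add: of_nat_diff algebra_simps)
    qed
    then show ?thesis unfolding card_truncation_invariant[OF D N] P_def poly_sum of_nat_sum by (intro sum.cong) auto
  qed
  then have "\<forall>\<^sub>F N in sequentially. of_nat (card {a\<in>D. sum a UNIV \<le> N}) = poly P (of_nat N)"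
    by (auto simp: eventually_sequentially)
  ultimately show ?thesis by blast
qed

section \<open>Ideals of the polynomial ring spanned by monomials\<close>

abbreviation "lookup \<equiv> Poly_Mapping.lookup"
abbreviation "keys \<equiv> Poly_Mapping.keys"
abbreviation "single \<equiv> Poly_Mapping.single"

lemma class_ring_idealI:
  fixes A :: "'a::comm_ring_1 set"
  assumes "0 \<in> A" "\<And>x y. x \<in> A \<Longrightarrow> y \<in> A \<Longrightarrow> x + y \<in> A" "\<And>r x. x \<in> A \<Longrightarrow> r * x \<in> A"
  shows "ideal A class_ring"
proof (rule idealI)
  show "ring (class_ring :: 'a ring)" by (rule class_ring.ring_axioms)
  show "subgroup A (add_monoid (class_ring :: 'a ring))"
  proof (rule group.subgroupI)
    show "group (add_monoid (class_ring :: 'a ring))" 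
      by (rule abelian_group.a_group[OF ring.axioms(1)[OF class_ring.ring_axioms]])
    show "A \<noteq> {}" using assms(1) by blast
    fix x assume "x \<in> A"
    then have "- x \<in> A" using assms(3)[of x "-1"] by simp
    then show "inv\<^bsub>add_monoid class_ring\<^esub> x \<in> A"
      using class_ring_simps(8)[where 'a = 'a] by (simp add: a_inv_def fun_eq_iff)
  qed (use assms in auto)
qed (use assms in \<open>auto simp: mult.commute\<close>)

lemma class_ring_idealD:
  fixes A :: "'a::comm_ring_1 set"
  assumes "ideal A class_ring"
  shows "0 \<in> A" "x \<in> A \<Longrightarrow> y \<in> A \<Longrightarrow> x + y \<in> A" "x \<in> A \<Longrightarrow> r * x \<in> A"
    "x \<in> A \<Longrightarrow> - x \<in> A" "x \<in> A \<Longrightarrow> y \<in> A \<Longrightarrow> x - y \<in> A"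
proof -
  interpret ideal A "class_ring :: 'a ring" by fact
  show a: "0 \<in> A" "\<And>x y. x \<in> A \<Longrightarrow> y \<in> A \<Longrightarrow> x + y \<in> A" and b: "\<And>x r. x \<in> A \<Longrightarrow> r * x \<in> A"
    using additive_subgroup.zero_closed[OF additive_subgroup_axioms]
      additive_subgroup.a_closed[OF additive_subgroup_axioms] I_l_closed by auto
  show c: "\<And>x. x \<in> A \<Longrightarrow> - x \<in> A" using b[of _ "-1"] by simp
  show "x \<in> A \<Longrightarrow> y \<in> A \<Longrightarrow> x - y \<in> A" using a(2)[of x "- y"] c by simp
qed

definition exp_monom :: "('n::finite \<Rightarrow> nat) \<Rightarrow> 'n \<Rightarrow>\<^sub>0 nat" where
  "exp_monom a = Abs_poly_mapping a"

lemma lookup_exp_monom [simp]: "lookup (exp_monom a) = a"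
  by (simp add: exp_monom_def)

lemma exp_monom_lookup [simp]: "exp_monom (lookup m) = m"
  by (simp add: exp_monom_def)

lemma inj_exp_monom: "inj exp_monom"
  by (metis injI lookup_exp_monom)

definition up_closed :: "('n \<Rightarrow> nat) set \<Rightarrow> bool" where
  "up_closed U \<longleftrightarrow> (\<forall>a\<in>U. \<forall>b. (\<forall>i. a i \<le> b i) \<longrightarrow> b \<in> U)"

lemma up_closedD: "up_closed U \<Longrightarrow> a \<in> U \<Longrightarrow> (\<And>i. a i \<le> b i) \<Longrightarrow> b \<in> U"
  by (auto simp: up_closed_def)

lemma up_closed_power_exps: "up_closed (power_exps E k)"
  by (auto simp: up_closed_def intro: power_exps_mono)

text \<open>The span of the monomials with exponents in \<open>U\<close>. It is an ideal if
  \<open>U\<close> is up-closed, but the same notation serves homogeneous parts, cubes and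
  complements \<open>G - U\<close>, which are treated only as subspaces.\<close>

definition exps_ideal :: "('n::finite \<Rightarrow> nat) set \<Rightarrow> ('n, 'k::field) mpoly set" where
  "exps_ideal U = {p. \<forall>m\<in>keys p. lookup m \<in> U}"

lemma exps_ideal_iff_lookup:
  "p \<in> exps_ideal U \<longleftrightarrow> (\<forall>a. a \<notin> U \<longrightarrow> lookup p (exp_monom a) = 0)"
proof
  assume p: "p \<in> exps_ideal U"
  show "\<forall>a. a \<notin> U \<longrightarrow> lookup p (exp_monom a) = 0"
  proof (intro allI impI)
    fix a assume "a \<notin> U"
    then have "exp_monom a \<notin> keys p" using p by (auto simp: exps_ideal_def)
    then show "lookup p (exp_monom a) = 0" by (simp add: in_keys_iff)
  qed
next
  assume p: "\<forall>a. a \<notin> U \<longrightarrow> lookup p (exp_monom a) = 0"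
  have "lookup m \<in> U" if "m \<in> keys p" for m
    using p[rule_format, of "lookup m"] that by (auto simp: in_keys_iff)
  then show "p \<in> exps_ideal U" by (simp add: exps_ideal_def)
qed

lemma exps_ideal_mono: "U \<subseteq> V \<Longrightarrow> exps_ideal U \<subseteq> exps_ideal V"
  by (auto simp: exps_ideal_def)

lemma zero_in_exps_ideal [simp]: "0 \<in> exps_ideal U"
  by (simp add: exps_ideal_def)

lemma add_in_exps_ideal: "p \<in> exps_ideal U \<Longrightarrow> q \<in> exps_ideal U \<Longrightarrow> p + q \<in> exps_ideal U"
  by (auto simp: exps_ideal_iff_lookup lookup_add)

lemma mult_in_exps_ideal:
  assumes "p \<in> exps_ideal U" "q \<in> exps_ideal V"
    and "\<And>a b. a \<in> U \<Longrightarrow> b \<in> V \<Longrightarrow> (\<lambda>i. a i + b i) \<in> W"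
  shows "p * q \<in> exps_ideal W"
proof -
  have "lookup m \<in> W" if m: "m \<in> keys (p * q)" for m
  proof -
    obtain a b where "m = a + b" "a \<in> keys p" "b \<in> keys q"
      using m keys_mult[of p q] by auto
    moreover have "lookup (a + b) = (\<lambda>i. lookup a i + lookup b i)"
      by (simp add: fun_eq_iff lookup_add)
    ultimately show ?thesis using assms by (auto simp: exps_ideal_def)
  qed
  then show ?thesis by (simp add: exps_ideal_def)
qed

lemma mult_left_in_exps_ideal:
  assumes "up_closed U" "p \<in> exps_ideal U"
  shows "r * p \<in> exps_ideal U"
  by (rule mult_in_exps_ideal[of r UNIV p U])
     (use assms in \<open>auto simp: exps_ideal_def intro: up_closedD\<close>)

lemma ideal_exps_ideal: "up_closed U \<Longrightarrow> ideal (exps_ideal U) mpoly_ring"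
  by (intro class_ring_idealI add_in_exps_ideal mult_left_in_exps_ideal zero_in_exps_ideal)

lemma single_in_exps_ideal:
  "lookup m \<in> U \<Longrightarrow> single m c \<in> exps_ideal U"
  by (auto simp: exps_ideal_def)

lemma mpoly_sum_singles:
  fixes p :: "'a \<Rightarrow>\<^sub>0 'b::comm_monoid_add"
  shows "p = (\<Sum>m\<in>keys p. single m (lookup p m))"
proof (rule poly_mapping_eqI)
  fix m
  have "lookup (\<Sum>m\<in>keys p. single m (lookup p m)) m =
    (\<Sum>m'\<in>keys p. if m' = m then lookup p m else 0)"
    unfolding lookup_sum by (intro sum.cong refl) (auto simp: lookup_single when_def)
  also have "\<dots> = lookup p m" by (simp add: in_keys_iff)
  finally show "lookup p m = lookup
    (\<Sum>m\<in>keys p. single m (lookup p m)) m" by simp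
qed

lemma exps_ideal_induct [consumes 1, case_names zero add single]:
  assumes "p \<in> exps_ideal U" "P 0" "\<And>p q. P p \<Longrightarrow> P q \<Longrightarrow> P (p + q)"
    "\<And>m c. lookup m \<in> U \<Longrightarrow> P (single m c)"
  shows "P p"
proof -
  have "P (\<Sum>m\<in>M. single m (lookup p m))"
    if "M \<subseteq> keys p" "finite M" for M
    using that(2,1) assms by (induction M rule: finite_induct) (auto simp: exps_ideal_def)
  then show ?thesis using mpoly_sum_singles[of p] by (metis finite_keys order_refl)
qed

lemma genideal_monomials:
  fixes E :: "('n::finite \<Rightarrow>\<^sub>0 nat) set"
  shows "genideal mpoly_ring (monomial ` E) =
    (exps_ideal {a. \<exists>e\<in>E. \<forall>i. lookup e i \<le> a i} :: ('n, 'k::field) mpoly set)"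
    (is "?L = exps_ideal ?U")
proof
  have up: "up_closed ?U" by (auto simp: up_closed_def intro: order_trans)
  show "?L \<subseteq> exps_ideal ?U"
    by (rule ring.genideal_minimal[OF class_ring.ring_axioms ideal_exps_ideal[OF up]])
       (auto simp: monomial_def intro: single_in_exps_ideal)
  have L: "ideal ?L mpoly_ring" by (rule ring.genideal_ideal[OF class_ring.ring_axioms]) simp
  show "exps_ideal ?U \<subseteq> ?L"
  proof
    fix p :: "('n, 'k) mpoly" assume "p \<in> exps_ideal ?U"
    then show "p \<in> ?L"
    proof (induction rule: exps_ideal_induct)
      case (single m c)
      then obtain e where e: "e \<in> E" "\<And>i. lookup e i \<le> lookup m i" by blast
      have "m = (m - e) + e" using e(2) by (intro poly_mapping_eqI) (simp add: lookup_add lookup_minus)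
      then have "single m c = single (m - e) c * monomial e"
        by (simp add: monomial_def mult_single)
      moreover have "(monomial e :: ('n, 'k) mpoly) \<in> ?L"
        using ring.genideal_self[OF class_ring.ring_axioms, of "monomial ` E :: ('n, 'k) mpoly set"] e(1) by auto
      ultimately show ?case using class_ring_idealD(3)[OF L] by metis
    qed (use class_ring_idealD[OF L] in auto)
  qed
qed

text \<open>A monomial ideal may be presented by infinitely many monomials; Dickson's lemma supplies
  the finite set on which the sums over generators rely.\<close>

lemma finite_generators:
  fixes E :: "('n::finite \<Rightarrow>\<^sub>0 nat) set"
  obtains E' :: "('n \<Rightarrow> nat) set" where "finite E'"
    "{a. \<exists>e\<in>E. \<forall>i. lookup e i \<le> a i} = {a. \<exists>e\<in>E'. \<forall>i. e i \<le> a i}"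
proof -
  obtain E' where E': "E' \<subseteq> lookup ` E" "finite E'"
    "\<And>e. e \<in> lookup ` E \<Longrightarrow> \<exists>e'\<in>E'. \<forall>i. e' i \<le> e i"
    using dickson[of "lookup ` E"] by blast
  have "{a. \<exists>e\<in>E. \<forall>i. lookup e i \<le> a i} = {a. \<exists>e\<in>E'. \<forall>i. e i \<le> a i}"
  proof (rule Set.set_eqI, unfold mem_Collect_eq, rule iffI)
    fix a assume "\<exists>e\<in>E. \<forall>i. lookup e i \<le> a i"
    then obtain e where e: "e \<in> E" "\<forall>i. lookup e i \<le> a i" by blast
    obtain e' where "e' \<in> E'" "\<forall>i. e' i \<le> lookup e i" using E'(3) e(1) by blast
    then show "\<exists>e\<in>E'. \<forall>i. e i \<le> a i" using e(2) order_trans by blast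
  next
    fix a assume "\<exists>e\<in>E'. \<forall>i. e i \<le> a i"
    then show "\<exists>e\<in>E. \<forall>i. lookup e i \<le> a i" using E'(1) by blast
  qed
  then show ?thesis using that E'(2) by blast
qed

lemma monomial_ideal_generators:
  assumes "monomial_ideal I"
  obtains E where "finite E" "I = exps_ideal {a. \<exists>e\<in>E. \<forall>i. e i \<le> a i}"
proof -
  obtain M where M: "I = genideal mpoly_ring (monomial ` M)" using assms by (auto simp: monomial_ideal_def)
  obtain E where "finite E"
    "{a. \<exists>e\<in>M. \<forall>i. lookup e i \<le> a i} = {a. \<exists>e\<in>E. \<forall>i. e i \<le> a i}"
    using finite_generators[of M] .
  then show ?thesis using that[of E] M genideal_monomials[of M] by simp
qed

section \<open>Products, colons and saturations of monomial ideals\<close>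

lemma ideal_prod_exps_ideal:
  assumes "up_closed U" "up_closed V"
  shows "ideal_prod mpoly_ring (exps_ideal U) (exps_ideal V) =
    (exps_ideal {c. \<exists>a\<in>U. \<exists>b\<in>V. \<forall>i. a i + b i \<le> c i} :: ('n::finite, 'k::field) mpoly set)"
    (is "?L = exps_ideal ?W")
proof
  show "?L \<subseteq> exps_ideal ?W"
  proof
    fix p assume "p \<in> ?L"
    then show "p \<in> exps_ideal ?W"
    proof (induction rule: ideal_prod.induct)
      case (prod p q)
      then have "p * q \<in> exps_ideal ?W"
        by (intro mult_in_exps_ideal[of p U q V]) (auto intro!: bexI)
      then show ?case by simp
    next
      case (sum p q)
      then show ?case using add_in_exps_ideal[of p _ q] by simp
    qed
  qed
  show "exps_ideal ?W \<subseteq> ?L"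
  proof
    fix p :: "('n, 'k) mpoly" assume "p \<in> exps_ideal ?W"
    then show "p \<in> ?L"
    proof (induction rule: exps_ideal_induct)
      case zero
      show ?case using ideal_prod.prod[of 0 "exps_ideal U" 0 "exps_ideal V" mpoly_ring] by simp
    next
      case (add p q)
      then show ?case using ideal_prod.sum[of p mpoly_ring _ _ q] by simp
    next
      case (single m c)
      then obtain a b where ab: "a \<in> U" "b \<in> V" "\<And>i. a i + b i \<le> lookup m i" by blast
      \<comment> \<open>The second factor receives exactly \<open>b\<close>; the first receives all
        the rest, which still dominates \<open>a\<close>.\<close>
      define m1 where "m1 = exp_monom (\<lambda>i. lookup m i - b i)"
      have le: "b i \<le> lookup m i" "a i \<le> lookup m i - b i" for i
        using ab(3)[of i] by auto
      have "m = m1 + exp_monom b"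
        by (intro poly_mapping_eqI) (simp add: m1_def lookup_add le)
      then have "single m c = single m1 c * single (exp_monom b) 1"
        by (simp add: mult_single)
      moreover have "single m1 c \<in> exps_ideal U"
        by (rule single_in_exps_ideal) (use up_closedD[OF assms(1) ab(1)] le in \<open>simp add: m1_def\<close>)
      moreover have "single (exp_monom b) (1::'k) \<in> exps_ideal V"
        by (rule single_in_exps_ideal) (use ab(2) in simp)
      ultimately show ?case
        using ideal_prod.prod[of "single m1 c" "exps_ideal U"
            "single (exp_monom b) 1" "exps_ideal V" mpoly_ring] by simp
    qed
  qed
qed

lemma ideal_power_exps_ideal:
  assumes "finite E"
  shows "ideal_power mpoly_ring (exps_ideal {a. \<exists>e\<in>E. \<forall>i. e i \<le> a i}) k =
    (exps_ideal (power_exps E k) :: ('n::finite, 'k::field) mpoly set)"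
proof (induction k)
  case 0
  show ?case by (simp add: ideal_power_def ideals_set_def power_exps_0 exps_ideal_def)
next
  case (Suc k)
  let ?U = "{a. \<exists>e\<in>E. \<forall>i. e i \<le> a i}"
  have up: "up_closed ?U" by (auto simp: up_closed_def intro: order_trans)
  have "ideal_power mpoly_ring (exps_ideal ?U) (Suc k) =
    ideal_prod mpoly_ring (exps_ideal (power_exps E k)) (exps_ideal ?U :: ('n, 'k) mpoly set)"
    using Suc.IH by (simp add: ideal_power_def ideals_set_def nat_pow_def)
  also have "\<dots> = exps_ideal {c. \<exists>a\<in>power_exps E k. \<exists>b\<in>?U. \<forall>i. a i + b i \<le> c i}"
    by (rule ideal_prod_exps_ideal[OF up_closed_power_exps up])
  also have "{c. \<exists>a\<in>power_exps E k. \<exists>b\<in>?U. \<forall>i. a i + b i \<le> c i} = power_exps E (Suc k)"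
  proof (rule Set.set_eqI, unfold mem_Collect_eq power_exps_Suc[OF assms], rule iffI)
    fix c assume "\<exists>a\<in>power_exps E k. \<exists>b\<in>?U. \<forall>i. a i + b i \<le> c i"
    then obtain a b e where *: "a \<in> power_exps E k" "e \<in> E" "\<And>i. e i \<le> b i" "\<And>i. a i + b i \<le> c i" by blast
    have "a i + e i \<le> c i" for i using *(3,4)[of i] by linarith
    then show "\<exists>b\<in>power_exps E k. \<exists>e\<in>E. \<forall>i. b i + e i \<le> c i" using *(1,2) by blast
  next
    fix c assume "\<exists>b\<in>power_exps E k. \<exists>e\<in>E. \<forall>i. b i + e i \<le> c i"
    then obtain b e where *: "b \<in> power_exps E k" "e \<in> E" "\<forall>i. b i + e i \<le> c i" by blast
    then show "\<exists>a\<in>power_exps E k. \<exists>b\<in>?U. \<forall>i. a i + b i \<le> c i"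
      by (intro bexI[of _ b] bexI[of _ e] CollectI) auto
  qed
  finally show ?case .
qed

text \<open>Multiplication by a monomial shifts the exponents injectively, so no two terms can merge
  or cancel.\<close>

lemma lookup_mult_single:
  fixes p :: "('n::finite, 'k::field) mpoly"
  shows "lookup (p * single m 1) (l + m) = lookup p l"
proof -
  have "p * single m 1 = (\<Sum>x\<in>keys p. single (x + m) (lookup p x))"
    by (subst mpoly_sum_singles[of p]) (simp add: sum_distrib_right mult_single)
  then have "lookup (p * single m 1) (l + m) =
    (\<Sum>x\<in>keys p. if x = l then lookup p l else 0)"
    by (simp add: lookup_sum lookup_single when_def cong: if_cong)
  then show ?thesis by (simp add: in_keys_iff)
qed

text \<open>Testing against single monomials of \<open>V\<close> suffices, because a shift keeps
  every exponent of \<open>p\<close> visible in the product.\<close>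

lemma ideal_colon_exps_ideal:
  "ideal_colon mpoly_ring (exps_ideal U) (exps_ideal V) =
    (exps_ideal {a. \<forall>b\<in>V. (\<lambda>i. a i + b i) \<in> U} :: ('n::finite, 'k::field) mpoly set)" (is "?L = exps_ideal ?W")
proof
  show "?L \<subseteq> exps_ideal ?W"
  proof
    fix p assume p: "p \<in> ?L"
    have "(\<lambda>i. lookup m i + b i) \<in> U" if m: "m \<in> keys p" and b: "b \<in> V" for m b
    proof -
      have "single (exp_monom b) (1::'k) \<in> exps_ideal V"
        using b by (intro single_in_exps_ideal) simp
      then have "p * single (exp_monom b) 1 \<in> exps_ideal U"
        using p by (simp add: ideal_colon_def)
      moreover have "m + exp_monom b \<in> keys (p * single (exp_monom b) 1)"
        using m by (simp add: in_keys_iff lookup_mult_single)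
      ultimately have "lookup (m + exp_monom b) \<in> U" by (auto simp: exps_ideal_def)
      moreover have "lookup (m + exp_monom b) = (\<lambda>i. lookup m i + b i)"
        by (simp add: fun_eq_iff lookup_add)
      ultimately show ?thesis by simp
    qed
    then show "p \<in> exps_ideal ?W" by (simp add: exps_ideal_def)
  qed
  show "exps_ideal ?W \<subseteq> ?L"
  proof
    fix p :: "('n, 'k) mpoly" assume p: "p \<in> exps_ideal ?W"
    have "p * q \<in> exps_ideal U" if "q \<in> exps_ideal V" for q :: "('n, 'k) mpoly"
      using p that by (rule mult_in_exps_ideal) auto
    then show "p \<in> ?L" by (simp add: ideal_colon_def)
  qed
qed

text \<open>Testing against \<open>m\<close> copies of a single generator \<open>f\<close> shows
  that the condition is necessary. Conversely one power \<open>M\<close> serves all exponents: among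
  \<open>M\<close> chosen generators some \<open>f\<close> occurs at least \<open>B * k\<close>
  times.\<close>

lemma ideal_saturation_exps_ideal:
  fixes E J :: "('n::finite \<Rightarrow> nat) set"
  assumes E: "finite E" and J: "finite J"
  shows "ideal_saturation mpoly_ring (exps_ideal (power_exps E k)) (exps_ideal {a. \<exists>f\<in>J. \<forall>i. f i \<le> a i}) =
    (exps_ideal {a. \<forall>f\<in>J. a \<in> power_exps (zero_on {i. f i \<noteq> 0} ` E) k} :: ('n, 'k::field) mpoly set)"
    (is "?L = exps_ideal ?W")
proof -
  have L: "?L = (\<Union>m\<in>{1..}. exps_ideal {a. \<forall>b\<in>power_exps J m. (\<lambda>i. a i + b i) \<in> power_exps E k})"
    by (simp add: ideal_saturation_def ideal_power_exps_ideal[OF J] ideal_colon_exps_ideal)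
  obtain B where B: "\<And>e i. e \<in> E \<Longrightarrow> e i \<le> B" using generator_bound[OF E] by blast
  have sub: "a \<in> ?W" if m: "\<forall>b\<in>power_exps J m. (\<lambda>i. a i + b i) \<in> power_exps E k" for a m
  proof (rule CollectI, rule ballI)
    fix f assume f: "f \<in> J"
    have "(\<Sum>x\<in>J. if x = f then m else 0) = m" using J f by simp
    moreover have "(\<Sum>x\<in>J. (if x = f then m else 0) * x i) = m * f i" for i
      using J f by (subst sum.remove[of _ f]) (auto intro: sum.neutral)
    ultimately have "(\<lambda>i. m * f i) \<in> power_exps J m"
      unfolding power_exps_def by (intro CollectI exI[of _ "\<lambda>x. if x = f then m else 0"]) simp
    then show "a \<in> power_exps (zero_on {i. f i \<noteq> 0} ` E) k"
      using m by (intro power_exps_add_multiple[OF E]) auto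
  qed
  \<comment> \<open>With this total the multiplicities cannot all be at most \<open>B * k\<close>.
    The summand 1 also keeps \<open>M\<close> in the range of the union, which starts at 1.\<close>
  define M where "M = card J * (B * k) + 1"
  have sup: "(\<lambda>i. a i + b i) \<in> power_exps E k" if a: "a \<in> ?W" and b: "b \<in> power_exps J M" for a b
  proof -
    obtain c where c: "(\<Sum>f\<in>J. c f) = M" "\<And>i. (\<Sum>f\<in>J. c f * f i) \<le> b i"
      using b by (auto simp: power_exps_def)
    obtain f where f: "f \<in> J" "B * k \<le> c f"
    proof (rule ccontr)
      assume "\<not> thesis"
      then have "\<forall>f\<in>J. c f \<le> B * k" using that by (meson nle_le)
      then have "(\<Sum>f\<in>J. c f) \<le> card J * (B * k)" using sum_bounded_above[of J c "B * k"] by simp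
      then show False using c(1) by (simp add: M_def)
    qed
    have "a \<in> power_exps (zero_on {i. f i \<noteq> 0} ` E) k" using a f(1) by blast
    then have "(\<lambda>i. a i + c f * f i) \<in> power_exps E k"
      using power_exps_add_multiple_large[of E B a f k "c f"] E B f(2) by blast
    moreover have "c f * f i \<le> b i" for i
    proof -
      have "c f * f i \<le> (\<Sum>f\<in>J. c f * f i)" using J f(1) by (intro member_le_sum) auto
      then show ?thesis using c(2)[of i] by linarith
    qed
    ultimately show ?thesis by (auto intro: power_exps_mono)
  qed
  show ?thesis
  proof
    show "?L \<subseteq> exps_ideal ?W" unfolding L using sub by (intro UN_least exps_ideal_mono subsetI) blast
    have "exps_ideal ?W \<subseteq> (exps_ideal {a. \<forall>b\<in>power_exps J M. (\<lambda>i. a i + b i) \<in> power_exps E k} :: ('n, 'k) mpoly set)"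
      using sup by (intro exps_ideal_mono subsetI) blast
    then show "exps_ideal ?W \<subseteq> ?L" unfolding L by (auto simp: M_def intro!: bexI[of _ M])
  qed
qed

lemma irrelevant_ideal_generators:
  "irrelevant_ideal = (exps_ideal {a. \<exists>f\<in>range (\<lambda>j i. if i = j then 1 else 0). \<forall>i. f i \<le> a i}
    :: ('n::finite, 'k::field) mpoly set)"
proof -
  have "range mvar = (monomial ` range (\<lambda>j::'n. single j 1) :: ('n, 'k) mpoly set)"
    by (auto simp: mvar_def monomial_def)
  moreover have "lookup (single j (1::nat)) = (\<lambda>i. if i = j then 1 else 0)" for j :: 'n
    by (auto simp: fun_eq_iff lookup_single when_def)
  ultimately show ?thesis unfolding irrelevant_ideal_def by (simp add: genideal_monomials)
qed

section \<open>Hilbert functions of quotients\<close>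

definition residue_class :: "'a::comm_ring_1 set \<Rightarrow> 'a \<Rightarrow> 'a set" where
  "residue_class B p = (\<lambda>b. b + p) ` B"

lemma residue_class_eq_iff:
  assumes "ideal B class_ring"
  shows "residue_class B p = residue_class B q \<longleftrightarrow> p - q \<in> B"
proof
  note D = class_ring_idealD[OF assms]
  assume "residue_class B p = residue_class B q"
  moreover have "p \<in> residue_class B p" using D(1) by (force simp: residue_class_def)
  ultimately obtain b where "b \<in> B" "p = b + q" by (auto simp: residue_class_def)
  then show "p - q \<in> B" by simp
next
  note D = class_ring_idealD[OF assms]
  assume pq: "p - q \<in> B"
  have "residue_class B p \<subseteq> residue_class B q" if "p - q \<in> B" for p q
  proof
    fix x assume "x \<in> residue_class B p"
    then obtain b where b: "b \<in> B" "x = b + p" by (auto simp: residue_class_def)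
    then have "x = (b + (p - q)) + q" "b + (p - q) \<in> B" using that D(2) by auto
    then show "x \<in> residue_class B q" unfolding residue_class_def by (metis imageI)
  qed
  moreover have "q - p \<in> B" using D(4)[OF pq] by simp
  ultimately show "residue_class B p = residue_class B q" using pq by blast
qed

lemma residue_class_zero: "residue_class B 0 = B"
  by (simp add: residue_class_def)

lemma coset_residue_class: "B +>\<^bsub>class_ring\<^esub> p = residue_class B p"
  by (auto simp: a_r_coset_def r_coset_def residue_class_def)

lemma graded_quot_simps:
  "carrier (graded_quot A B) = residue_class B ` A"
  "\<zero>\<^bsub>graded_quot A B\<^esub> = B"
  "component (graded_quot A B) j = residue_class B ` (A \<inter> homogeneous_part j)"
  unfolding graded_quot_def quot_module_def ideal_module_def module.extend_def graded_module.fields_def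
  by (auto simp: A_RCOSETS_def RCOSETS_def a_r_coset_def r_coset_def residue_class_def)

lemma graded_quot_add:
  assumes "ideal B mpoly_ring"
  shows "residue_class B p \<oplus>\<^bsub>graded_quot A B\<^esub> residue_class B q = residue_class B (p + q)"
proof -
  note D = class_ring_idealD[OF assms]
  have "residue_class B p \<oplus>\<^bsub>graded_quot A B\<^esub> residue_class B q = {x + y | x y. x \<in> residue_class B p \<and> y \<in> residue_class B q}"
    unfolding graded_quot_def quot_module_def ideal_module_def module.extend_def graded_module.fields_def
    by (auto simp: set_add_def set_mult_def)
  also have "\<dots> = residue_class B (p + q)"
  proof
    show "{x + y | x y. x \<in> residue_class B p \<and> y \<in> residue_class B q} \<subseteq> residue_class B (p + q)"
    proof
      fix z assume "z \<in> {x + y | x y. x \<in> residue_class B p \<and> y \<in> residue_class B q}"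
      then obtain b c where "b \<in> B" "c \<in> B" "z = (b + p) + (c + q)" by (auto simp: residue_class_def)
      then have "z = (b + c) + (p + q)" "b + c \<in> B" using D(2) by (auto simp: algebra_simps)
      then show "z \<in> residue_class B (p + q)" by (auto simp: residue_class_def)
    qed
    show "residue_class B (p + q) \<subseteq> {x + y | x y. x \<in> residue_class B p \<and> y \<in> residue_class B q}"
    proof
      fix z assume "z \<in> residue_class B (p + q)"
      then obtain b where "b \<in> B" "z = b + (p + q)" by (auto simp: residue_class_def)
      then have "z = (b + p) + (0 + q)" "b + p \<in> residue_class B p" "0 + q \<in> residue_class B q"
        using D(1) unfolding residue_class_def by (auto simp: algebra_simps simp del: add_0_left)
      then show "z \<in> {x + y | x y. x \<in> residue_class B p \<and> y \<in> residue_class B q}" by blast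
    qed
  qed
  finally show ?thesis .
qed

lemma graded_quot_smult:
  assumes "ideal B mpoly_ring"
  shows "r \<odot>\<^bsub>graded_quot A B\<^esub> residue_class B p = residue_class B (r * p)"
proof -
  note D = class_ring_idealD[OF assms]
  have "r \<odot>\<^bsub>graded_quot A B\<^esub> residue_class B p = (\<Union>x\<in>residue_class B p. residue_class B (r * x))"
    unfolding graded_quot_def quot_module_def ideal_module_def module.extend_def graded_module.fields_def
    by (auto simp: a_r_coset_def r_coset_def residue_class_def)
  also have "\<dots> = (\<Union>x\<in>residue_class B p. residue_class B (r * p))"
  proof (rule SUP_cong[OF refl])
    fix x assume "x \<in> residue_class B p"
    then obtain b where "b \<in> B" "x = b + p" by (auto simp: residue_class_def)
    then have "r * x - r * p \<in> B" using D(3)[of b r] by (simp add: algebra_simps)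
    then show "residue_class B (r * x) = residue_class B (r * p)" by (simp add: residue_class_eq_iff[OF assms])
  qed
  also have "\<dots> = residue_class B (r * p)" using D(1) by (auto simp: residue_class_def)
  finally show ?thesis .
qed

lemma mconst_add: "mconst (a + b) = mconst a + mconst b"
  by (simp add: mconst_def single_add)

lemma mconst_mult: "mconst (a * b) = mconst a * mconst b"
  by (simp add: mconst_def mult_single)

lemma mconst_0 [simp]: "mconst 0 = 0"
  by (simp add: mconst_def)

lemma mconst_1 [simp]: "mconst 1 = 1"
  by (simp add: mconst_def single_one)

lemma mconst_mult_monomial: "mconst c * monomial m = single m c"
  by (simp add: mconst_def monomial_def mult_single)

lemma exps_ideal_Int: "exps_ideal U \<inter> exps_ideal V = exps_ideal (U \<inter> V)"
  by (auto simp: exps_ideal_def)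

lemma homogeneous_part_eq: "homogeneous_part j = exps_ideal {a. sum a UNIV = j}"
  by (auto simp: homogeneous_part_def exps_ideal_def)

lemma mconst_mult_in_exps_ideal:
  assumes "p \<in> exps_ideal U"
  shows "mconst c * p \<in> exps_ideal U"
  by (rule mult_in_exps_ideal[of "mconst c" "{\<lambda>_. 0}" p U])
     (use assms in \<open>auto simp: mconst_def exps_ideal_def\<close>)

lemma uminus_in_exps_ideal: "p \<in> exps_ideal U \<Longrightarrow> - p \<in> exps_ideal U"
  by (auto simp: exps_ideal_iff_lookup)

section \<open>Monomial bases of graded components\<close>

lemma component_space_exps:
  fixes G U :: "('n::finite \<Rightarrow> nat) set" and j :: nat
  assumes "up_closed U"
  defines "V \<equiv> component_space (graded_quot (exps_ideal G) (exps_ideal U) :: (('n, 'k::field) mpoly, _) graded_module) j"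
  shows "carrier V = residue_class (exps_ideal U) ` exps_ideal (G \<inter> {a. sum a UNIV = j})"
    "\<zero>\<^bsub>V\<^esub> = residue_class (exps_ideal U) 0"
    "residue_class (exps_ideal U) p \<oplus>\<^bsub>V\<^esub> residue_class (exps_ideal U) q = residue_class (exps_ideal U) (p + q)"
    "c \<odot>\<^bsub>V\<^esub> residue_class (exps_ideal U) p = residue_class (exps_ideal U) (mconst c * p)"
  unfolding V_def
  by (simp_all add: component_space_def graded_quot_simps homogeneous_part_eq exps_ideal_Int residue_class_zero
      graded_quot_add[OF ideal_exps_ideal[OF assms(1)]] graded_quot_smult[OF ideal_exps_ideal[OF assms(1)]])

lemma vectorspace_component:
  fixes G :: "('n::finite \<Rightarrow> nat) set"
  assumes U: "up_closed U"
  shows "vectorspace class_ring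
    (component_space (graded_quot (exps_ideal G) (exps_ideal U) :: (('n, 'k::field) mpoly, _) graded_module) j)"
    (is "vectorspace class_ring ?V")
proof -
  let ?B = "exps_ideal U :: ('n, 'k) mpoly set"
  define H where "H = (exps_ideal (G \<inter> {a. sum a UNIV = j}) :: ('n, 'k) mpoly set)"
  let ?c = "residue_class ?B"
  have B: "ideal ?B mpoly_ring" by (rule ideal_exps_ideal[OF U])
  note carr = component_space_exps(1)[OF U, where 'k = 'k and G = G and j = j, folded H_def]
    and zero = component_space_exps(2)[OF U, where 'k = 'k and G = G and j = j]
    and add = component_space_exps(3)[OF U, where 'k = 'k and G = G and j = j]
    and smult = component_space_exps(4)[OF U, where 'k = 'k and G = G and j = j]
  have H: "0 \<in> H" "\<And>p q. p \<in> H \<Longrightarrow> q \<in> H \<Longrightarrow> p + q \<in> H" "\<And>p c. p \<in> H \<Longrightarrow> mconst c * p \<in> H"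
    "\<And>p. p \<in> H \<Longrightarrow> - p \<in> H"
    unfolding H_def by (auto intro: add_in_exps_ideal mconst_mult_in_exps_ideal uminus_in_exps_ideal)
  have "abelian_group ?V"
  proof (rule abelian_groupI)
    fix x assume "x \<in> carrier ?V"
    then obtain p where "x = ?c p" "p \<in> H" by (auto simp: carr)
    then have "?c (- p) \<in> carrier ?V" "?c (- p) \<oplus>\<^bsub>?V\<^esub> x = \<zero>\<^bsub>?V\<^esub>" by (auto simp: carr add zero H)
    then show "\<exists>y\<in>carrier ?V. y \<oplus>\<^bsub>?V\<^esub> x = \<zero>\<^bsub>?V\<^esub>" by blast
  qed (auto simp: carr add zero H algebra_simps)
  then have "module class_ring ?V"
    by (intro Module.module.intro module_axioms.intro class_cring.cring_axioms)
       (auto simp: carr add smult zero H distrib_left distrib_right mult.assoc mconst_add mconst_mult)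
  then show ?thesis
    by (intro vectorspace.intro class_field.field_axioms)
qed

lemma finite_degree_eq: "finite {a::'n::finite \<Rightarrow> nat. sum a UNIV \<le> N}"
  using card_bounded_sum[of "UNIV :: 'n set" N] by simp

lemma lookup_sum_monomials:
  assumes "finite X"
  shows "lookup (\<Sum>x\<in>X. mconst (c x) * monomial (exp_monom x)) (exp_monom a) = (if a \<in> X then c a else 0)"
proof -
  have "lookup (\<Sum>x\<in>X. mconst (c x) * monomial (exp_monom x)) (exp_monom a) =
    (\<Sum>x\<in>X. if x = a then c a else 0)"
    unfolding lookup_sum mconst_mult_monomial
    by (intro sum.cong refl) (auto simp: lookup_single when_def dest: injD[OF inj_exp_monom])
  then show ?thesis using assms by simp
qed

text \<open>Coefficients at exponents outside \<open>U\<close> are well defined on residue classes,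
  which makes the monomials in \<open>G - U\<close> independent; they also determine the class,
  which makes these monomials span.\<close>

lemma dim_component:
  fixes G U :: "('n::finite \<Rightarrow> nat) set"
  assumes U: "up_closed U"
  shows "vectorspace.dim class_ring
    (component_space (graded_quot (exps_ideal G) (exps_ideal U) :: (('n, 'k::field) mpoly, _) graded_module) j) =
    card {a \<in> G - U. sum a UNIV = j}"
    (is "vectorspace.dim class_ring ?V = card ?X")
proof -
  let ?B = "exps_ideal U :: ('n, 'k) mpoly set"
  define H where "H = (exps_ideal (G \<inter> {a. sum a UNIV = j}) :: ('n, 'k) mpoly set)"
  let ?c = "residue_class ?B"
  let ?m = "\<lambda>a. monomial (exp_monom a) :: ('n, 'k) mpoly"
  let ?b = "\<lambda>a. ?c (?m a)"
  have B: "ideal ?B mpoly_ring" by (rule ideal_exps_ideal[OF U])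
  note carr = component_space_exps(1)[OF U, where 'k = 'k and G = G and j = j, folded H_def]
    and zero = component_space_exps(2)[OF U, where 'k = 'k and G = G and j = j]
    and add = component_space_exps(3)[OF U, where 'k = 'k and G = G and j = j]
    and smult = component_space_exps(4)[OF U, where 'k = 'k and G = G and j = j]
  interpret V: vectorspace "class_ring :: 'k ring" ?V by (rule vectorspace_component[OF U])
  have finX: "finite ?X" by (rule finite_subset[OF _ finite_degree_eq[of j]]) auto
  have mH: "?m x \<in> H" if "x \<in> ?X" for x
    using that by (auto simp: H_def monomial_def intro: single_in_exps_ideal)
  have lc: "finsum ?V (\<lambda>x. u x \<odot>\<^bsub>?V\<^esub> ?b x) Y = ?c (\<Sum>x\<in>Y. mconst (u x) * ?m x)"
    if "Y \<subseteq> ?X" "finite Y" for Y u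
    using that(2,1)
  proof (induction Y rule: finite_induct)
    case empty
    show ?case by (simp add: zero)
  next
    case (insert y Y)
    have "u x \<odot>\<^bsub>?V\<^esub> ?b x \<in> carrier ?V" if "x \<in> ?X" for x
      unfolding smult carr using mH[OF that] unfolding H_def by (intro imageI mconst_mult_in_exps_ideal)
    then have "finsum ?V (\<lambda>x. u x \<odot>\<^bsub>?V\<^esub> ?b x) (insert y Y) =
      u y \<odot>\<^bsub>?V\<^esub> ?b y \<oplus>\<^bsub>?V\<^esub> finsum ?V (\<lambda>x. u x \<odot>\<^bsub>?V\<^esub> ?b x) Y"
      using insert by (intro V.finsum_insert) auto
    then show ?case using insert by (simp add: smult add)
  qed
  have zero_iff: "?c (\<Sum>x\<in>Y. mconst (u x) * ?m x) = \<zero>\<^bsub>?V\<^esub> \<longleftrightarrow> (\<forall>x\<in>Y. u x = 0)"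
    if "Y \<subseteq> ?X" "finite Y" for Y u
  proof
    assume "?c (\<Sum>x\<in>Y. mconst (u x) * ?m x) = \<zero>\<^bsub>?V\<^esub>"
    then have *: "(\<Sum>x\<in>Y. mconst (u x) * ?m x) \<in> ?B" by (simp add: zero residue_class_eq_iff[OF B])
    show "\<forall>x\<in>Y. u x = 0"
    proof
      fix x assume x: "x \<in> Y"
      then have "x \<notin> U" using that by auto
      then have "lookup (\<Sum>x\<in>Y. mconst (u x) * ?m x) (exp_monom x) = 0"
        using * by (simp add: exps_ideal_iff_lookup)
      then show "u x = 0" using x that by (simp add: lookup_sum_monomials)
    qed
  qed (simp add: zero)
  have inj: "inj_on ?b ?X"
  proof (rule inj_onI, rule ccontr)
    fix x y assume xy: "x \<in> ?X" "y \<in> ?X" "?b x = ?b y" "x \<noteq> y"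
    then have "?m x - ?m y \<in> ?B" by (simp add: residue_class_eq_iff[OF B])
    then have "lookup (?m x - ?m y) (exp_monom x) = 0" using xy(1) by (simp add: exps_ideal_iff_lookup)
    moreover have "exp_monom y \<noteq> exp_monom x" using xy(4) injD[OF inj_exp_monom, of y x] by blast
    ultimately show False by (simp add: monomial_def lookup_minus lookup_single when_def)
  qed
  have bcarr: "?b ` ?X \<subseteq> carrier ?V" using mH by (auto simp: carr)
  have reindex: "V.lincomb u (?b ` Y) = ?c (\<Sum>x\<in>Y. mconst (u (?b x)) * ?m x)" if "Y \<subseteq> ?X" "finite Y" for Y u
  proof -
    have "V.lincomb u (?b ` Y) = finsum ?V (\<lambda>x. u (?b x) \<odot>\<^bsub>?V\<^esub> ?b x) Y"
      unfolding V.lincomb_def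
      using that inj_on_subset[OF inj that(1)] bcarr
      by (intro V.finsum_reindex) (auto intro!: V.smult_closed)
    also have "\<dots> = ?c (\<Sum>x\<in>Y. mconst (u (?b x)) * ?m x)"
      using lc[OF that, of "\<lambda>x. u (?b x)"] by simp
    finally show ?thesis .
  qed
  have "V.lin_indpt (?b ` ?X)"
  proof
    assume "V.lin_dep (?b ` ?X)"
    then obtain A u v where A: "finite A" "A \<subseteq> ?b ` ?X" "V.lincomb u A = \<zero>\<^bsub>?V\<^esub>" "v \<in> A" "u v \<noteq> 0"
      unfolding V.lin_dep_def by auto
    then obtain Y where Y: "Y \<subseteq> ?X" "A = ?b ` Y" by (auto simp: subset_image_iff)
    have finY: "finite Y" using Y(1) finX finite_subset by blast
    have "\<forall>x\<in>Y. u (?b x) = 0"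
      using zero_iff[OF Y(1) finY, of "\<lambda>x. u (?b x)"] reindex[OF Y(1) finY, of u] A(3) Y(2) by simp
    then show False using A(4,5) Y(2) by auto
  qed
  moreover have "V.gen_set (?b ` ?X)"
  proof
    show "V.span (?b ` ?X) \<subseteq> carrier ?V" by (rule V.span_is_subset2[OF bcarr])
    show "carrier ?V \<subseteq> V.span (?b ` ?X)"
    proof
      fix y assume "y \<in> carrier ?V"
      then obtain p where p: "y = ?c p" "p \<in> H" by (auto simp: carr)
      let ?q = "\<Sum>x\<in>?X. mconst (lookup p (exp_monom x)) * ?m x"
      have "p - ?q \<in> ?B"
        unfolding exps_ideal_iff_lookup
      proof (intro allI impI)
        fix a assume a: "a \<notin> U"
        have "lookup p (exp_monom a) = 0" if "a \<notin> ?X"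
          using p(2) a that unfolding H_def exps_ideal_iff_lookup by auto
        then show "lookup (p - ?q) (exp_monom a) = 0"
          using finX by (simp add: lookup_minus lookup_sum_monomials)
      qed
      then have y: "y = ?c ?q" using p(1) by (simp add: residue_class_eq_iff[OF B])
      define u where "u v = lookup p (exp_monom (the_inv_into ?X ?b v))" for v
      have "V.lincomb u (?b ` ?X) = ?c (\<Sum>x\<in>?X. mconst (u (?b x)) * ?m x)"
        using finX by (intro reindex) auto
      also have "(\<Sum>x\<in>?X. mconst (u (?b x)) * ?m x) = ?q"
      proof (rule sum.cong[OF refl])
        fix x assume "x \<in> ?X"
        then have "the_inv_into ?X ?b (?b x) = x" by (rule the_inv_into_f_f[OF inj])
        then show "mconst (u (?b x)) * ?m x = mconst (lookup p (exp_monom x)) * ?m x"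
          by (simp only: u_def)
      qed
      finally have "y = V.lincomb u (?b ` ?X)" using y by simp
      then show "y \<in> V.span (?b ` ?X)"
        using finX unfolding V.span_def by (intro CollectI exI[of _ u] exI[of _ "?b ` ?X"]) auto
    qed
  qed
  ultimately have "V.basis (?b ` ?X)" using bcarr by (simp add: V.basis_def)
  then have "V.dim = card (?b ` ?X)" using finX by (intro V.dim_basis) auto
  then show ?thesis using card_image[OF inj] by simp
qed

lemma hilbert_fun_exps:
  fixes G U :: "('n::finite \<Rightarrow> nat) set"
  assumes U: "up_closed U"
  shows "hilbert_fun (graded_quot (exps_ideal G) (exps_ideal U) :: (('n, 'k::field) mpoly, _) graded_module) N =
    card {a \<in> G - U. sum a UNIV \<le> N}"
proof -
  have "{a \<in> G - U. sum a UNIV \<le> N} = (\<Union>j\<in>{..N}. {a \<in> G - U. sum a UNIV = j})" by auto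
  also have "card \<dots> = (\<Sum>j\<le>N. card {a \<in> G - U. sum a UNIV = j})"
  proof (rule card_UN_disjoint)
    show "\<forall>j\<in>{..N}. finite {a \<in> G - U. sum a UNIV = j}"
      by (auto intro: finite_subset[OF _ finite_degree_eq[of N]])
  qed auto
  finally show ?thesis by (simp add: hilbert_fun_def dim_component[OF U])
qed

section \<open>Krull dimension\<close>

lemma vector_space_mpoly: "vector_space (\<lambda>c (p :: ('n, 'k::field) mpoly). mconst c * p)"
  by unfold_locales (auto simp: mconst_add mconst_mult distrib_left distrib_right mult.assoc)

text \<open>Independence is stated for an indexed family; two equal members would satisfy a relation
  with coefficients 1 and -1, so \<open>f\<close> is injective and the bound for sets applies.
  Chains of primes and chains of submodules are both measured with it.\<close>

lemma card_independent_le: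
  fixes f :: "'b \<Rightarrow> ('n::finite, 'k::field) mpoly"
  assumes "finite T" "finite X" "\<And>a. a \<in> T \<Longrightarrow> f a \<in> exps_ideal X"
    and ind: "\<And>u. (\<Sum>a\<in>T. mconst (u a) * f a) = 0 \<Longrightarrow> \<forall>a\<in>T. u a = 0"
  shows "card T \<le> card X"
proof -
  interpret vs: vector_space "\<lambda>c (p :: ('n, 'k) mpoly). mconst c * p" by (rule vector_space_mpoly)
  have inj: "inj_on f T"
  proof (rule inj_onI, rule ccontr)
    fix a b assume ab: "a \<in> T" "b \<in> T" "f a = f b" "a \<noteq> b"
    define u where "u x = (if x = a then 1 else if x = b then -1 else (0::'k))" for x
    have neg1: "mconst (- 1) = (- 1 :: ('n, 'k) mpoly)"
    proof -
      have "mconst (1 + - 1) = (mconst 1 + mconst (- 1) :: ('n, 'k) mpoly)" by (rule mconst_add)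
      then show ?thesis by (simp add: eq_neg_iff_add_eq_0 add.commute)
    qed
    have "(\<Sum>x\<in>T. mconst (u x) * f x) = (\<Sum>x\<in>{a, b}. mconst (u x) * f x)"
      using ab assms(1) by (intro sum.mono_neutral_right) (auto simp: u_def)
    also have "\<dots> = 0" using ab by (simp add: u_def neg1)
    finally have "u a = 0" using ind[of u] ab(1) by blast
    then show False by (simp add: u_def)
  qed
  let ?S = "(\<lambda>x. monomial (exp_monom x) :: ('n, 'k) mpoly) ` X"
  have "vs.independent (f ` T)"
  proof
    assume "vs.dependent (f ` T)"
    then obtain u where u: "\<exists>v\<in>f ` T. u v \<noteq> 0" "(\<Sum>v\<in>f ` T. mconst (u v) * v) = 0"
      using vs.dependent_finite[of "f ` T"] assms(1) by auto
    have "(\<Sum>a\<in>T. mconst (u (f a)) * f a) = 0" using u(2) inj by (simp add: sum.reindex)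
    then show False using ind[of "\<lambda>a. u (f a)"] u(1) by blast
  qed
  moreover have "f ` T \<subseteq> vs.span ?S"
  proof
    fix p assume "p \<in> f ` T"
    then have "p \<in> exps_ideal X" using assms(3) by blast
    then show "p \<in> vs.span ?S"
    proof (induction rule: exps_ideal_induct)
      case (single m c)
      have "(monomial m :: ('n, 'k) mpoly) \<in> ?S" using single by (intro image_eqI[of _ _ "lookup m"]) auto
      then have "mconst c * monomial m \<in> vs.span ?S" by (intro vs.span_scale vs.span_base)
      then show ?case by (simp add: mconst_mult_monomial)
    qed (auto intro: vs.span_zero vs.span_add)
  qed
  ultimately have "card (f ` T) \<le> card ?S"
    using vs.independent_span_bound[of ?S "f ` T"] assms(2) by auto
  also have "\<dots> \<le> card X" using assms(2) by (rule card_image_le)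
  finally show ?thesis using card_image[OF inj] by simp
qed

section \<open>Lengths of chains of prime ideals\<close>

lemma class_ring_primeidealD:
  fixes P :: "'a::comm_ring_1 set"
  assumes "primeideal P class_ring"
  shows "ideal P class_ring" "1 \<notin> P" "x * y \<in> P \<Longrightarrow> x \<in> P \<or> y \<in> P"
proof -
  interpret primeideal P "class_ring :: 'a ring" by fact
  show I: "ideal P class_ring" by (rule ideal_axioms)
  show "1 \<notin> P"
  proof
    assume "1 \<in> P"
    then have "x \<in> P" for x using class_ring_idealD(3)[OF I, of 1 x] by simp
    then show False using I_notcarr by auto
  qed
  show "x * y \<in> P \<Longrightarrow> x \<in> P \<or> y \<in> P" using I_prime[of x y] by simp
qed

lemma class_ring_primeidealI:
  fixes P :: "'a::comm_ring_1 set"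
  assumes "ideal P class_ring" "1 \<notin> P" "\<And>x y. x * y \<in> P \<Longrightarrow> x \<in> P \<or> y \<in> P"
  shows "primeideal P class_ring"
  by (rule primeidealI[OF assms(1) class_cring.cring_axioms]) (use assms in auto)

lemma power_notin_prime:
  fixes P :: "'a::comm_ring_1 set"
  assumes "primeideal P class_ring" "x \<notin> P"
  shows "x ^ n \<notin> P"
proof (induction n)
  case 0
  then show ?case using class_ring_primeidealD(2)[OF assms(1)] by simp
next
  case (Suc n)
  then show ?case using class_ring_primeidealD(3)[OF assms(1), of x "x ^ n"] assms(2) by auto
qed

lemma sum_in_ideal:
  fixes P :: "'a::comm_ring_1 set"
  assumes "ideal P class_ring" "\<And>a. a \<in> T \<Longrightarrow> g a \<in> P"
  shows "(\<Sum>a\<in>T. g a) \<in> P"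
  using assms(2) by (induction T rule: infinite_finite_induct) (auto intro: class_ring_idealD(1,2)[OF assms(1)])

text \<open>Elements chosen from the successive steps of a chain of prime ideals are algebraically
  independent: the lowest power of \<open>f s\<close> occurring in a relation can be cancelled modulo \<open>P s\<close>,
  and what remains is a relation between the later elements modulo \<open>P (Suc s)\<close>.\<close>

lemma prime_chain_independent:
  fixes P :: "nat \<Rightarrow> ('n::finite, 'k::field) mpoly set" and T :: "(nat \<Rightarrow> nat) set"
  assumes P: "\<And>i. i \<le> r \<Longrightarrow> primeideal (P i) mpoly_ring" "\<And>i. i < r \<Longrightarrow> P i \<subset> P (Suc i)"
    and f: "\<And>i. i < r \<Longrightarrow> f i \<in> P (Suc i) - P i"
  shows "s \<le> r \<Longrightarrow> finite T \<Longrightarrow> (\<And>a b. a \<in> T \<Longrightarrow> b \<in> T \<Longrightarrow> (\<forall>i\<in>{s..<r}. a i = b i) \<Longrightarrow> a = b) \<Longrightarrow>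
    (\<Sum>a\<in>T. mconst (u a) * (\<Prod>i\<in>{s..<r}. f i ^ a i)) \<in> P s \<Longrightarrow> \<forall>a\<in>T. u a = 0"
proof (induction s arbitrary: T rule: inc_induct)
  case base
  show ?case
  proof
    fix a assume a: "a \<in> T"
    \<comment> \<open>No exponents remain to be compared, so \<open>T\<close> is a singleton and the
      relation is a constant lying in a prime ideal.\<close>
    then have "T = {a}" using base(2) by auto
    then have m: "mconst (u a) \<in> P r" using base(3) by simp
    note D = class_ring_primeidealD[OF P(1)[of r]]
    show "u a = 0"
    proof (rule ccontr)
      assume "u a \<noteq> 0"
      then have "mconst (1 / u a) * mconst (u a) = (1 :: ('n, 'k) mpoly)"
        by (simp flip: mconst_mult)
      then show False using class_ring_idealD(3)[OF D(1) m, of "mconst (1 / u a)"] D(2) by simp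
    qed
  qed
next
  case (step s)
  note Ds = class_ring_primeidealD[OF P(1)[of s]]
  note DS = class_ring_idealD[OF class_ring_primeidealD(1)[OF P(1)[of "Suc s"]]]
  have sr: "s \<le> r" "Suc s \<le> r" using step.hyps by auto
  define S where "S = {a\<in>T. u a \<noteq> 0}"
  define Q where "Q a = (\<Prod>i\<in>{Suc s..<r}. f i ^ a i)" for a
  show ?case
  proof (rule ccontr)
    assume "\<not> (\<forall>a\<in>T. u a = 0)"
    then have ne: "S \<noteq> {}" by (auto simp: S_def)
    have finS: "finite S" using step.prems(1) by (simp add: S_def)
    define j where "j = Min ((\<lambda>a. a s) ` S)"
    have jle: "j \<le> a s" if "a \<in> S" for a using that finS by (simp add: j_def)
    have "j \<in> (\<lambda>a. a s) ` S" unfolding j_def using ne finS by (intro Min_in) auto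
    then obtain a0 where a0: "a0 \<in> S" "a0 s = j" by auto
    define R where "R = (\<Sum>a\<in>S. mconst (u a) * (f s ^ (a s - j) * Q a))"
    have "(\<Sum>a\<in>T. mconst (u a) * (\<Prod>i\<in>{s..<r}. f i ^ a i)) = (\<Sum>a\<in>S. mconst (u a) * (\<Prod>i\<in>{s..<r}. f i ^ a i))"
      using step.prems(1) by (intro sum.mono_neutral_right) (auto simp: S_def)
    also have "\<dots> = (\<Sum>a\<in>S. f s ^ j * (mconst (u a) * (f s ^ (a s - j) * Q a)))"
    proof (rule sum.cong[OF refl])
      fix a assume a: "a \<in> S"
      have "(\<Prod>i\<in>{s..<r}. f i ^ a i) = f s ^ a s * Q a"
        unfolding Q_def using step.hyps by (intro prod.atLeast_Suc_lessThan) auto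
      also have "f s ^ a s = f s ^ j * f s ^ (a s - j)" using jle[OF a] by (simp flip: power_add)
      finally show "mconst (u a) * (\<Prod>i\<in>{s..<r}. f i ^ a i) = f s ^ j * (mconst (u a) * (f s ^ (a s - j) * Q a))"
        by (simp add: mult_ac)
    qed
    also have "\<dots> = f s ^ j * R" by (simp add: R_def sum_distrib_left)
    finally have "f s ^ j * R \<in> P s" using step.prems(3) by simp
    moreover have "f s ^ j \<notin> P s" using power_notin_prime[OF P(1)[OF sr(1)]] f[of s] step.hyps by blast
    ultimately have "R \<in> P s" using Ds(3)[OF sr(1)] by blast
    then have RP: "R \<in> P (Suc s)" using P(2)[of s] step.hyps by blast
    \<comment> \<open>Terms with a larger exponent at \<open>s\<close> still contain the factor
      \<open>f s\<close>, which lies in \<open>P (Suc s)\<close>; only those with exponent exactly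
      \<open>j\<close> remain in the relation.\<close>
    define T' where "T' = {a\<in>S. a s = j}"
    have "R = (\<Sum>a\<in>S - T'. mconst (u a) * (f s ^ (a s - j) * Q a)) + (\<Sum>a\<in>T'. mconst (u a) * (f s ^ (a s - j) * Q a))"
      unfolding R_def using finS by (intro sum.subset_diff) (auto simp: T'_def)
    then have Req: "(\<Sum>a\<in>T'. mconst (u a) * (f s ^ (a s - j) * Q a)) = R - (\<Sum>a\<in>S - T'. mconst (u a) * (f s ^ (a s - j) * Q a))"
      by simp
    have "(\<Sum>a\<in>S - T'. mconst (u a) * (f s ^ (a s - j) * Q a)) \<in> P (Suc s)"
    proof (rule sum_in_ideal[OF class_ring_primeidealD(1)[OF P(1)[OF sr(2)]]])
      fix a assume a: "a \<in> S - T'"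
      then have "a s - j = Suc (a s - j - 1)" using jle[of a] by (auto simp: T'_def)
      then have "f s ^ (a s - j) = f s ^ (a s - j - 1) * f s" by (metis power_Suc2)
      then have "mconst (u a) * (f s ^ (a s - j) * Q a) = (mconst (u a) * f s ^ (a s - j - 1) * Q a) * f s"
        by (simp add: mult_ac)
      moreover have "f s \<in> P (Suc s)" using f[of s] step.hyps by simp
      ultimately show "mconst (u a) * (f s ^ (a s - j) * Q a) \<in> P (Suc s)" using DS(3)[OF sr(2)] by simp
    qed
    then have "(\<Sum>a\<in>T'. mconst (u a) * (f s ^ (a s - j) * Q a)) \<in> P (Suc s)"
      unfolding Req by (rule DS(5)[OF sr(2) RP])
    moreover have "(\<Sum>a\<in>T'. mconst (u a) * (f s ^ (a s - j) * Q a)) = (\<Sum>a\<in>T'. mconst (u a) * Q a)"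
      by (intro sum.cong refl) (simp add: T'_def)
    ultimately have "(\<Sum>a\<in>T'. mconst (u a) * (\<Prod>i\<in>{Suc s..<r}. f i ^ a i)) \<in> P (Suc s)" by (simp add: Q_def)
    moreover have "a = b" if ab: "a \<in> T'" "b \<in> T'" "\<forall>i\<in>{Suc s..<r}. a i = b i" for a b
    proof (rule step.prems(2))
      show "a \<in> T" "b \<in> T" using ab by (auto simp: T'_def S_def)
      have "a s = b s" using ab by (simp add: T'_def)
      then show "\<forall>i\<in>{s..<r}. a i = b i" using ab(3) by (auto simp: Suc_le_eq le_less)
    qed
    moreover have "finite T'" using finS by (simp add: T'_def)
    ultimately have "\<forall>a\<in>T'. u a = 0" by (intro step.IH) auto
    then show False using a0 by (auto simp: T'_def S_def)
  qed
qed

text \<open>Bounding the degree in each variable separately makes the number of monomials an exact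
  power, and the bounds still add under multiplication.\<close>

definition cube_exps :: "nat \<Rightarrow> ('n \<Rightarrow> nat) set" where
  "cube_exps e = {b. \<forall>i. b i \<le> e}"

lemma card_cube_exps: "finite (cube_exps e :: ('n::finite \<Rightarrow> nat) set)"
    "card (cube_exps e :: ('n::finite \<Rightarrow> nat) set) = (e + 1) ^ CARD('n)"
proof -
  have "cube_exps e = (PiE UNIV (\<lambda>_. {..e}) :: ('n \<Rightarrow> nat) set)" by (auto simp: cube_exps_def)
  then show "finite (cube_exps e :: ('n::finite \<Rightarrow> nat) set)"
    "card (cube_exps e :: ('n::finite \<Rightarrow> nat) set) = (e + 1) ^ CARD('n)"
    by (simp_all add: card_PiE finite_PiE)
qed

lemma mult_in_cube:
  "p \<in> exps_ideal (cube_exps d) \<Longrightarrow> q \<in> exps_ideal (cube_exps e) \<Longrightarrow> p * q \<in> exps_ideal (cube_exps (d + e))"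
  by (rule mult_in_exps_ideal[of p "cube_exps d" q "cube_exps e"]) (auto simp: cube_exps_def add_mono)

lemma one_in_cube: "1 \<in> exps_ideal (cube_exps e)"
  by (auto simp: exps_ideal_def cube_exps_def)

lemma power_in_cube: "p \<in> exps_ideal (cube_exps e) \<Longrightarrow> p ^ m \<in> exps_ideal (cube_exps (m * e))"
  by (induction m) (auto intro: mult_in_cube one_in_cube)

lemma prod_in_cube:
  "finite I \<Longrightarrow> (\<And>i. i \<in> I \<Longrightarrow> g i \<in> exps_ideal (cube_exps e)) \<Longrightarrow> (\<Prod>i\<in>I. g i) \<in> exps_ideal (cube_exps (card I * e))"
  by (induction I rule: finite_induct) (auto intro: mult_in_cube one_in_cube)

lemma cube_mono: "d \<le> e \<Longrightarrow> exps_ideal (cube_exps d) \<subseteq> exps_ideal (cube_exps e)"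
  by (intro exps_ideal_mono) (auto simp: cube_exps_def intro: order_trans)

lemma in_some_cube:
  fixes p :: "('n::finite, 'k::field) mpoly"
  shows "\<exists>e. p \<in> exps_ideal (cube_exps e)"
proof -
  let ?M = "\<Union>m\<in>keys p. range (lookup m)"
  have "finite ?M" by auto
  then have "lookup m i \<le> Max ?M" if "m \<in> keys p" for m i
    using that by (intro Max_ge) auto
  then show ?thesis by (intro exI[of _ "Max ?M"]) (simp add: exps_ideal_def cube_exps_def)
qed

lemma power_growth_bound:
  fixes r n c :: nat
  assumes "\<And>N. (N + 1) ^ r \<le> (c * N + 1) ^ n"
  shows "r \<le> n"
proof (rule ccontr)
  assume "\<not> r \<le> n"
  \<comment> \<open>Chosen so that the constant factor \<open>(c + 1) ^ n\<close> is
    \<open>N\<close> itself and hence smaller than one further factor \<open>N + 1\<close>.\<close>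
  define N where "N = (c + 1) ^ n"
  have "(N + 1) ^ (n + 1) \<le> (N + 1) ^ r" using \<open>\<not> r \<le> n\<close> by (intro power_increasing) auto
  also have "\<dots> \<le> (c * N + 1) ^ n" by (rule assms)
  also have "\<dots> \<le> ((c + 1) * (N + 1)) ^ n" by (intro power_mono) auto
  also have "\<dots> = N * (N + 1) ^ n" by (simp only: power_mult_distrib N_def)
  finally show False by simp
qed

text \<open>The \<open>(N + 1) ^ r\<close> power products of elements chosen along the chain are
  independent and lie in a cube of side proportional to \<open>N\<close>. Comparing growth in
  \<open>N\<close> bounds \<open>r\<close> by the number of variables.\<close>

lemma prime_chain_length:
  fixes P :: "nat \<Rightarrow> ('n::finite, 'k::field) mpoly set"
  assumes P: "\<And>i. i \<le> r \<Longrightarrow> primeideal (P i) mpoly_ring" "\<And>i. i < r \<Longrightarrow> P i \<subset> P (Suc i)"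
  shows "r \<le> CARD('n)"
proof -
  have "\<forall>i. \<exists>x. i < r \<longrightarrow> x \<in> P (Suc i) - P i" using P(2) by blast
  then obtain f where f: "\<And>i. i < r \<Longrightarrow> f i \<in> P (Suc i) - P i" by metis
  obtain e0 where e0: "\<And>i. f i \<in> exps_ideal (cube_exps (e0 i))" 
    using choice[of "\<lambda>i e. f i \<in> exps_ideal (cube_exps e)"] in_some_cube by blast
  define e where "e = (\<Sum>i<r. e0 i)"
  have e: "f i \<in> exps_ideal (cube_exps e)" if "i < r" for i
  proof -
    have "e0 i \<le> e" unfolding e_def using that by (intro member_le_sum) auto
    then show ?thesis using e0[of i] cube_mono by blast
  qed
  have "(N + 1) ^ r \<le> (r * e * N + 1) ^ CARD('n)" for N
  proof -
    let ?T = "PiE {0..<r} (\<lambda>_. {..N})"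
    have "card ?T \<le> card (cube_exps (r * e * N) :: ('n \<Rightarrow> nat) set)"
    proof (rule card_independent_le[where f = "\<lambda>a. \<Prod>i\<in>{0..<r}. f i ^ a i"])
      fix a assume a: "a \<in> ?T"
      have "f i ^ a i \<in> exps_ideal (cube_exps (N * e))" if i: "i \<in> {0..<r}" for i
      proof -
        have "a i * e \<le> N * e" using a i by (auto simp: PiE_def Pi_def)
        then show ?thesis using power_in_cube[OF e, of i "a i"] i cube_mono[of "a i * e" "N * e"] by auto
      qed
      then have "(\<Prod>i\<in>{0..<r}. f i ^ a i) \<in> exps_ideal (cube_exps (card {0..<r} * (N * e)))"
        by (intro prod_in_cube) auto
      then show "(\<Prod>i\<in>{0..<r}. f i ^ a i) \<in> exps_ideal (cube_exps (r * e * N))" by (simp add: mult_ac)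
    next
      fix u :: "(nat \<Rightarrow> nat) \<Rightarrow> 'k"
      assume "(\<Sum>a\<in>?T. mconst (u a) * (\<Prod>i\<in>{0..<r}. f i ^ a i)) = 0"
      then have "(\<Sum>a\<in>?T. mconst (u a) * (\<Prod>i\<in>{0..<r}. f i ^ a i)) \<in> P 0"
        using class_ring_idealD(1)[OF class_ring_primeidealD(1)[OF P(1)[of 0]]] by simp
      moreover have "a = b" if "a \<in> ?T" "b \<in> ?T" "\<forall>i\<in>{0..<r}. a i = b i" for a b
        by (rule PiE_ext[OF that(1,2)]) (use that(3) in blast)
      moreover have "finite ?T" by (intro finite_PiE) auto
      ultimately show "\<forall>a\<in>?T. u a = 0"
        using prime_chain_independent[of r P f 0 ?T u] P f by blast
    qed (auto intro: finite_PiE card_cube_exps)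
    then show ?thesis by (simp add: card_PiE card_cube_exps)
  qed
  then show ?thesis by (rule power_growth_bound)
qed

section \<open>Primes generated by variables and lower bounds for the dimension\<close>

text \<open>The ideal generated by the variables outside \<open>F\<close>; it shrinks as
  \<open>F\<close> grows.\<close>

definition vars_ideal :: "'n::finite set \<Rightarrow> ('n, 'k::field) mpoly set" where
  "vars_ideal F = exps_ideal {a. \<exists>i. i \<notin> F \<and> a i \<noteq> 0}"

lemma ideal_vars_ideal: "ideal (vars_ideal F :: ('n::finite, 'k::field) mpoly set) mpoly_ring"
  unfolding vars_ideal_def
proof (rule ideal_exps_ideal, unfold up_closed_def, intro ballI allI impI)
  fix a b :: "'n \<Rightarrow> nat"
  assume "a \<in> {a. \<exists>i. i \<notin> F \<and> a i \<noteq> 0}" and le: "\<forall>i. a i \<le> b i"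
  then obtain i where "i \<notin> F" "a i \<noteq> 0" by blast
  then have "i \<notin> F \<and> b i \<noteq> 0" using le[rule_format, of i] by simp
  then show "b \<in> {a. \<exists>i. i \<notin> F \<and> a i \<noteq> 0}" by blast
qed

text \<open>Any injection of the variables into \<open>nat\<close> turns the order of \<open>nat \<Rightarrow>\<^sub>0 nat\<close> into a monomial
  order, whose leading terms multiply.\<close>

lemma primeideal_vars_ideal: "primeideal (vars_ideal F :: ('n::finite, 'k::field) mpoly set) mpoly_ring"
proof (rule class_ring_primeidealI[OF ideal_vars_ideal])
  show "1 \<notin> (vars_ideal F :: ('n, 'k) mpoly set)" by (auto simp: vars_ideal_def exps_ideal_def)
  obtain g :: "'n \<Rightarrow> nat" where g: "inj g"
    using finite_imp_inj_to_nat_seg[of "UNIV :: 'n set"] by auto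
  define \<phi> :: "('n \<Rightarrow>\<^sub>0 nat) \<Rightarrow> (nat \<Rightarrow>\<^sub>0 nat)" where
    "\<phi> m = (\<Sum>i\<in>UNIV. single (g i) (lookup m i))" for m
  have \<phi>_add: "\<phi> (m + m') = \<phi> m + \<phi> m'" for m m'
    by (simp add: \<phi>_def lookup_add single_add sum.distrib)
  have \<phi>_lookup: "lookup (\<phi> m) (g j) = lookup m j" for m j
  proof -
    have "lookup (\<phi> m) (g j) = (\<Sum>i\<in>UNIV. if i = j then lookup m j else 0)"
      unfolding \<phi>_def lookup_sum
      by (intro sum.cong refl) (auto simp: lookup_single when_def dest: injD[OF g])
    then show ?thesis by simp
  qed
  have \<phi>_inj: "m = m'" if "\<phi> m = \<phi> m'" for m m'
    using that \<phi>_lookup by (metis poly_mapping_eqI)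
  \<comment> \<open>These are the terms of \<open>p\<close> that survive modulo
    \<open>vars_ideal F\<close>.\<close>
  define K where "K p = {m \<in> keys p. \<forall>i. i \<notin> F \<longrightarrow> lookup m i = 0}" for p :: "('n, 'k) mpoly"
  have lead: "\<exists>a\<in>K p. \<forall>m\<in>K p. m \<noteq> a \<longrightarrow> \<phi> m < \<phi> a" if p: "p \<notin> vars_ideal F" for p
  proof -
    have ne: "K p \<noteq> {}" using p unfolding vars_ideal_def exps_ideal_def K_def by blast
    have fin: "finite (K p)" by (simp add: K_def)
    have "Max (\<phi> ` K p) \<in> \<phi> ` K p" using ne fin by (intro Max_in) auto
    then obtain a where a: "a \<in> K p" "\<phi> a = Max (\<phi> ` K p)" by auto
    have "\<phi> m < \<phi> a" if "m \<in> K p" "m \<noteq> a" for m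
    proof -
      have "\<phi> m \<le> \<phi> a" using a(2) that fin by simp
      then show ?thesis using \<phi>_inj that(2) by (metis le_neq_trans)
    qed
    then show ?thesis using a(1) by blast
  qed
  fix p q :: "('n, 'k) mpoly" assume pq: "p * q \<in> vars_ideal F"
  show "p \<in> vars_ideal F \<or> q \<in> vars_ideal F"
  proof (rule ccontr)
    assume "\<not> (p \<in> vars_ideal F \<or> q \<in> vars_ideal F)"
    then obtain a b where a: "a \<in> K p" "\<And>m. m \<in> K p \<Longrightarrow> m \<noteq> a \<Longrightarrow> \<phi> m < \<phi> a"
      and b: "b \<in> K q" "\<And>m. m \<in> K q \<Longrightarrow> m \<noteq> b \<Longrightarrow> \<phi> m < \<phi> b" using lead by metis
    \<comment> \<open>The sum \<open>a + b\<close> arises from no other pair of terms: both members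
      of such a pair involve only variables in \<open>F\<close>, and among those the order
      decides.\<close>
    have unique: "m = a \<and> m' = b" if mm: "m \<in> keys p" "m' \<in> keys q" "m + m' = a + b" for m m'
    proof -
      have z: "lookup m i + lookup m' i = 0" if "i \<notin> F" for i
        using a(1) b(1) that mm(3) by (metis (mono_tags, lifting) K_def add_0 lookup_add mem_Collect_eq)
      have K: "m \<in> K p" "m' \<in> K q" using mm(1,2) z by (auto simp: K_def)
      have eq: "\<phi> m + \<phi> m' = \<phi> a + \<phi> b" using mm(3) by (simp flip: \<phi>_add)
      have le: "\<phi> m \<le> \<phi> a" "\<phi> m' \<le> \<phi> b" using a(2)[OF K(1)] b(2)[OF K(2)] by fastforce+
      have "m = a"
      proof (rule ccontr)
        assume "m \<noteq> a"
        then have "\<phi> m + \<phi> m' < \<phi> a + \<phi> b" using a(2)[OF K(1)] le(2) by (intro add_less_le_mono)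
        then show False using eq by simp
      qed
      moreover from this have "m' = b" using mm(3) by simp
      ultimately show ?thesis by blast
    qed
    define c where "c = lookup p a"
    define d where "d = lookup q b"
    define p' where "p' = p - single a c"
    define q' where "q' = q - single b d"
    have p': "m \<in> keys p \<and> m \<noteq> a" if "m \<in> keys p'" for m
      using that by (auto simp: p'_def c_def in_keys_iff lookup_minus lookup_single when_def split: if_splits)
    have q': "m \<in> keys q \<and> m \<noteq> b" if "m \<in> keys q'" for m
      using that by (auto simp: q'_def d_def in_keys_iff lookup_minus lookup_single when_def split: if_splits)
    have aK: "a \<in> keys p" "b \<in> keys q" using a(1) b(1) by (auto simp: K_def)
    have "p * q = single (a + b) (c * d) + (single a c * q' + p' * q)"
      by (simp add: p'_def q'_def algebra_simps mult_single)
    moreover have "a + b \<notin> keys (single a c * q')"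
    proof
      assume "a + b \<in> keys (single a c * q')"
      then obtain m m' where "m \<in> keys (single a c)" "m' \<in> keys q'" "a + b = m + m'"
        using keys_mult[of "single a c" q'] by blast
      then show False using q'[of m'] by (auto split: if_splits)
    qed
    moreover have "a + b \<notin> keys (p' * q)"
    proof
      assume "a + b \<in> keys (p' * q)"
      then obtain m m' where "m \<in> keys p'" "m' \<in> keys q" "a + b = m + m'"
        using keys_mult[of p' q] by blast
      then show False using p'[of m] unique[of m m'] by auto
    qed
    ultimately have "lookup (p * q) (a + b) = c * d"
      by (simp add: lookup_add in_keys_iff)
    then have "a + b \<in> keys (p * q)" using aK by (simp add: in_keys_iff c_def d_def)
    moreover have "lookup (a + b) i = 0" if "i \<notin> F" for i
      using a(1) b(1) that by (simp add: K_def lookup_add)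
    ultimately show False using pq by (auto simp: vars_ideal_def exps_ideal_def)
  qed
qed

lemma vars_ideal_strict_mono:
  assumes "F \<subset> F'"
  shows "vars_ideal F' \<subset> (vars_ideal F :: ('n::finite, 'k::field) mpoly set)"
proof
  show "vars_ideal F' \<subseteq> (vars_ideal F :: ('n, 'k) mpoly set)"
    unfolding vars_ideal_def using assms by (intro exps_ideal_mono) auto
  obtain j where j: "j \<in> F'" "j \<notin> F" using assms by blast
  have "single (single j 1) 1 \<in> (vars_ideal F :: ('n, 'k) mpoly set)"
    using j by (auto simp: vars_ideal_def intro!: single_in_exps_ideal exI[of _ j])
  moreover have "single (single j 1) 1 \<notin> (vars_ideal F' :: ('n, 'k) mpoly set)"
    using j by (auto simp: vars_ideal_def exps_ideal_def lookup_single when_def)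
  ultimately show "vars_ideal F' \<noteq> (vars_ideal F :: ('n, 'k) mpoly set)" by blast
qed

lemma primeideal_quot_image:
  fixes A P :: "'a::comm_ring_1 set"
  assumes A: "ideal A class_ring" and P: "primeideal P class_ring" "A \<subseteq> P"
  shows "primeideal ((\<lambda>x. A +>\<^bsub>class_ring\<^esub> x) ` P) (class_ring Quot A)"
proof -
  let ?R = "class_ring :: 'a ring"
  interpret A: ideal A ?R by fact
  note DP = class_ring_primeidealD[OF P(1)]
  \<comment> \<open>Because \<open>A \<subseteq> P\<close>, the set \<open>P\<close> is a union of
    cosets, so membership can be tested on any representative.\<close>
  have mem: "x \<in> P" if x: "A +>\<^bsub>?R\<^esub> x \<in> (\<lambda>x. A +>\<^bsub>?R\<^esub> x) ` P" for x
  proof -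
    obtain y where "y \<in> P" "A +>\<^bsub>?R\<^esub> x = A +>\<^bsub>?R\<^esub> y" using x by blast
    then have "x - y \<in> P" using P(2) residue_class_eq_iff[OF A] by (auto simp: coset_residue_class)
    then show ?thesis using class_ring_idealD(2)[OF DP(1) _ \<open>y \<in> P\<close>, of "x - y"] by simp
  qed
  show ?thesis
  proof (rule primeidealI)
    show "ideal ((\<lambda>x. A +>\<^bsub>?R\<^esub> x) ` P) (?R Quot A)"
      by (rule ring.ring_ideal_imp_quot_ideal[OF class_ring.ring_axioms A DP(1)])
    show "cring (?R Quot A)" by (rule A.quotient_is_cring[OF class_cring.cring_axioms])
    show "carrier (?R Quot A) \<noteq> (\<lambda>x. A +>\<^bsub>?R\<^esub> x) ` P"
    proof
      assume eq: "carrier (?R Quot A) = (\<lambda>x. A +>\<^bsub>?R\<^esub> x) ` P"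
      have "A +>\<^bsub>?R\<^esub> 1 \<in> carrier (?R Quot A)" by (auto simp: FactRing_def A_RCOSETS_def RCOSETS_def a_r_coset_def)
      then show False using eq mem DP(2) by blast
    qed
    fix X Y assume XY: "X \<in> carrier (?R Quot A)" "Y \<in> carrier (?R Quot A)" "X \<otimes>\<^bsub>?R Quot A\<^esub> Y \<in> (\<lambda>x. A +>\<^bsub>?R\<^esub> x) ` P"
    obtain x y where xy: "X = A +>\<^bsub>?R\<^esub> x" "Y = A +>\<^bsub>?R\<^esub> y"
      using XY(1,2) by (auto simp: FactRing_def A_RCOSETS_def RCOSETS_def a_r_coset_def)
    have "X \<otimes>\<^bsub>?R Quot A\<^esub> Y = A +>\<^bsub>?R\<^esub> (x * y)"
      using A.rcoset_mult_add[of x y] by (simp add: FactRing_def xy)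
    then have "x * y \<in> P" using XY(3) mem[of "x * y"] by (simp only:)
    then show "X \<in> (\<lambda>x. A +>\<^bsub>?R\<^esub> x) ` P \<or> Y \<in> (\<lambda>x. A +>\<^bsub>?R\<^esub> x) ` P" using DP(3)[of x y] xy by auto
  qed
qed

lemma primeideal_quot_vimage:
  fixes A :: "'a::comm_ring_1 set"
  assumes A: "ideal A class_ring" and Q: "primeideal Q (class_ring Quot A)"
  shows "primeideal {x. A +>\<^bsub>class_ring\<^esub> x \<in> Q} class_ring"
proof -
  interpret A: ideal A "class_ring :: 'a ring" by fact
  have "primeideal {x \<in> carrier class_ring. A +>\<^bsub>class_ring\<^esub> x \<in> Q} class_ring"
    by (rule ring_hom_ring.primeideal_vimage[OF A.rcos_ring_hom_ring class_cring.cring_axioms Q])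
  then show ?thesis by simp
qed

text \<open>Exhibiting a chain gives a lower bound for a supremum of integers only once the set is
  bounded above; this is the purpose of \<open>prime_chain_length\<close>, applied to preimages of
  primes of the quotient.\<close>

lemma card_le_krull_dim_quot:
  fixes A :: "('n::finite, 'k::field) mpoly set"
  assumes A: "ideal A mpoly_ring" "A \<subseteq> vars_ideal F"
  shows "int (card F) \<le> krull_dim (mpoly_ring Quot A)"
proof -
  let ?R = "mpoly_ring :: ('n, 'k) mpoly ring"
  let ?X = "{int r | r. \<exists>P. (\<forall>i\<le>r. primeideal (P i) (?R Quot A)) \<and> (\<forall>i<r. P i \<subset> P (Suc i))}"
  have "x \<le> int CARD('n)" if x: "x \<in> insert (- 1) ?X" for x
  proof (cases "x = - 1")
    case False
    then obtain r Q where r: "x = int r" "\<And>i. i \<le> r \<Longrightarrow> primeideal (Q i) (?R Quot A)" "\<And>i. i < r \<Longrightarrow> Q i \<subset> Q (Suc i)"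
      using x by blast
    define P where "P i = {x. A +>\<^bsub>?R\<^esub> x \<in> Q i}" for i
    have "r \<le> CARD('n)"
    proof (rule prime_chain_length[of r P])
      show "primeideal (P i) ?R" if "i \<le> r" for i
        unfolding P_def by (rule primeideal_quot_vimage[OF A(1) r(2)[OF that]])
      show "P i \<subset> P (Suc i)" if i: "i < r" for i
      proof -
        obtain X where X: "X \<in> Q (Suc i)" "X \<notin> Q i" using r(3)[OF i] by blast
        interpret Q: primeideal "Q (Suc i)" "?R Quot A" using r(2)[of "Suc i"] i by simp
        have "X \<in> carrier (?R Quot A)" using X(1) Q.Icarr by blast
        then obtain y where "X = A +>\<^bsub>?R\<^esub> y" by (auto simp: FactRing_def A_RCOSETS_def RCOSETS_def a_r_coset_def)
        then have "y \<in> P (Suc i)" "y \<notin> P i" using X by (auto simp: P_def)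
        moreover have "P i \<subseteq> P (Suc i)" using r(3)[OF i] by (auto simp: P_def)
        ultimately show ?thesis by blast
      qed
    qed
    then show ?thesis using r(1) by simp
  qed simp
  then have bdd: "bdd_above (insert (- 1) ?X)" by (rule bdd_aboveI)
  obtain h where h: "bij_betw h {0..<card F} F" using ex_bij_betw_nat_finite[of F] by auto
  \<comment> \<open>Removing the elements of \<open>F\<close> one at a time gives
    \<open>card F + 1\<close> primes above \<open>A\<close>, ending with the ideal of all
    variables.\<close>
  define G where "G i = h ` {i..<card F}" for i
  have G0: "G 0 = F" using h by (simp add: G_def bij_betw_def)
  have GS: "G (Suc i) \<subset> G i" if "i < card F" for i
  proof -
    have "h i \<notin> G (Suc i)"
    proof
      assume "h i \<in> G (Suc i)"
      then obtain j where "h i = h j" "Suc i \<le> j" "j < card F" by (auto simp: G_def)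
      then have "i = j" using h that by (auto simp: bij_betw_def inj_on_def)
      then show False using \<open>Suc i \<le> j\<close> by simp
    qed
    moreover have "h i \<in> G i" "G (Suc i) \<subseteq> G i" using that by (auto simp: G_def)
    ultimately show ?thesis by blast
  qed
  have sub: "A \<subseteq> vars_ideal (G i)" for i
  proof -
    have "G i \<subseteq> F" unfolding G0[symmetric] by (auto simp: G_def)
    then have "vars_ideal F \<subseteq> (vars_ideal (G i) :: ('n, 'k) mpoly set)"
      unfolding vars_ideal_def by (intro exps_ideal_mono) auto
    then show ?thesis using A(2) by blast
  qed
  define P where "P i = (\<lambda>x. A +>\<^bsub>?R\<^esub> x) ` vars_ideal (G i)" for i
  have "P i \<subset> P (Suc i)" if i: "i < card F" for i
  proof -
    have v: "vars_ideal (G i) \<subset> (vars_ideal (G (Suc i)) :: ('n, 'k) mpoly set)"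
      by (rule vars_ideal_strict_mono[OF GS[OF i]])
    then obtain y :: "('n, 'k) mpoly" where y: "y \<in> vars_ideal (G (Suc i))" "y \<notin> vars_ideal (G i)" by blast
    have "A +>\<^bsub>?R\<^esub> y \<notin> P i"
    proof
      assume "A +>\<^bsub>?R\<^esub> y \<in> P i"
      then obtain z where z: "z \<in> vars_ideal (G i)" "y - z \<in> A"
        using residue_class_eq_iff[OF A(1)] by (auto simp: P_def coset_residue_class)
      then have "(y - z) + z \<in> vars_ideal (G i)" using sub[of i] class_ring_idealD(2)[OF ideal_vars_ideal] by blast
      then show False using y(2) by simp
    qed
    moreover have "A +>\<^bsub>?R\<^esub> y \<in> P (Suc i)" "P i \<subseteq> P (Suc i)" using y(1) v by (auto simp: P_def)
    ultimately show ?thesis by blast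
  qed
  moreover have "primeideal (P i) (?R Quot A)" for i
    unfolding P_def by (rule primeideal_quot_image[OF A(1) primeideal_vars_ideal sub])
  ultimately have "int (card F) \<in> ?X" by blast
  then show ?thesis unfolding krull_dim_def by (intro cSup_upper bdd) blast
qed

lemma annihilator_graded_quot:
  assumes "ideal B mpoly_ring"
  shows "annihilator mpoly_ring (graded_quot A B) = ideal_colon mpoly_ring B A"
proof -
  have "r \<odot>\<^bsub>graded_quot A B\<^esub> residue_class B p = B \<longleftrightarrow> r * p \<in> B" for r p
    using residue_class_eq_iff[OF assms, of "r * p" 0]
    by (simp add: graded_quot_smult[OF assms] residue_class_zero)
  then show ?thesis by (simp add: annihilator_def ideal_colon_def graded_quot_simps)
qed

text \<open>If \<open>b\<close> stays outside \<open>U\<close> however its coordinates in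
  \<open>F\<close> are raised, every monomial annihilating the quotient involves a variable outside
  \<open>F\<close>. So the annihilator lies in \<open>vars_ideal F\<close>.\<close>

lemma card_le_module_dim:
  fixes G U :: "('n::finite \<Rightarrow> nat) set"
  assumes U: "up_closed U" and b: "b \<in> G"
    and F: "\<And>a. (\<And>i. i \<notin> F \<Longrightarrow> a i = 0) \<Longrightarrow> (\<lambda>i. a i + b i) \<notin> U"
  shows "int (card F) \<le> module_dim mpoly_ring (graded_quot (exps_ideal G) (exps_ideal U :: ('n, 'k::field) mpoly set))"
proof -
  let ?W = "{a. \<forall>b\<in>G. (\<lambda>i. a i + b i) \<in> U}"
  have "up_closed ?W"
  proof (unfold up_closed_def, intro ballI allI impI CollectI)
    fix a a' c assume "a \<in> ?W" "\<forall>i. a i \<le> a' i" "c \<in> G"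
    then have "(\<lambda>i. a i + c i) \<in> U" "\<And>i. a i + c i \<le> a' i + c i" by auto
    then show "(\<lambda>i. a' i + c i) \<in> U" by (rule up_closedD[OF U])
  qed
  then have "ideal (exps_ideal ?W :: ('n, 'k) mpoly set) mpoly_ring" by (rule ideal_exps_ideal)
  moreover have "exps_ideal ?W \<subseteq> (vars_ideal F :: ('n, 'k) mpoly set)"
    unfolding vars_ideal_def using F b by (intro exps_ideal_mono subsetI) blast
  ultimately have "int (card F) \<le> krull_dim (mpoly_ring Quot (exps_ideal ?W :: ('n, 'k) mpoly set))"
    by (rule card_le_krull_dim_quot)
  then show ?thesis
    unfolding module_dim_def annihilator_graded_quot[OF ideal_exps_ideal[OF U]] ideal_colon_exps_ideal .
qed

section \<open>Length\<close>

lemma module_graded_quot: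
  assumes A: "ideal A mpoly_ring" and B: "ideal B mpoly_ring"
  shows "module mpoly_ring (graded_quot A B)"
proof -
  let ?N = "graded_quot A B"
  note D = class_ring_idealD[OF A]
  note simps = graded_quot_simps(1) graded_quot_add[OF B] graded_quot_smult[OF B]
  have zero: "\<zero>\<^bsub>?N\<^esub> = residue_class B 0" by (simp add: graded_quot_simps residue_class_zero)
  have "abelian_group ?N"
  proof (rule abelian_groupI)
    fix x assume "x \<in> carrier ?N"
    then obtain p where "x = residue_class B p" "p \<in> A" by (auto simp: simps)
    then have "residue_class B (- p) \<in> carrier ?N" "residue_class B (- p) \<oplus>\<^bsub>?N\<^esub> x = \<zero>\<^bsub>?N\<^esub>"
      by (auto simp: simps zero D(4))
    then show "\<exists>y\<in>carrier ?N. y \<oplus>\<^bsub>?N\<^esub> x = \<zero>\<^bsub>?N\<^esub>" by blast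
  qed (auto simp: simps zero D(1,2) add_ac)
  then show ?thesis
    by (intro Module.module.intro module_axioms.intro class_cring.cring_axioms)
       (auto simp: simps zero D(1-3) distrib_left distrib_right mult.assoc)
qed

lemma submodule_graded_quot:
  assumes A: "ideal A mpoly_ring" and B: "ideal B mpoly_ring" and C: "ideal C mpoly_ring" "C \<subseteq> A"
  shows "Module.submodule (residue_class B ` C) mpoly_ring (graded_quot A B)"
proof -
  let ?N = "graded_quot A B"
  interpret N: Module.module mpoly_ring ?N by (rule module_graded_quot[OF A B])
  note D = class_ring_idealD[OF C(1)]
  note simps = graded_quot_simps(1) graded_quot_add[OF B] graded_quot_smult[OF B]
  have zero: "\<zero>\<^bsub>?N\<^esub> = residue_class B 0" by (simp add: graded_quot_simps residue_class_zero)
  show ?thesis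
  proof (rule N.submoduleI)
    fix x assume "x \<in> residue_class B ` C"
    then obtain p where p: "x = residue_class B p" "p \<in> C" by blast
    have "\<ominus>\<^bsub>?N\<^esub> x = residue_class B (- p)"
      using p C(2) D(4) by (intro N.minus_equality) (auto simp: simps zero)
    then show "\<ominus>\<^bsub>?N\<^esub> x \<in> residue_class B ` C" using p(2) D(4) by auto
  qed (use C(2) D in \<open>auto simp: simps zero\<close>)
qed

text \<open>Adjoin an exponent of maximal total degree in \<open>G - U\<close>: everything strictly
  above it already lies in \<open>U\<close>, so the enlarged set is still up-closed.\<close>

lemma up_closed_chain:
  fixes G U :: "('n::finite \<Rightarrow> nat) set"
  assumes "up_closed G" "up_closed U" "U \<subseteq> G" "finite (G - U)" "card (G - U) = r"
  shows "\<exists>C. (\<forall>i\<le>r. up_closed (C i) \<and> U \<subseteq> C i \<and> C i \<subseteq> G) \<and> (\<forall>i<r. C i \<subset> C (Suc i))"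
  using assms(2-)
proof (induction r arbitrary: U)
  case 0
  then show ?case by (intro exI[of _ "\<lambda>_. U"]) auto
next
  case (Suc r)
  let ?d = "\<lambda>a. \<Sum>i\<in>UNIV. a i"
  have ne: "G - U \<noteq> {}" using Suc.prems(4) by (metis card.empty nat.distinct(1))
  have "Max (?d ` (G - U)) \<in> ?d ` (G - U)" using Suc.prems(3) ne by (intro Max_in) auto
  then obtain a where a': "a \<in> G - U" "?d a = Max (?d ` (G - U))" by fastforce
  have a: "a \<in> G - U" "\<And>b. b \<in> G - U \<Longrightarrow> ?d b \<le> ?d a"
    using a' Suc.prems(3) by auto
  have up: "up_closed (insert a U)"
    unfolding up_closed_def
  proof (intro ballI allI impI)
    fix x b assume x: "x \<in> insert a U" "\<forall>i. x i \<le> b i"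
    show "b \<in> insert a U"
    proof (cases "x \<in> U")
      case True
      then show ?thesis using up_closedD[OF Suc.prems(1), of x b] x(2) by blast
    next
      case False
      then have xa: "x = a" using x(1) by simp
      have bG: "b \<in> G" using up_closedD[OF assms(1), of a b] a(1) x(2) xa by blast
      show ?thesis
      proof (rule ccontr)
        assume b: "b \<notin> insert a U"
        then have "?d b \<le> ?d a" using a(2) bG by blast
        moreover obtain i where "b i \<noteq> a i" using b by (auto simp: fun_eq_iff)
        then have "a i < b i" using x(2)[rule_format, of i] xa by simp
        then have "?d a < ?d b" using x(2) xa by (intro sum_strict_mono_ex1) auto
        ultimately show False by simp
      qed
    qed
  qed
  have eq: "G - insert a U = (G - U) - {a}" by auto
  have "card (G - insert a U) = r" using Suc.prems(3,4) a(1) unfolding eq by simp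
  moreover have "finite (G - insert a U)" using Suc.prems(3) unfolding eq by simp
  ultimately obtain C where C: "\<forall>i\<le>r. up_closed (C i) \<and> insert a U \<subseteq> C i \<and> C i \<subseteq> G" "\<forall>i<r. C i \<subset> C (Suc i)"
    using Suc.IH[OF up] Suc.prems(2) a(1) by blast
  define C' where "C' i = (case i of 0 \<Rightarrow> U | Suc j \<Rightarrow> C j)" for i
  have "up_closed (C' i) \<and> U \<subseteq> C' i \<and> C' i \<subseteq> G" if "i \<le> Suc r" for i
    using that C(1) Suc.prems(1,2) by (cases i) (auto simp: C'_def)
  moreover have "C' i \<subset> C' (Suc i)" if "i < Suc r" for i
  proof (cases i)
    case 0
    have "insert a U \<subseteq> C 0" using C(1) by simp
    then show ?thesis using a(1) 0 by (auto simp: C'_def)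
  next
    case (Suc j)
    then show ?thesis using C(2) that by (simp add: C'_def)
  qed
  ultimately show ?case by blast
qed

lemma reduce_mod_exps_ideal:
  fixes p :: "('n::finite, 'k::field) mpoly"
  assumes "p \<in> exps_ideal G" "finite (G - U)"
  shows "\<exists>q\<in>exps_ideal (G - U). p - q \<in> exps_ideal U"
proof -
  let ?q = "\<Sum>x\<in>G - U. mconst (lookup p (exp_monom x)) * monomial (exp_monom x)"
  have "?q \<in> exps_ideal (G - U)"
    unfolding exps_ideal_iff_lookup using assms(2) by (simp add: lookup_sum_monomials)
  moreover have "p - ?q \<in> exps_ideal U"
    using assms by (auto simp: exps_ideal_iff_lookup lookup_minus lookup_sum_monomials)
  ultimately show ?thesis by blast
qed

text \<open>Each strict step supplies a representative spanned by the exponents in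
  \<open>G - U\<close>. In a linear relation the last member with nonzero coefficient would lie in
  the submodule that it was chosen to avoid, so the representatives are independent over the
  field.\<close>

lemma submodule_chain_length_le:
  fixes G U :: "('n::finite \<Rightarrow> nat) set"
  assumes U: "up_closed U" and fin: "finite (G - U)"
    and M: "\<And>i. i \<le> r \<Longrightarrow> Module.submodule (M i) mpoly_ring (graded_quot (exps_ideal G) (exps_ideal U :: ('n, 'k::field) mpoly set))"
      "\<And>i. i < r \<Longrightarrow> M i \<subset> M (Suc i)"
  shows "r \<le> card (G - U)"
proof -
  let ?B = "exps_ideal U :: ('n, 'k) mpoly set"
  let ?N = "graded_quot (exps_ideal G) ?B"
  let ?c = "residue_class ?B"
  have B: "ideal ?B mpoly_ring" by (rule ideal_exps_ideal[OF U])
  have M0: "?c 0 \<in> M i" if "i \<le> r" for i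
  proof -
    interpret Module.submodule "M i" mpoly_ring ?N by (rule M(1)[OF that])
    show ?thesis using one_closed by (simp add: graded_quot_simps residue_class_zero)
  qed
  have Madd: "?c (p + q) \<in> M i" if "i \<le> r" "?c p \<in> M i" "?c q \<in> M i" for i p q
  proof -
    interpret Module.submodule "M i" mpoly_ring ?N by (rule M(1)[OF that(1)])
    show ?thesis using m_closed[OF that(2,3)] by (simp add: graded_quot_add[OF B])
  qed
  have Msmult: "?c (s * p) \<in> M i" if "i \<le> r" "?c p \<in> M i" for i s p
  proof -
    interpret Module.submodule "M i" mpoly_ring ?N by (rule M(1)[OF that(1)])
    show ?thesis using smult_closed[of s "?c p"] that(2) by (simp add: graded_quot_smult[OF B])
  qed
  have mono: "M l \<subseteq> M i" if "l \<le> i" "i \<le> r" for l i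
    using that
  proof (induction i rule: dec_induct)
    case (step n)
    then show ?case using M(2)[of n] by auto
  qed simp
  have "\<exists>q. i < r \<longrightarrow> q \<in> exps_ideal (G - U) \<and> ?c q \<in> M (Suc i) \<and> ?c q \<notin> M i" for i
  proof (cases "i < r")
    case True
    obtain X where X: "X \<in> M (Suc i)" "X \<notin> M i" using M(2)[OF True] by blast
    interpret Module.submodule "M (Suc i)" mpoly_ring ?N using M(1)[of "Suc i"] True by simp
    have "X \<in> carrier ?N" using subset X(1) by auto
    then obtain p where p: "X = ?c p" "p \<in> exps_ideal G" by (auto simp: graded_quot_simps)
    obtain q where q: "q \<in> exps_ideal (G - U)" "p - q \<in> ?B" using reduce_mod_exps_ideal[OF p(2) fin] by blast
    then have "X = ?c q" using p(1) by (simp add: residue_class_eq_iff[OF B])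
    then show ?thesis using X q(1) by blast
  qed simp
  then obtain f where f: "\<And>i. i < r \<Longrightarrow> f i \<in> exps_ideal (G - U)" "\<And>i. i < r \<Longrightarrow> ?c (f i) \<in> M (Suc i)"
    "\<And>i. i < r \<Longrightarrow> ?c (f i) \<notin> M i"
    by metis
  have "card {..<r} \<le> card (G - U)"
  proof (rule card_independent_le[where f = f])
    fix u :: "nat \<Rightarrow> 'k" assume sum0: "(\<Sum>i<r. mconst (u i) * f i) = 0"
    show "\<forall>i\<in>{..<r}. u i = 0"
    proof (rule ccontr)
      assume "\<not> (\<forall>i\<in>{..<r}. u i = 0)"
      then have ne: "{i. i < r \<and> u i \<noteq> 0} \<noteq> {}" by auto
      define s where "s = Max {i. i < r \<and> u i \<noteq> 0}"
      have s: "s < r" "u s \<noteq> 0" using Max_in[OF _ ne] by (auto simp: s_def)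
      have above: "u i = 0" if "i < r" "s < i" for i
      proof (rule ccontr)
        assume "u i \<noteq> 0"
        then have "i \<le> s" unfolding s_def using that(1) by (intro Max_ge) auto
        then show False using that(2) by simp
      qed
      have "(\<Sum>i<r. mconst (u i) * f i) = (\<Sum>i<Suc s. mconst (u i) * f i)"
        using s(1) above by (intro sum.mono_neutral_right) (auto simp: not_less Suc_le_eq)
      then have eq: "mconst (u s) * f s = - (\<Sum>i<s. mconst (u i) * f i)"
        using sum0 by (simp add: eq_neg_iff_add_eq_0 add.commute)
      have part: "?c (\<Sum>i<t. mconst (u i) * f i) \<in> M s" if "t \<le> s" for t
        using that
      proof (induction t)
        case 0
        then show ?case using M0[of s] s(1) by simp
      next
        case (Suc t)
        have "?c (f t) \<in> M s" using f(2)[of t] mono[of "Suc t" s] Suc.prems s(1) by auto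
        then show ?case using Suc s(1) by (simp add: Madd Msmult)
      qed
      have "f s = mconst (1 / u s) * (mconst (u s) * f s)"
        using s(2) by (simp add: mult.assoc[symmetric] mconst_mult[symmetric])
      also have "\<dots> = (- mconst (1 / u s)) * (\<Sum>i<s. mconst (u i) * f i)" unfolding eq by simp
      finally have "?c (f s) \<in> M s" using Msmult[OF _ part[OF order_refl], of "- mconst (1 / u s)"] s(1) by simp
      then show False using f(3)[OF s(1)] by blast
    qed
  qed (use f fin in auto)
  then show ?thesis by simp
qed

text \<open>The vector space dimension bounds all chains, and a chain of monomial ideals growing by
  one exponent at a time attains the bound.\<close>

lemma module_length_exps:
  fixes G U :: "('n::finite \<Rightarrow> nat) set"
  assumes G: "up_closed G" and U: "up_closed U" "U \<subseteq> G" and fin: "finite (G - U)"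
  shows "module_length mpoly_ring (graded_quot (exps_ideal G) (exps_ideal U :: ('n, 'k::field) mpoly set)) =
    enat (card (G - U))"
proof -
  let ?B = "exps_ideal U :: ('n, 'k) mpoly set"
  let ?N = "graded_quot (exps_ideal G) ?B"
  have B: "ideal ?B mpoly_ring" by (rule ideal_exps_ideal[OF U(1)])
  let ?S = "{enat r | r. \<exists>N. (\<forall>i\<le>r. Module.submodule (N i) mpoly_ring ?N) \<and> (\<forall>i<r. N i \<subset> N (Suc i))}"
  have "Sup ?S \<le> enat (card (G - U))"
  proof (rule Sup_least)
    fix x assume "x \<in> ?S"
    then obtain r N where "x = enat r" "\<forall>i\<le>r. Module.submodule (N i) mpoly_ring ?N" "\<forall>i<r. N i \<subset> N (Suc i)"
      by blast
    then show "x \<le> enat (card (G - U))" using submodule_chain_length_le[OF U(1) fin, of r N] by simp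
  qed
  moreover have "enat (card (G - U)) \<in> ?S"
  proof -
    obtain C where C: "\<And>i. i \<le> card (G - U) \<Longrightarrow> up_closed (C i) \<and> U \<subseteq> C i \<and> C i \<subseteq> G"
      "\<And>i. i < card (G - U) \<Longrightarrow> C i \<subset> C (Suc i)"
      using up_closed_chain[OF G U fin refl] by blast
    define M where "M i = residue_class ?B ` exps_ideal (C i)" for i
    have "Module.submodule (M i) mpoly_ring ?N" if "i \<le> card (G - U)" for i
      unfolding M_def using C(1)[OF that] G
      by (intro submodule_graded_quot ideal_exps_ideal exps_ideal_mono U) auto
    moreover have "M i \<subset> M (Suc i)" if i: "i < card (G - U)" for i
    proof -
      obtain a where a: "a \<in> C (Suc i)" "a \<notin> C i" using C(2)[OF i] by blast
      let ?m = "single (exp_monom a) 1 :: ('n, 'k) mpoly"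
      have "residue_class ?B ?m \<notin> M i"
      proof
        assume "residue_class ?B ?m \<in> M i"
        then obtain q where q: "q \<in> exps_ideal (C i)" "?m - q \<in> ?B"
          by (auto simp: M_def residue_class_eq_iff[OF B])
        then have "?m - q \<in> exps_ideal (C i)" using exps_ideal_mono[of U "C i"] C(1)[of i] i by auto
        then have "(?m - q) + q \<in> exps_ideal (C i)" using q(1) by (rule add_in_exps_ideal)
        then have "?m \<in> exps_ideal (C i)" by simp
        then show False using a(2) by (simp add: exps_ideal_def)
      qed
      moreover have "residue_class ?B ?m \<in> M (Suc i)"
        unfolding M_def using a(1) by (intro imageI single_in_exps_ideal) simp
      moreover have "M i \<subseteq> M (Suc i)"
        unfolding M_def using C(2)[OF i] by (intro image_mono exps_ideal_mono) auto
      ultimately show ?thesis by blast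
    qed
    ultimately show ?thesis by blast
  qed
  then have "enat (card (G - U)) \<le> Sup ?S" by (rule Sup_upper)
  ultimately show ?thesis unfolding module_length_def by (rule antisym)
qed

section \<open>Multiplicities and limits\<close>

definition saturation_exps :: "('n \<Rightarrow> nat) set \<Rightarrow> ('n \<Rightarrow> nat) set \<Rightarrow> nat \<Rightarrow> ('n \<Rightarrow> nat) set" where
  "saturation_exps E J k = {a. \<forall>f\<in>J. a \<in> power_exps (zero_on {i. f i \<noteq> 0} ` E) k}"

lemma saturation_exps_diff: "saturation_exps E J k - power_exps E k = exps_diff E J k"
  by (auto simp: saturation_exps_def exps_diff_def)

lemma up_closed_saturation_exps: "up_closed (saturation_exps E J k)"
  unfolding up_closed_def saturation_exps_def by (auto intro: power_exps_mono)

lemma graded_quot_saturation: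
  fixes I J :: "('n::finite, 'k::field) mpoly set"
  assumes "finite E" "finite F" "I = exps_ideal {a. \<exists>e\<in>E. \<forall>i. e i \<le> a i}"
    "J = exps_ideal {a. \<exists>f\<in>F. \<forall>i. f i \<le> a i}"
  shows "graded_quot (ideal_saturation mpoly_ring (ideal_power mpoly_ring I k) J) (ideal_power mpoly_ring I k) =
    graded_quot (exps_ideal (saturation_exps E F k)) (exps_ideal (power_exps E k))"
  unfolding assms(3,4) ideal_power_exps_ideal[OF assms(1)] ideal_saturation_exps_ideal[OF assms(1,2)]
    saturation_exps_def ..

text \<open>Raising the capped coordinates of \<open>b\<close> does not change its truncation, so
  all these multiples stay outside the power. The capped coordinates are therefore free directions
  of the module.\<close>

lemma stratum_le_module_dim:
  fixes E F :: "('n::finite \<Rightarrow> nat) set"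
  assumes B: "\<And>e i. e \<in> E \<Longrightarrow> e i \<le> B"
    and b: "b \<in> exps_diff E F k" "\<And>i. b i \<le> B * k"
  shows "int (card {i. b i = B * k}) \<le> module_dim mpoly_ring
    (graded_quot (exps_ideal (saturation_exps E F k)) (exps_ideal (power_exps E k) :: ('n, 'k::field) mpoly set))"
proof (rule card_le_module_dim[OF up_closed_power_exps])
  show "b \<in> saturation_exps E F k" using b(1) by (auto simp flip: saturation_exps_diff)
  fix a :: "'n \<Rightarrow> nat" assume a: "\<And>i. i \<notin> {i. b i = B * k} \<Longrightarrow> a i = 0"
  have "(\<lambda>i. min (a i + b i) (B * k)) = b"
  proof
    fix i show "min (a i + b i) (B * k) = b i" using a[of i] b(2)[of i] by (cases "b i = B * k") auto
  qed
  moreover have "(\<lambda>i. min (a i + b i) (B * k)) \<in> power_exps E k \<longleftrightarrow> (\<lambda>i. a i + b i) \<in> power_exps E k"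
    by (rule power_exps_truncate) (rule B)
  ultimately show "(\<lambda>i. a i + b i) \<notin> power_exps E k" using b(1) by (simp add: exps_diff_def)
qed

text \<open>If the quotient vanishes, both sides are 0, the left one by convention. Otherwise the
  dimension bounds the number of capped coordinates, so the Hilbert polynomial has degree at most
  \<open>d\<close> and its coefficient in degree \<open>d\<close> counts the stratum.\<close>

lemma multiplicity_eq_card:
  fixes E F :: "('n::finite \<Rightarrow> nat) set" and k :: nat
  assumes B: "\<And>e i. e \<in> E \<Longrightarrow> e i \<le> B"
  defines "N \<equiv> graded_quot (exps_ideal (saturation_exps E F k)) (exps_ideal (power_exps E k) :: ('n, 'k::field) mpoly set)"
  shows "multiplicity_e0 N = of_nat (card (stratum (exps_diff E F k) (B * k) (nat (module_dim mpoly_ring N))))"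
proof (cases "exps_diff E F k = {}")
  case True
  then have "saturation_exps E F k \<subseteq> power_exps E k" by (auto simp flip: saturation_exps_diff)
  then have sub: "exps_ideal (saturation_exps E F k) \<subseteq> (exps_ideal (power_exps E k) :: ('n, 'k) mpoly set)"
    by (rule exps_ideal_mono)
  let ?B = "exps_ideal (power_exps E k) :: ('n, 'k) mpoly set"
  have BI: "ideal ?B mpoly_ring" by (rule ideal_exps_ideal[OF up_closed_power_exps])
  have "residue_class ?B p = ?B" if "p \<in> exps_ideal (saturation_exps E F k)" for p
    using residue_class_eq_iff[OF BI, of p 0] sub that by (auto simp: residue_class_zero)
  moreover have "0 \<in> (exps_ideal (saturation_exps E F k) :: ('n, 'k) mpoly set)" by simp
  ultimately have "residue_class ?B ` exps_ideal (saturation_exps E F k) = {?B}"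
    by (metis (no_types, lifting) empty_iff image_cong image_constant)
  then have "carrier N = {\<zero>\<^bsub>N\<^esub>}" unfolding N_def graded_quot_simps .
  then show ?thesis using True by (simp add: multiplicity_e0_def)
next
  case False
  then obtain a where a: "a \<in> saturation_exps E F k" "a \<notin> power_exps E k" by (auto simp flip: saturation_exps_diff)
  define d where "d = nat (module_dim mpoly_ring N)"
  let ?B = "exps_ideal (power_exps E k) :: ('n, 'k) mpoly set"
  have BI: "ideal ?B mpoly_ring" by (rule ideal_exps_ideal[OF up_closed_power_exps])
  have "carrier N \<noteq> {\<zero>\<^bsub>N\<^esub>}"
  proof
    assume eq: "carrier N = {\<zero>\<^bsub>N\<^esub>}"
    let ?m = "single (exp_monom a) 1 :: ('n, 'k) mpoly"
    have "?m \<in> exps_ideal (saturation_exps E F k)" using a(1) by (intro single_in_exps_ideal) simp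
    then have "residue_class ?B ?m \<in> carrier N" unfolding N_def graded_quot_simps by blast
    then have "residue_class ?B ?m = residue_class ?B 0"
      using eq by (simp add: N_def graded_quot_simps residue_class_zero)
    then have "?m \<in> ?B" by (simp add: residue_class_eq_iff[OF BI])
    then show False using a(2) by (simp add: exps_ideal_def)
  qed
  then have e0: "multiplicity_e0 N = hilbert_coeff N 0" by (simp add: multiplicity_e0_def)
  have trunc: "(\<lambda>i. min (a i) (B * k)) \<in> exps_diff E F k \<longleftrightarrow> a \<in> exps_diff E F k" for a
    by (rule exps_diff_truncate) (rule B)
  have dim: "card {i. b i = B * k} \<le> d" if "b \<in> exps_diff E F k" "\<And>i. b i \<le> B * k" for b
  proof -
    have "int (card {i. b i = B * k}) \<le> module_dim mpoly_ring N"
      unfolding N_def by (rule stratum_le_module_dim) (use B that in auto)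
    then show ?thesis by (simp add: d_def)
  qed
  obtain P :: "rat poly" where P: "degree P \<le> d"
    "coeff P d * fact d = of_nat (card (stratum (exps_diff E F k) (B * k) d))"
    "\<forall>\<^sub>F M in sequentially. of_nat (card {a \<in> exps_diff E F k. sum a UNIV \<le> M}) = poly P (of_nat M)"
    using truncation_invariant_poly[of "B * k" "exps_diff E F k" d] trunc dim by blast
  have hf: "hilbert_fun N M = card {a \<in> exps_diff E F k. sum a UNIV \<le> M}" for M
    unfolding N_def hilbert_fun_exps[OF up_closed_power_exps] saturation_exps_diff ..
  have "hilbert_poly N = P"
    unfolding hilbert_poly_def
  proof (rule the_equality)
    show ev: "\<forall>\<^sub>F i in sequentially. of_nat (hilbert_fun N i) = poly P (of_nat i)" using P(3) by (simp add: hf)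
    fix Q :: "rat poly" assume "\<forall>\<^sub>F i in sequentially. of_nat (hilbert_fun N i) = poly Q (of_nat i)"
    then have "\<forall>\<^sub>F i in sequentially. poly Q (of_nat i) = poly P (of_nat i)" using ev by eventually_elim simp
    then show "Q = P" by (rule poly_eqI_eventually)
  qed
  then have "hilbert_coeff N 0 = coeff P d * fact d"
    unfolding hilbert_coeff_def Let_def d_def[symmetric] using the_binomial_coeff_0[OF P(1)] by simp
  then show ?thesis using e0 P(2) by (simp add: d_def)
qed

text \<open>From some \<open>k\<close> on the dimension is the constant \<open>d\<close>, so the
  multiplicity counts one fixed kind of stratum. The factor \<open>k ^ d\<close> in
  \<open>stratum_limit\<close> cancels against \<open>k ^ n\<close>, where \<open>n\<close> is the
  number of variables.\<close>

lemma multiplicity_limit: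
  fixes E F :: "('n::finite \<Rightarrow> nat) set"
  defines "N \<equiv> \<lambda>k. graded_quot (exps_ideal (saturation_exps E F k)) (exps_ideal (power_exps E k) :: ('n, 'k::field) mpoly set)"
  assumes "finite E" "finite F" "has_limit_dim mpoly_ring N d"
  shows "\<exists>q\<in>\<rat>. (\<lambda>k. 1 / (real k powi (int CARD('n) - d)) * of_rat (multiplicity_e0 (N k))) \<longlonglongrightarrow> q"
proof -
  obtain B where B: "\<And>e i. e \<in> E \<Longrightarrow> e i \<le> B" using generator_bound[OF assms(2)] by blast
  obtain k0 where k0: "\<And>k. k \<ge> k0 \<Longrightarrow> module_dim mpoly_ring (N k) = d"
    using assms(4) by (auto simp: has_limit_dim_def)
  define X where "X k = (stratum (exps_diff E F k) (B * k) (nat d))" for k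
  have e0: "multiplicity_e0 (N k) = of_nat (card (X k))" if "k \<ge> k0" for k
    using multiplicity_eq_card[of E B F k, where 'k = 'k] B k0[OF that] unfolding N_def X_def by simp
  show ?thesis
  proof (cases "0 \<le> d \<and> d \<le> int CARD('n)")
    case True
    obtain q where q: "q \<in> \<rat>" "(\<lambda>k. real (card (X k) * k ^ nat d) / real k ^ CARD('n)) \<longlonglongrightarrow> q"
      using stratum_limit[of E F B "nat d"] assms(2,3) B unfolding X_def by blast
    have "\<forall>\<^sub>F k in sequentially. real (card (X k) * k ^ nat d) / real k ^ CARD('n) =
        1 / (real k powi (int CARD('n) - d)) * of_rat (multiplicity_e0 (N k))"
      using eventually_ge_at_top[of k0] eventually_gt_at_top[of 0]
    proof eventually_elim
      case (elim k)
      have "nat d \<le> CARD('n)" using True by (simp add: nat_le_iff)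
      then have n: "CARD('n) = (CARD('n) - nat d) + nat d" by simp
      have "real k powi (int CARD('n) - d) = real k ^ (CARD('n) - nat d)"
        using True by (simp add: power_int_def nat_diff_distrib')
      moreover have "real k ^ CARD('n) = real k ^ (CARD('n) - nat d) * real k ^ nat d"
        unfolding power_add[symmetric] n[symmetric] ..
      ultimately show ?case using elim(2) by (simp add: e0[OF elim(1)])
    qed
    from Lim_transform_eventually[OF q(2) this] show ?thesis using q(1) by blast
  next
    case False
    \<comment> \<open>A member would have exactly \<open>nat d\<close> capped coordinates, a number
      bounded both by \<open>d\<close> and by the number of variables; this excludes negative and
      too large \<open>d\<close>. The dimension -1 of the zero module falls under this case.\<close>
    have emp: "X k = {}" if "k \<ge> k0" for k
    proof (rule ccontr)
      assume "X k \<noteq> {}"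
      then obtain b where b: "b \<in> exps_diff E F k" "\<forall>i. b i \<le> B * k" "card {i. b i = B * k} = nat d" by (auto simp: X_def)
      have "int (card {i. b i = B * k}) \<le> module_dim mpoly_ring (N k)"
        unfolding N_def by (rule stratum_le_module_dim) (use B b(1,2) in auto)
      then have "int (card {i. b i = B * k}) \<le> d" using k0[OF that] by simp
      moreover have "card {i. b i = B * k} \<le> CARD('n)" by (intro card_mono) auto
      ultimately show False using False b(3) by linarith
    qed
    have "\<forall>\<^sub>F k in sequentially. 0 = 1 / (real k powi (int CARD('n) - d)) * of_rat (multiplicity_e0 (N k))"
      by (rule eventually_mono[OF eventually_ge_at_top[of k0]]) (simp add: e0 emp)
    then have "(\<lambda>k. 1 / (real k powi (int CARD('n) - d)) * of_rat (multiplicity_e0 (N k))) \<longlonglongrightarrow> 0"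
      by (rule Lim_transform_eventually[OF tendsto_const])
    then show ?thesis using Rats_0 by blast
  qed
qed

text \<open>With the unit vectors as generators each coordinate may be forgotten singly, so one that
  reaches \<open>B * k\<close> would put the exponent into the power. Hence nothing in the quotient
  is capped: the length is finite and the stratum with \<open>m = 0\<close> is everything.\<close>

lemma length_limit:
  fixes E :: "('n::finite \<Rightarrow> nat) set"
  defines "F \<equiv> range (\<lambda>j i. if i = j then 1 else 0) :: ('n \<Rightarrow> nat) set"
  assumes "finite E"
  shows "\<exists>q\<in>\<rat>. (\<lambda>k. ereal (1 / real k ^ CARD('n)) * ereal_of_enat (module_length mpoly_ring
    (graded_quot (exps_ideal (saturation_exps E F k)) (exps_ideal (power_exps E k) :: ('n, 'k::field) mpoly set)))) \<longlonglongrightarrow> ereal q"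
proof -
  obtain B where B: "\<And>e i. e \<in> E \<Longrightarrow> e i \<le> B" using generator_bound[OF assms(2)] by blast
  have lt: "a j < B * k" if a: "a \<in> exps_diff E F k" for a j k
  proof (rule ccontr)
    assume "\<not> a j < B * k"
    let ?f = "\<lambda>i. if i = j then 1 else (0::nat)"
    have "a \<in> power_exps (zero_on {i. ?f i \<noteq> 0} ` E) k" using a by (auto simp: exps_diff_def F_def)
    moreover have "a \<in> power_exps (zero_on {i. ?f i \<noteq> 0} ` E) k \<longleftrightarrow> a \<in> power_exps E k"
      by (rule power_exps_zero_on_iff[where B = B]) (use assms(2) B \<open>\<not> a j < B * k\<close> in \<open>auto split: if_splits\<close>)
    ultimately show False using a by (simp add: exps_diff_def)
  qed
  have fin: "finite (exps_diff E F k)" for k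
    by (rule finite_subset[of _ "PiE UNIV (\<lambda>_. {..<B * k})"]) (use lt in \<open>auto intro: finite_PiE\<close>)
  have "power_exps E k \<subseteq> saturation_exps E F k" for k
    using power_exps_subset_zero_on[OF assms(2)] by (auto simp: saturation_exps_def)
  then have len: "module_length mpoly_ring (graded_quot (exps_ideal (saturation_exps E F k))
      (exps_ideal (power_exps E k) :: ('n, 'k) mpoly set)) = enat (card (exps_diff E F k))" for k
    using module_length_exps[OF up_closed_saturation_exps up_closed_power_exps, of E k E F k] fin[of k]
    by (simp add: saturation_exps_diff)
  have "(stratum (exps_diff E F k) (B * k) 0) = exps_diff E F k" for k
    using lt by (auto simp: less_imp_le less_imp_neq)
  then obtain q where q: "q \<in> \<rat>" "(\<lambda>k. real (card (exps_diff E F k)) / real k ^ CARD('n)) \<longlonglongrightarrow> q"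
    using stratum_limit[of E F B 0] assms(2) B by (auto simp: F_def)
  have "ereal (1 / real k ^ CARD('n)) * ereal_of_enat (enat (card (exps_diff E F k))) =
    ereal (real (card (exps_diff E F k)) / real k ^ CARD('n))" for k by simp
  then show ?thesis unfolding len using q by (auto intro!: bexI[of _ q])
qed

theorem corollary2p6:
  fixes I J :: "('n::finite, 'k::field) mpoly set" and d :: int
  assumes "monomial_ideal I" and "monomial_ideal J"
    and "has_limit_dim mpoly_ring
           (\<lambda>k. graded_quot (ideal_saturation mpoly_ring (ideal_power mpoly_ring I k) J)
                            (ideal_power mpoly_ring I k)) d"
  shows "(\<exists>q::rat. (\<lambda>k. 1 / (real k powi (int CARD('n) - d)) *
             of_rat (multiplicity_e0
               (graded_quot (ideal_saturation mpoly_ring (ideal_power mpoly_ring I k) J)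
                            (ideal_power mpoly_ring I k))))
           \<longlonglongrightarrow> of_rat q)
       \<and> (\<exists>q::rat. (\<lambda>k. ereal (1 / real k ^ CARD('n)) *
             ereal_of_enat (module_length mpoly_ring
               (graded_quot
                  (ideal_saturation mpoly_ring (ideal_power mpoly_ring I k) irrelevant_ideal)
                  (ideal_power mpoly_ring I k))))
           \<longlonglongrightarrow> ereal (of_rat q))"
proof -
  obtain E where E: "finite E" "I = exps_ideal {a. \<exists>e\<in>E. \<forall>i. e i \<le> a i}"
    using monomial_ideal_generators[OF assms(1)] .
  obtain F where F: "finite F" "J = exps_ideal {a. \<exists>f\<in>F. \<forall>i. f i \<le> a i}"
    using monomial_ideal_generators[OF assms(2)] .
  note quot = graded_quot_saturation[OF E(1) F(1) E(2) F(2)]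
  obtain q where q: "q \<in> \<rat>" "(\<lambda>k. 1 / (real k powi (int CARD('n) - d)) *
             of_rat (multiplicity_e0
               (graded_quot (ideal_saturation mpoly_ring (ideal_power mpoly_ring I k) J)
                            (ideal_power mpoly_ring I k)))) \<longlonglongrightarrow> q"
    using multiplicity_limit[OF E(1) F(1) assms(3)[unfolded quot]] unfolding quot by blast
  \<comment> \<open>The second limit does not pass through the multiplicity; it uses the same counts
    without capped coordinates, for the generators of the irrelevant ideal.\<close>
  obtain r where r: "r \<in> \<rat>" "(\<lambda>k. ereal (1 / real k ^ CARD('n)) *
             ereal_of_enat (module_length mpoly_ring
               (graded_quot
                  (ideal_saturation mpoly_ring (ideal_power mpoly_ring I k) irrelevant_ideal)
                  (ideal_power mpoly_ring I k)))) \<longlonglongrightarrow> ereal r"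
    using length_limit[OF E(1), where 'k = 'k]
    unfolding graded_quot_saturation[OF E(1) _ E(2) irrelevant_ideal_generators, simplified] by blast
  obtain q' r' where "q = of_rat q'" "r = of_rat r'" using q(1) r(1) by (auto simp: Rats_def)
  then show ?thesis using q(2) r(2) by blast
qed

end
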